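(* Let $p,q\in\mathbb R$. Suppose $\sigma=f\xi$, where $\xi$ is the Hopf vector field on $M=S^{2m+1}$ and $f\colon M\to\mathbb R$ is any smooth function. Then $\sigma$ is a non-trivial (i.e. not the zero section) $(p,q)$-harmonic section of $TM$ if and only if $p>1$ and $f=\pm 1/\sqrt{p-1}$.
   Context: $M=S^{2m+1}\subset\mathbb R^{2m+2}\cong\mathbb C^{m+1}$ is the odd-dimensional unit sphere with the induced Riemannian metric $g$; the bundle is $TM$ with fibre metric $\langle\,,\rangle=g$ and Levi-Civita connection $\nabla$. The Hopf vector field is $\xi(x)=ix$, $i=\sqrt{-1}$. For a vector field $\sigma$ on $M$ put $F=\tfrac12|\sigma|^2\colon M\to\mathbb R$, let $\nabla F$ be its gradient, and $|\nabla\sigma|^2=\sum_i|\nabla_{E_i}\sigma|^2$ for a local orthonormal tangent frame $\{E_i\}$. For $p,q\in\mathbb R$ define a symmetric 2-covariant tensor on the total space $TM$ (with projection $\pi\colon TM\to M$) by $h_{p,q}(A,B)=g(d\pi(A),d\pi(B))+(1+|e|^2)^{-p}\big(\langle KA,KB\rangle+q\langle KA,e\rangle\langle KB,e\rangle\big)$ for $A,B\in T_e(TM)$, where $K\colon T(TM)\to TM$ is the connection map of $\nabla$ (so $K(d\sigma(X))=\nabla_X\sigma$). The vertical $(p,q)$-energy of $\sigma$ (half the integral of the $h_{p,q}$-square norm of the vertical part of $d\sigma$) is $$E^v_{p,q}(\sigma)=\frac12\int_M\frac{1}{(1+|\sigma|^2)^p}\big(|\nabla\sigma|^2+q|\nabla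 F|^2\big)\,\mathrm{vol}(g).$$ $\sigma$ is a $(p,q)$-harmonic section of $TM$ if $\frac{d}{dt}\big|_{t=0}E^v_{p,q}(\sigma_t)=0$ for every smooth variation $\sigma_t$ of $\sigma_0=\sigma$ through vector fields (sections of $TM$).
   Formalization: The formal theorem assumes m ≥ 1; for m = 0 (the circle) the Hopf field is parallel, so fξ with any nonzero constant f is a non-trivial (p,q)-harmonic section for every p and q, and the claim fails there. *)

theory Defs
  imports "HOL-Analysis.Analysis"
begin

section \<open>Smooth maps on subsets of Euclidean space\<close>

text \<open>Only meaningful for open \<open>U\<close>: in finite dimension, a map is \<open>C\<^sup>k\<^sup>+\<^sup>1\<close> iff it is
  differentiable and all its directional derivatives are \<open>C\<^sup>k\<close>.\<close>

primrec ck_on :: "nat \<Rightarrow> 'a::euclidean_space set \<Rightarrow> ('a \<Rightarrow> 'b::real_normed_vector) \<Rightarrow> bool" where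
  "ck_on 0 U f = continuous_on U f"
| "ck_on (Suc k) U f =
     ((\<forall>x\<in>U. f differentiable (at x)) \<and> (\<forall>v. ck_on k U (\<lambda>x. frechet_derivative f (at x) v)))"

text \<open>\<open>C\<^sup>\<infinity>\<close> maps on an arbitrary subset, by local smooth extension; on an embedded submanifold
  these are the maps that are smooth in charts. Values of \<open>f\<close> off \<open>S\<close> are irrelevant.\<close>

definition smooth_on :: "'a::euclidean_space set \<Rightarrow> ('a \<Rightarrow> 'b::real_normed_vector) \<Rightarrow> bool" where
  "smooth_on S f \<longleftrightarrow>
     (\<forall>x\<in>S. \<exists>U g. open U \<and> x \<in> U \<and> (\<forall>k. ck_on k U g) \<and> (\<forall>y\<in>S \<inter> U. g y = f y))"

section \<open>Geometry of the unit sphere with the induced metric\<close>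

definition tangent :: "'a::euclidean_space \<Rightarrow> 'a set" where
  "tangent x = {v. x \<bullet> v = 0}"

definition vector_field :: "('a::euclidean_space \<Rightarrow> 'a) \<Rightarrow> bool" where
  "vector_field X \<longleftrightarrow> smooth_on (sphere 0 1) X \<and> (\<forall>x\<in>sphere 0 1. X x \<in> tangent x)"

text \<open>The differential \<open>du\<^sub>x(v)\<close> of a map on the sphere. The derivative within the sphere is
  determined only in tangential directions, so this is to be used for \<open>v \<in> tangent x\<close> only;
  see \<open>sphere_deriv_eq\<close> below.\<close>

definition sphere_deriv :: "('a::euclidean_space \<Rightarrow> 'b::real_normed_vector) \<Rightarrow> 'a \<Rightarrow> 'a \<Rightarrow> 'b" where
  "sphere_deriv u x v = frechet_derivative u (at x within sphere 0 1) v"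

definition sphere_grad :: "('a::euclidean_space \<Rightarrow> real) \<Rightarrow> 'a \<Rightarrow> 'a" where
  "sphere_grad u x = (THE w. w \<in> tangent x \<and> (\<forall>v\<in>tangent x. w \<bullet> v = sphere_deriv u x v))"

text \<open>The Lie bracket \<open>[X,Y] = dY(X) - dX(Y)\<close> in the coordinates of the ambient space.\<close>

definition lie_bracket ::
    "('a::euclidean_space \<Rightarrow> 'a) \<Rightarrow> ('a \<Rightarrow> 'a) \<Rightarrow> 'a \<Rightarrow> 'a" where
  "lie_bracket X Y x = sphere_deriv Y x (X x) - sphere_deriv X x (Y x)"

text \<open>\<open>nabla x v Y\<close> stands for \<open>(\<nabla>\<^sub>v Y)(x)\<close> with \<open>v \<in> tangent x\<close>: the operator is a linear connection
  on the tangent bundle, compatible with the metric and torsion-free. It exists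
  (\<open>levi_civita_tangential\<close> below), and these conditions determine it on tangent vectors and
  vector fields.\<close>

definition levi_civita :: "('a::euclidean_space \<Rightarrow> 'a \<Rightarrow> ('a \<Rightarrow> 'a) \<Rightarrow> 'a) \<Rightarrow> bool" where
  "levi_civita nabla \<longleftrightarrow>
     (\<forall>X Y. vector_field X \<longrightarrow> vector_field Y \<longrightarrow> vector_field (\<lambda>x. nabla x (X x) Y)) \<and>
     (\<forall>x\<in>sphere 0 1. \<forall>v\<in>tangent x. \<forall>w\<in>tangent x. \<forall>a b Y. vector_field Y \<longrightarrow>
        nabla x (a *\<^sub>R v + b *\<^sub>R w) Y = a *\<^sub>R nabla x v Y + b *\<^sub>R nabla x w Y) \<and>
     (\<forall>x\<in>sphere 0 1. \<forall>v\<in>tangent x. \<forall>Y Z. vector_field Y \<longrightarrow> vector_field Z \<longrightarrow>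
        nabla x v (\<lambda>y. Y y + Z y) = nabla x v Y + nabla x v Z) \<and>
     (\<forall>x\<in>sphere 0 1. \<forall>v\<in>tangent x. \<forall>u Y. smooth_on (sphere 0 1) u \<longrightarrow> vector_field Y \<longrightarrow>
        nabla x v (\<lambda>y. u y *\<^sub>R Y y) = sphere_deriv u x v *\<^sub>R Y x + u x *\<^sub>R nabla x v Y) \<and>
     (\<forall>x\<in>sphere 0 1. \<forall>v\<in>tangent x. \<forall>Y Z. vector_field Y \<longrightarrow> vector_field Z \<longrightarrow>
        sphere_deriv (\<lambda>y. Y y \<bullet> Z y) x v = nabla x v Y \<bullet> Z x + Y x \<bullet> nabla x v Z) \<and>
     (\<forall>x\<in>sphere 0 1. \<forall>X Y. vector_field X \<longrightarrow> vector_field Y \<longrightarrow>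
        nabla x (X x) Y - nabla x (Y x) X = lie_bracket X Y x)"

definition tangent_onb :: "'a::euclidean_space \<Rightarrow> 'a set \<Rightarrow> bool" where
  "tangent_onb x B \<longleftrightarrow>
     B \<subseteq> tangent x \<and> pairwise orthogonal B \<and> (\<forall>b\<in>B. norm b = 1) \<and> span B = tangent x"

text \<open>\<open>|\<nabla>\<sigma>|\<^sup>2\<close> at \<open>x\<close>; the value does not depend on the chosen orthonormal basis.\<close>

definition nabla_norm_sq ::
    "('a::euclidean_space \<Rightarrow> 'a \<Rightarrow> ('a \<Rightarrow> 'a) \<Rightarrow> 'a) \<Rightarrow> ('a \<Rightarrow> 'a) \<Rightarrow> 'a \<Rightarrow> real" where
  "nabla_norm_sq nabla \<sigma> x = (\<Sum>e\<in>(SOME B. tangent_onb x B). (norm (nabla x e \<sigma>))\<^sup>2)"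

text \<open>The Riemannian volume measure of the unit sphere of an \<open>n\<close>-dimensional Euclidean space.
  By polar coordinates, Lebesgue measure is \<open>r\<^sup>n\<^sup>-\<^sup>1 dr \<otimes> vol\<close>, so the volume of \<open>A\<close> is \<open>n\<close> times
  the Lebesgue measure of the cone \<open>{y. 0 < |y| < 1 \<and> y/|y| \<in> A}\<close>.\<close>

definition sphere_volume :: "'a::euclidean_space measure" where
  "sphere_volume =
     density
       (distr (restrict_space lborel (ball 0 1 - {0})) (restrict_space borel (sphere 0 1)) sgn)
       (\<lambda>_. ennreal (real DIM('a)))"

section \<open>The vertical energy and harmonic sections\<close>

definition vertical_energy ::
    "('a::euclidean_space \<Rightarrow> 'a \<Rightarrow> ('a \<Rightarrow> 'a) \<Rightarrow> 'a) \<Rightarrow> real \<Rightarrow> real \<Rightarrow> ('a \<Rightarrow> 'a) \<Rightarrow> real" where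
  "vertical_energy nabla p q \<sigma> =
     (1/2) * (\<integral>x. 1 / (1 + (norm (\<sigma> x))\<^sup>2) powr p *
        (nabla_norm_sq nabla \<sigma> x + q * (norm (sphere_grad (\<lambda>y. (norm (\<sigma> y))\<^sup>2 / 2) x))\<^sup>2)
        \<partial>sphere_volume)"

definition smooth_variation ::
    "('a::euclidean_space \<Rightarrow> 'a) \<Rightarrow> real \<Rightarrow> (real \<Rightarrow> 'a \<Rightarrow> 'a) \<Rightarrow> bool" where
  "smooth_variation \<sigma> \<epsilon> \<Sigma> \<longleftrightarrow>
     \<epsilon> > 0 \<and>
     smooth_on ({-\<epsilon><..<\<epsilon>} \<times> sphere 0 1) (\<lambda>(t, x). \<Sigma> t x) \<and>
     (\<forall>t\<in>{-\<epsilon><..<\<epsilon>}. \<forall>x\<in>sphere 0 1. \<Sigma> t x \<in> tangent x) \<and>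
     (\<forall>x\<in>sphere 0 1. \<Sigma> 0 x = \<sigma> x)"

definition harmonic_section ::
    "('a::euclidean_space \<Rightarrow> 'a \<Rightarrow> ('a \<Rightarrow> 'a) \<Rightarrow> 'a) \<Rightarrow> real \<Rightarrow> real \<Rightarrow> ('a \<Rightarrow> 'a) \<Rightarrow> bool" where
  "harmonic_section nabla p q \<sigma> \<longleftrightarrow>
     vector_field \<sigma> \<and>
     (\<forall>\<epsilon> \<Sigma>. smooth_variation \<sigma> \<epsilon> \<Sigma> \<longrightarrow>
        ((\<lambda>t. vertical_energy nabla p q (\<Sigma> t)) has_real_derivative 0) (at 0))"

definition hopf :: "complex ^ 'n \<Rightarrow> complex ^ 'n" where
  "hopf x = \<i> *s x"

section \<open>Well-definedness\<close>

lemma sphere_deriv_eq: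
  fixes u :: "'a::euclidean_space \<Rightarrow> 'b::real_normed_vector"
  assumes D: "(u has_derivative D) (at x within sphere 0 1)"
    and x: "x \<in> sphere 0 1" and v: "v \<in> tangent x"
  shows "sphere_deriv u x v = D v"
proof -
  have nx: "norm x = 1" using x by simp
  have ortho: "x \<bullet> v = 0" using v by (simp add: tangent_def)
  have unique: "E v = D' v"
    if E: "(u has_derivative E) (at x within sphere 0 1)"
      and D': "(u has_derivative D') (at x within sphere 0 1)" for E D'
  proof (cases "v = 0")
    case True
    then show ?thesis using has_derivative_linear[OF E] has_derivative_linear[OF D']
      by (simp add: linear_0)
  next
    case False
    define w where "w = v /\<^sub>R norm v"
    have w: "norm w = 1" "x \<bullet> w = 0" "v = norm v *\<^sub>R w"
      using False ortho by (auto simp: w_def)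
    define c where "c = (\<lambda>t::real. cos t *\<^sub>R x + sin t *\<^sub>R w)"
    have c0: "c 0 = x" by (simp add: c_def)
    have "x \<bullet> x = 1" "w \<bullet> w = 1" "w \<bullet> x = 0"
      using nx w by (simp_all add: norm_eq_1 inner_commute)
    then have "c t \<bullet> c t = (cos t)\<^sup>2 + (sin t)\<^sup>2" for t
      using w(2) by (simp add: c_def inner_add_left inner_add_right power2_eq_square)
    then have cS: "c t \<in> sphere 0 1" for t
      by (simp add: norm_eq_1)
    have dc: "(c has_derivative (\<lambda>h. h *\<^sub>R w)) (at 0)"
      unfolding c_def by (auto intro!: derivative_eq_intros)
    have "((u \<circ> c) has_derivative (F \<circ> (\<lambda>h. h *\<^sub>R w))) (at 0)"
      if F: "(u has_derivative F) (at x within sphere 0 1)" for F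
    proof (rule diff_chain_within[where s=UNIV, simplified])
      show "(c has_derivative (\<lambda>h. h *\<^sub>R w)) (at 0)" by (rule dc)
      show "(u has_derivative F) (at (c 0) within range c)"
        unfolding c0 by (rule has_derivative_subset[OF F]) (use cS in auto)
    qed
    from has_derivative_unique[OF this[OF E] this[OF D']]
    have "(E \<circ> (\<lambda>h. h *\<^sub>R w)) (norm v) = (D' \<circ> (\<lambda>h. h *\<^sub>R w)) (norm v)"
      by simp
    then show ?thesis using w(3) by simp
  qed
  have "(u has_derivative frechet_derivative u (at x within sphere 0 1)) (at x within sphere 0 1)"
    using D frechet_derivative_works differentiable_def by blast
  from unique[OF this D] show ?thesis by (simp add: sphere_deriv_def)
qed

lemma ck_on_cong:
  assumes "open U" "ck_on k U f" "\<And>x. x \<in> U \<Longrightarrow> f x = g x"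
  shows "ck_on k U g"
  using assms(2,3)
proof (induction k arbitrary: f g)
  case 0
  then show ?case using continuous_on_cong by fastforce
next
  case (Suc k)
  have d: "(g has_derivative frechet_derivative f (at x)) (at x)" if "x \<in> U" for x
  proof (rule has_derivative_transform_within_open[OF _ \<open>open U\<close> that])
    show "(f has_derivative frechet_derivative f (at x)) (at x)"
      using Suc.prems(1) that frechet_derivative_works by auto
  qed (use Suc.prems in auto)
  have "frechet_derivative f (at x) v = frechet_derivative g (at x) v" if "x \<in> U" for x v
    using frechet_derivative_at[OF d[OF that]] by simp
  then have "ck_on k U (\<lambda>x. frechet_derivative g (at x) v)" for v
    using Suc.IH[of "\<lambda>x. frechet_derivative f (at x) v"] Suc.prems(1) by simp
  moreover have "\<forall>x\<in>U. g differentiable (at x)"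
    using d unfolding differentiable_def by blast
  ultimately show ?case by simp
qed

lemma ck_on_subset: "ck_on k U f \<Longrightarrow> V \<subseteq> U \<Longrightarrow> ck_on k V f"
  by (induction k arbitrary: f) (auto intro: continuous_on_subset)

lemma ck_on_Suc: "ck_on (Suc k) U f \<Longrightarrow> ck_on k U f"
proof (induction k arbitrary: f)
  case 0
  then show ?case
    by (auto intro!: continuous_at_imp_continuous_on differentiable_imp_continuous_within)
next
  case (Suc k)
  then show ?case by (metis ck_on.simps(2))
qed

lemma ck_on_const: "ck_on k U (\<lambda>x. c)"
  by (induction k arbitrary: c) auto

lemma ck_on_linear:
  assumes "bounded_linear f" shows "ck_on k U f"
proof (cases k)
  case 0
  then show ?thesis using assms by (simp add: linear_continuous_on)
next
  case (Suc n)
  have "frechet_derivative f (at x) = f" for x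
    using frechet_derivative_at[OF bounded_linear_imp_has_derivative[OF assms]] by simp
  then show ?thesis using Suc assms
    by (auto simp: ck_on_const bounded_linear_imp_differentiable)
qed

lemma ck_on_add:
  assumes U: "open U" and "ck_on k U f" "ck_on k U g"
  shows "ck_on k U (\<lambda>x. f x + g x)"
  using assms(2,3)
proof (induction k arbitrary: f g)
  case 0
  then show ?case by (auto intro: continuous_on_add)
next
  case (Suc k)
  let ?fg = "\<lambda>x. f x + g x"
  have d: "((\<lambda>x. f x + g x) has_derivative
      (\<lambda>v. frechet_derivative f (at x) v + frechet_derivative g (at x) v)) (at x)" if "x \<in> U" for x
    using Suc.prems that by (intro has_derivative_add) (simp_all flip: frechet_derivative_works)
  have "ck_on k U (\<lambda>x. frechet_derivative f (at x) v + frechet_derivative g (at x) v)" for v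
    using Suc by auto
  then have "ck_on k U (\<lambda>x. frechet_derivative (\<lambda>x. f x + g x) (at x) v)" for v
    by (rule ck_on_cong[OF U]) (simp add: frechet_derivative_at[OF d, symmetric])
  moreover have "\<forall>x\<in>U. ?fg differentiable (at x)"
    using d unfolding differentiable_def by blast
  ultimately show ?case by simp
qed

lemma ck_on_bilinear:
  assumes U: "open U" and B: "bounded_bilinear B" and "ck_on k U f" "ck_on k U g"
  shows "ck_on k U (\<lambda>x. B (f x) (g x))"
  using assms(3,4)
proof (induction k arbitrary: f g)
  case 0
  then show ?case by (auto intro: bounded_bilinear.continuous_on[OF B])
next
  case (Suc k)
  let ?fg = "\<lambda>x. B (f x) (g x)"
  have d: "((\<lambda>x. B (f x) (g x)) has_derivative
      (\<lambda>v. B (f x) (frechet_derivative g (at x) v) + B (frechet_derivative f (at x) v) (g x))) (at x)"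
    if "x \<in> U" for x
    using Suc.prems that
    by (intro bounded_bilinear.FDERIV[OF B]) (simp_all flip: frechet_derivative_works)
  have "ck_on k U f" "ck_on k U g" using Suc.prems ck_on_Suc by blast+
  then have "ck_on k U
     (\<lambda>x. B (f x) (frechet_derivative g (at x) v) + B (frechet_derivative f (at x) v) (g x))" for v
    using Suc by (intro ck_on_add[OF U]) auto
  then have "ck_on k U (\<lambda>x. frechet_derivative (\<lambda>x. B (f x) (g x)) (at x) v)" for v
    by (rule ck_on_cong[OF U]) (simp add: frechet_derivative_at[OF d, symmetric])
  moreover have "\<forall>x\<in>U. ?fg differentiable (at x)"
    using d unfolding differentiable_def by blast
  ultimately show ?case by simp
qed

lemma ck_on_sum:
  assumes "open U" "finite I" "\<And>i. i \<in> I \<Longrightarrow> ck_on k U (f i)"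
  shows "ck_on k U (\<lambda>x. \<Sum>i\<in>I. f i x)"
  using assms(2,3) by induction (auto simp: ck_on_const intro: ck_on_add[OF assms(1)])

lemma smooth_on_bilinear:
  assumes B: "bounded_bilinear B" and f: "smooth_on S f" and g: "smooth_on S g"
  shows "smooth_on S (\<lambda>x. B (f x) (g x))"
  unfolding smooth_on_def
proof
  fix x assume "x \<in> S"
  then obtain U F V G where
    U: "open U" "x \<in> U" "\<And>k. ck_on k U F" "\<And>y. y \<in> S \<inter> U \<Longrightarrow> F y = f y" and
    V: "open V" "x \<in> V" "\<And>k. ck_on k V G" "\<And>y. y \<in> S \<inter> V \<Longrightarrow> G y = g y"
    using f g unfolding smooth_on_def by metis
  have "ck_on k (U \<inter> V) (\<lambda>x. B (F x) (G x))" for k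
    using U V by (intro ck_on_bilinear[OF open_Int B]) (auto intro: ck_on_subset)
  then show "\<exists>W H. open W \<and> x \<in> W \<and> (\<forall>k. ck_on k W H) \<and> (\<forall>y\<in>S \<inter> W. H y = B (f y) (g y))"
    using U V by (intro exI[of _ "U \<inter> V"] exI[of _ "\<lambda>x. B (F x) (G x)"]) auto
qed

lemma smooth_on_add:
  assumes f: "smooth_on S f" and g: "smooth_on S g"
  shows "smooth_on S (\<lambda>x. f x + g x)"
  unfolding smooth_on_def
proof
  fix x assume "x \<in> S"
  then obtain U F V G where
    U: "open U" "x \<in> U" "\<And>k. ck_on k U F" "\<And>y. y \<in> S \<inter> U \<Longrightarrow> F y = f y" and
    V: "open V" "x \<in> V" "\<And>k. ck_on k V G" "\<And>y. y \<in> S \<inter> V \<Longrightarrow> G y = g y"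
    using f g unfolding smooth_on_def by metis
  have "ck_on k (U \<inter> V) (\<lambda>x. F x + G x)" for k
    using U V by (intro ck_on_add) (auto intro: ck_on_subset)
  then show "\<exists>W H. open W \<and> x \<in> W \<and> (\<forall>k. ck_on k W H) \<and> (\<forall>y\<in>S \<inter> W. H y = f y + g y)"
    using U V by (intro exI[of _ "U \<inter> V"] exI[of _ "\<lambda>x. F x + G x"]) auto
qed

lemma smooth_on_linear: "bounded_linear f \<Longrightarrow> smooth_on S f"
  unfolding smooth_on_def by (auto intro!: exI[of _ UNIV] exI[of _ f] ck_on_linear)

lemma smooth_on_const: "smooth_on S (\<lambda>x. c)"
  unfolding smooth_on_def by (auto intro!: exI[of _ UNIV] exI[of _ "\<lambda>x. c"] ck_on_const)

lemma local_extension_deriv: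
  assumes U: "open U" "x \<in> U" "\<And>k. ck_on k U G" "\<And>y. y \<in> S \<inter> U \<Longrightarrow> G y = u y" and x: "x \<in> S"
  shows "(u has_derivative frechet_derivative G (at x)) (at x within S)"
proof -
  obtain d where d: "d > 0" "ball x d \<subseteq> U"
    using U(1,2) open_contains_ball by blast
  have "G differentiable (at x)" using U(2) U(3)[of 1] by auto
  then have "(G has_derivative frechet_derivative G (at x)) (at x within S)"
    using frechet_derivative_works has_derivative_at_withinI by blast
  then show ?thesis
    by (rule has_derivative_transform_within[OF _ d(1) x])
       (use d(2) U(4) in \<open>auto simp: subset_iff dist_commute\<close>)
qed

lemma sphere_deriv_works:
  assumes "smooth_on (sphere 0 1) u" "x \<in> sphere 0 1"
  shows "(u has_derivative sphere_deriv u x) (at x within sphere 0 1)"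
proof -
  obtain U G where "open U" "x \<in> U" "\<And>k. ck_on k U G" "\<And>y. y \<in> sphere 0 1 \<inter> U \<Longrightarrow> G y = u y"
    using assms unfolding smooth_on_def by metis
  from local_extension_deriv[OF this assms(2)]
  have "u differentiable (at x within sphere 0 1)" by (auto simp: differentiable_def)
  then show ?thesis
    unfolding sphere_deriv_def[abs_def] by (simp add: frechet_derivative_works)
qed

lemma smooth_on_sphere_deriv:
  fixes Y :: "'a::euclidean_space \<Rightarrow> 'b::real_normed_vector"
  assumes X: "vector_field X" and Y: "smooth_on (sphere 0 1) Y"
  shows "smooth_on (sphere 0 1) (\<lambda>x. sphere_deriv Y x (X x))"
  unfolding smooth_on_def
proof
  let ?S = "sphere 0 1 :: 'a set"
  fix x assume x: "x \<in> ?S"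
  have Xs: "smooth_on ?S X" and Xt: "\<And>y. y \<in> ?S \<Longrightarrow> X y \<in> tangent y"
    using X by (auto simp: vector_field_def)
  obtain U F V G where
    U: "open U" "x \<in> U" "\<And>k. ck_on k U F" "\<And>y. y \<in> ?S \<inter> U \<Longrightarrow> F y = X y" and
    V: "open V" "x \<in> V" "\<And>k. ck_on k V G" "\<And>y. y \<in> ?S \<inter> V \<Longrightarrow> G y = Y y"
    using Xs Y x unfolding smooth_on_def by metis
  define H where "H = (\<lambda>y. \<Sum>b\<in>Basis. (F y \<bullet> b) *\<^sub>R frechet_derivative G (at y) b)"
  have UV: "open (U \<inter> V)" using U V by auto
  have F: "ck_on k (U \<inter> V) F" for k using U ck_on_subset by blast
  have dG: "ck_on k (U \<inter> V) (\<lambda>y. frechet_derivative G (at y) b)" for k b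
    using V(3)[of "Suc k"] by (auto intro: ck_on_subset[of k V])
  have "ck_on k (U \<inter> V) H" for k
    unfolding H_def
    by (intro ck_on_sum UV ck_on_bilinear[OF UV bounded_bilinear_scaleR]
        ck_on_bilinear[OF UV bounded_bilinear_inner] F dG ck_on_const finite_Basis)
  moreover have "H y = sphere_deriv Y y (X y)" if y: "y \<in> ?S \<inter> (U \<inter> V)" for y
  proof -
    have "(Y has_derivative frechet_derivative G (at y)) (at y within ?S)"
      by (rule local_extension_deriv[OF V(1) _ V(3,4)]) (use y in auto)
    then have e: "sphere_deriv Y y (X y) = frechet_derivative G (at y) (X y)"
      and l: "linear (frechet_derivative G (at y))"
      using sphere_deriv_eq y Xt has_derivative_linear by blast+
    have "frechet_derivative G (at y) (X y) =
        frechet_derivative G (at y) (\<Sum>b\<in>Basis. (X y \<bullet> b) *\<^sub>R b)"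
      by (simp add: euclidean_representation)
    also have "\<dots> = H y"
      using U(4)[of y] y by (simp add: H_def linear_sum[OF l] linear_scale[OF l])
    finally show ?thesis using e by simp
  qed
  ultimately show "\<exists>W H. open W \<and> x \<in> W \<and> (\<forall>k. ck_on k W H) \<and>
      (\<forall>y\<in>?S \<inter> W. H y = sphere_deriv Y y (X y))"
    using UV U(2) V(2) by blast
qed

text \<open>The Levi-Civita connection is the tangential part of the ambient derivative.\<close>

lemma levi_civita_tangential:
  "levi_civita (\<lambda>x v Y. sphere_deriv Y x v - (x \<bullet> sphere_deriv Y x v) *\<^sub>R (x::'a::euclidean_space))"
proof -
  let ?S = "sphere 0 1 :: 'a set"
  let ?D = "\<lambda>x v (Y::'a \<Rightarrow> 'a). sphere_deriv Y x v - (x \<bullet> sphere_deriv Y x v) *\<^sub>R (x::'a)"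
  have xx: "x \<bullet> x = 1" if "x \<in> ?S" for x using that by (simp add: norm_eq_1)
  have lin: "linear (sphere_deriv Y x)" if "x \<in> ?S" "vector_field Y" for x and Y :: "'a \<Rightarrow> 'a"
    using that unfolding vector_field_def by (blast intro: has_derivative_linear sphere_deriv_works)
  have w: "(Y has_derivative sphere_deriv Y x) (at x within ?S)" if "x \<in> ?S" "vector_field Y"
    for x and Y :: "'a \<Rightarrow> 'a"
    using that unfolding vector_field_def by (blast intro: sphere_deriv_works)
  have vf: "vector_field (\<lambda>x. ?D x (X x) Y)" if X: "vector_field X" and Y: "vector_field Y" for X Y
  proof -
    have d: "smooth_on ?S (\<lambda>x. sphere_deriv Y x (X x))"
      using X Y smooth_on_sphere_deriv by (auto simp: vector_field_def)
    have i: "smooth_on ?S (\<lambda>x. x)" by (intro smooth_on_linear bounded_linear_ident)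
    have "smooth_on ?S (\<lambda>x. sphere_deriv Y x (X x) + (-1) *\<^sub>R ((x \<bullet> sphere_deriv Y x (X x)) *\<^sub>R x))"
      by (intro smooth_on_add d smooth_on_bilinear[OF bounded_bilinear_scaleR] smooth_on_const
          smooth_on_bilinear[OF bounded_bilinear_inner] i)
    then show ?thesis
      by (auto simp: vector_field_def tangent_def inner_diff_right xx simp del: mem_sphere)
  qed
  have add: "sphere_deriv (\<lambda>y. Y y + Z y) x v = sphere_deriv Y x v + sphere_deriv Z x v"
    if "x \<in> ?S" "v \<in> tangent x" "vector_field Y" "vector_field Z" for x v and Y Z :: "'a \<Rightarrow> 'a"
    using that by (intro sphere_deriv_eq has_derivative_add w)
  have leib: "sphere_deriv (\<lambda>y. u y *\<^sub>R Y y) x v = u x *\<^sub>R sphere_deriv Y x v + sphere_deriv u x v *\<^sub>R Y x"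
    if "x \<in> ?S" "v \<in> tangent x" "smooth_on ?S u" "vector_field Y" for x v u and Y :: "'a \<Rightarrow> 'a"
    using that by (intro sphere_deriv_eq has_derivative_scaleR w sphere_deriv_works)
  have met: "sphere_deriv (\<lambda>y. Y y \<bullet> Z y) x v = Y x \<bullet> sphere_deriv Z x v + sphere_deriv Y x v \<bullet> Z x"
    if "x \<in> ?S" "v \<in> tangent x" "vector_field Y" "vector_field Z" for x v and Y Z :: "'a \<Rightarrow> 'a"
    using that by (intro sphere_deriv_eq has_derivative_inner w)
  have tan: "x \<bullet> Y x = 0" "Y x \<bullet> x = 0" if "x \<in> ?S" "vector_field Y" for x and Y :: "'a \<Rightarrow> 'a"
    using that by (auto simp: vector_field_def tangent_def inner_commute)
  have sym: "x \<bullet> sphere_deriv Y x (X x) = - (X x \<bullet> Y x)"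
    if "x \<in> ?S" "vector_field X" "vector_field Y" for x and X Y :: "'a \<Rightarrow> 'a"
  proof -
    have t: "X x \<in> tangent x" using that by (auto simp: vector_field_def)
    have "((\<lambda>y. y \<bullet> Y y) has_derivative (\<lambda>h. x \<bullet> sphere_deriv Y x h + h \<bullet> Y x)) (at x within ?S)"
      using that by (intro has_derivative_inner w has_derivative_ident)
    moreover have "((\<lambda>y. y \<bullet> Y y) has_derivative (\<lambda>h. 0)) (at x within ?S)"
      using that(1) by (rule has_derivative_transform) (auto simp: tan that simp del: mem_sphere)
    ultimately have "x \<bullet> sphere_deriv Y x (X x) + X x \<bullet> Y x = 0"
      using sphere_deriv_eq[OF _ that(1) t] by metis
    then show ?thesis by simp
  qed
  show ?thesis
    unfolding levi_civita_def
  proof (intro conjI allI ballI impI)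
    fix X Y :: "'a \<Rightarrow> 'a"
    assume "vector_field X" "vector_field Y"
    then show "vector_field (\<lambda>x. ?D x (X x) Y)" by (rule vf)
  next
    fix x v w :: 'a and a b and Y :: "'a \<Rightarrow> 'a"
    assume "x \<in> ?S" "vector_field Y"
    then show "?D x (a *\<^sub>R v + b *\<^sub>R w) Y = a *\<^sub>R ?D x v Y + b *\<^sub>R ?D x w Y"
      using lin[of x Y] by (simp add: linear_add linear_scale inner_add_right algebra_simps)
  next
    fix x v :: 'a and Y Z :: "'a \<Rightarrow> 'a"
    assume "x \<in> ?S" "v \<in> tangent x" "vector_field Y" "vector_field Z"
    then show "?D x v (\<lambda>y. Y y + Z y) = ?D x v Y + ?D x v Z"
      using add[of x v Y Z] by (simp add: inner_add_right algebra_simps)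
  next
    fix x v :: 'a and u :: "'a \<Rightarrow> real" and Y :: "'a \<Rightarrow> 'a"
    assume *: "x \<in> ?S" "v \<in> tangent x" "smooth_on ?S u" "vector_field Y"
    then show "?D x v (\<lambda>y. u y *\<^sub>R Y y) = sphere_deriv u x v *\<^sub>R Y x + u x *\<^sub>R ?D x v Y"
      using leib[OF *] tan(1)[OF *(1,4)] by (simp add: inner_add_right algebra_simps)
  next
    fix x v :: 'a and Y Z :: "'a \<Rightarrow> 'a"
    assume *: "x \<in> ?S" "v \<in> tangent x" "vector_field Y" "vector_field Z"
    then show "sphere_deriv (\<lambda>y. Y y \<bullet> Z y) x v = ?D x v Y \<bullet> Z x + Y x \<bullet> ?D x v Z"
      using met[OF *] tan(1)[OF *(1,4)] tan(2)[OF *(1,3)]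
      by (simp add: inner_diff_left inner_diff_right)
  next
    fix x :: 'a and X Y :: "'a \<Rightarrow> 'a"
    assume "x \<in> ?S" "vector_field X" "vector_field Y"
    then show "?D x (X x) Y - ?D x (Y x) X = lie_bracket X Y x"
      using sym[of x X Y] sym[of x Y X] by (simp add: lie_bracket_def inner_commute)
  qed
qed

end

theory Submission
  imports Defs
begin

text \<open>A vector field is \<open>(p,q)\<close>-harmonic iff the linearised energy vanishes against every vector
  field \<open>\<eta>\<close>. For \<open>\<sigma> = f \<xi>\<close> and \<open>\<eta>\<close> orthogonal to \<open>\<xi>\<close>, integration by parts along rotations turns
  the linearised energy into the integral of \<open>2 (1 + f\<^sup>2)\<^sup>-\<^sup>p\<^sup>-\<^sup>1 (1 +
      (1 - p) f\<^sup>2) df(i \<eta>)\<close>, so harmonicity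
  makes \<open>f + (1 - p) f\<^sup>3 / 3\<close> constant along great circles orthogonal to the Hopf fibres. Any two
  points are joined by such circles, so \<open>f\<close> is a constant \<open>c\<close>. For constant \<open>f\<close>, the linearised
      energy
  is a multiple of \<open>c (1 + (1 - p) c\<^sup>2)\<close> times the integral of \<open>\<eta> \<bullet> \<xi>\<close>.\<close>

section \<open>Rotation invariance of the volume of the sphere\<close>

text \<open>The Euler-Lagrange equation for \<open>f\<close> is of second order, but test fields
  orthogonal to the Hopf field see only a first-order part of it: the derivative of the test field
  enters through its trace against the skew map \<open>hopf\<close>, and integrating that trace by
  parts puts one derivative on \<open>f\<close> and never a second one. The parameter
  \<open>q\<close> drops out in both regimes: for horizontal \<open>\<eta>\<close> each
  \<open>q\<close>-summand has the derivative of \<open>\<sigma> \<bullet> \<eta> = 0\<close> as a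
  factor, and for constant \<open>f\<close> the length of \<open>\<sigma>\<close> is constant. The
  factor \<open>1 + (1 - p) f^2\<close> may vanish somewhere, so the horizontal equation cannot be
  divided by it; its primitive, a cubic in \<open>f\<close>, is transported instead, and finiteness
  of the roots of a cubic together with connectedness of the sphere recovers \<open>f\<close>.
  Integration by parts does not go through Stokes' theorem: it is the derivative of the rotation
  invariance of the volume, which is why that invariance is derived from Lebesgue measure.\<close>

lemma nn_integral_lborel_translate:
  fixes g :: "'a::euclidean_space \<Rightarrow> ennreal"
  assumes [measurable]: "g \<in> borel_measurable borel"
  shows "(\<integral>\<^sup>+y. g (y + c) \<partial>lborel) = (\<integral>\<^sup>+y. g y \<partial>lborel)"
proof -
  have "(\<integral>\<^sup>+y. g y \<partial>lborel) = (\<integral>\<^sup>+y. g y \<partial>distr lborel borel ((+) c))"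
    by (simp add: lborel_distr_plus)
  also have "\<dots> = (\<integral>\<^sup>+y. g (y + c) \<partial>lborel)"
    by (subst nn_integral_distr) (auto simp: add.commute)
  finally show ?thesis by simp
qed

text \<open>Uniqueness of Haar measure, specialised: \<open>\<lambda>(R\<^sup>-\<^sup>1A) \<lambda>(B) = \<lambda>(A) \<lambda>(B)\<close> for the unit ball
  \<open>B\<close>, by translation invariance and Fubini.\<close>

lemma lborel_distr_orthogonal:
  fixes R :: "'a::euclidean_space \<Rightarrow> 'a"
  assumes R: "orthogonal_transformation R"
  shows "distr lborel borel R = lborel"
proof (rule measure_eqI)
  fix A assume "A \<in> sets (distr lborel borel R)"
  then have A[measurable]: "A \<in> sets borel" by simp
  have lin: "linear R" using R by (simp add: orthogonal_transformation_linear)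
  have Rm[measurable]: "R \<in> borel_measurable borel"
    by (intro borel_measurable_continuous_onI linear_continuous_on linear_conv_bounded_linear[THEN
        iffD1] lin)
  define B where "B = ball (0::'a) 1"
  have [measurable]: "B \<in> sets borel" by (simp add: B_def)
  obtain Q where Q: "\<And>x. R (Q x) = x"
    using orthogonal_transformation_surj[OF R] by (metis surjD)
  let ?A = "indicator A :: 'a \<Rightarrow> ennreal" and ?B = "indicator B :: 'a \<Rightarrow> ennreal"
  \<comment> \<open>The ball is invariant under isometries and under the reflection at 0, so the
    constant comparing the two translation-invariant measures is 1; for a general \<open>B\<close>
    only proportionality would come out.\<close>
  have Bsym: "?B (x - R y) = ?B (y - Q x)" for x y
  proof -
    have "norm (x - R y) = norm (R (Q x - y))" using lin Q by (simp add: linear_diff)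
    also have "\<dots> = norm (y - Q x)"
      using orthogonal_transformation_norm[OF R] by (simp add: norm_minus_commute)
    finally show ?thesis by (simp add: B_def indicator_def)
  qed
  have "emeasure (distr lborel borel R) A * emeasure lborel B = (\<integral>\<^sup>+y. ?A (R y) \<partial>lborel) *
      (\<integral>\<^sup>+x. ?B x \<partial>lborel)"
    by (subst nn_integral_indicator[symmetric], simp, subst nn_integral_distr, simp_all)
  also have "\<dots> = (\<integral>\<^sup>+x. ?B x * (\<integral>\<^sup>+y. ?A (R y) \<partial>lborel) \<partial>lborel)"
    by (simp add: nn_integral_multc mult.commute)
  also have "\<dots> = (\<integral>\<^sup>+x. \<integral>\<^sup>+y. ?B x * ?A (R y + x) \<partial>lborel \<partial>lborel)"
  proof (rule nn_integral_cong)
    fix x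
    have "(\<integral>\<^sup>+y. ?A (R y) \<partial>lborel) = (\<integral>\<^sup>+y. ?A (R (y + Q x)) \<partial>lborel)"
      by (rule nn_integral_lborel_translate[symmetric]) simp
    then show "?B x * (\<integral>\<^sup>+y. ?A (R y) \<partial>lborel) = (\<integral>\<^sup>+y. ?B x * ?A (R y + x) \<partial>lborel)"
      by (simp add: nn_integral_cmult linear_add[OF lin] Q)
  qed
  also have "\<dots> = (\<integral>\<^sup>+y. \<integral>\<^sup>+x. ?B x * ?A (R y + x) \<partial>lborel \<partial>lborel)"
    by (rule lborel_pair.Fubini'[symmetric]) measurable
  also have "\<dots> = (\<integral>\<^sup>+y. \<integral>\<^sup>+x. ?B (x - R y) * ?A x \<partial>lborel \<partial>lborel)"
  proof (rule nn_integral_cong)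
    fix y
    show "(\<integral>\<^sup>+x. ?B x * ?A (R y + x) \<partial>lborel) = (\<integral>\<^sup>+x. ?B (x - R y) * ?A x \<partial>lborel)"
      using nn_integral_lborel_translate[of "\<lambda>x. ?B (x - R y) * ?A x" "R y"] by
          (simp add: add.commute)
  qed
  also have "\<dots> = (\<integral>\<^sup>+x. \<integral>\<^sup>+y. ?B (x - R y) * ?A x \<partial>lborel \<partial>lborel)"
    by (rule lborel_pair.Fubini') measurable
  also have "\<dots> = (\<integral>\<^sup>+x. emeasure lborel B * ?A x \<partial>lborel)"
  proof (rule nn_integral_cong)
    fix x
    have "(\<integral>\<^sup>+y. ?B (y - Q x) \<partial>lborel) = emeasure lborel B"
      using nn_integral_lborel_translate[of ?B "- Q x"] by simp
    then show "(\<integral>\<^sup>+y. ?B (x - R y) * ?A x \<partial>lborel) = emeasure lborel B * ?A x"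
      by (simp add: Bsym nn_integral_multc)
  qed
  also have "\<dots> = emeasure lborel A * emeasure lborel B"
    by (simp add: nn_integral_cmult mult.commute[of _ "indicator A _"] mult.commute[of
        "emeasure lborel B"] nn_integral_multc)
  finally have e: "emeasure lborel B * emeasure (distr lborel borel R) A
      = emeasure lborel B * emeasure lborel A"
    by (simp add: mult.commute)
  have fin: "emeasure lborel B < \<infinity>" unfolding B_def by (rule emeasure_lborel_ball_finite)
  have "measure lborel B > 0" unfolding B_def by (rule content_ball_pos) simp
  then have "emeasure lborel B \<noteq> 0" by (auto simp: measure_def)
  with e fin show "emeasure (distr lborel borel R) A = emeasure lborel A"
    by (auto simp: ennreal_mult_cancel_left)
qed simp

lemma sets_sphere_volume [simp, measurable_cong]:
  "sets sphere_volume = sets (restrict_space borel (sphere 0 1))"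
  by (simp add: sphere_volume_def)

lemma space_sphere_volume [simp]: "space sphere_volume = sphere 0 1"
  by (simp add: sphere_volume_def space_restrict_space)

lemma sgn_measurable_sphere:
  "sgn \<in> restrict_space lborel (ball 0 1 - {0}) \<rightarrow>\<^sub>M
     restrict_space borel (sphere (0::'a::euclidean_space) 1)"
proof (rule measurable_restrict_space2)
  have "(\<lambda>y::'a. y /\<^sub>R norm y) \<in> borel_measurable borel" by measurable
  then show "sgn \<in> restrict_space lborel (ball 0 1 - {0}) \<rightarrow>\<^sub>M (borel :: 'a measure)"
    by (intro measurable_restrict_space1) (simp add: sgn_div_norm)
qed (auto simp: space_restrict_space norm_sgn)

lemma emeasure_sphere_volume:
  fixes A :: "'a::euclidean_space set"
  assumes A: "A \<in> sets (restrict_space borel (sphere 0 1))"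
  shows "emeasure sphere_volume A = DIM('a) * emeasure lborel {y \<in> ball 0 1 - {0}. sgn y \<in> A}"
proof -
  let ?M = "restrict_space lborel (ball (0::'a) 1 - {0})"
  have s: "space ?M = ball 0 1 - {0}" by (simp add: space_restrict_space)
  have "emeasure sphere_volume A =
      DIM('a) * emeasure (distr ?M (restrict_space borel (sphere 0 1)) sgn) A"
    unfolding sphere_volume_def using A
    by (subst emeasure_density_const) (auto simp: ennreal_of_nat_eq_real_of_nat)
  also have "emeasure (distr ?M (restrict_space borel (sphere 0 1)) sgn) A =
      emeasure ?M (sgn -` A \<inter> space ?M)"
    by (rule emeasure_distr[OF sgn_measurable_sphere A])
  also have "\<dots> = emeasure lborel (sgn -` A \<inter> space ?M)"
    by (subst emeasure_restrict_space) (auto simp: s)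
  also have "sgn -` A \<inter> space ?M = {y \<in> ball 0 1 - {0}. sgn y \<in> A}"
    unfolding s by auto
  finally show ?thesis .
qed

lemma finite_measure_sphere_volume: "finite_measure (sphere_volume :: 'a::euclidean_space measure)"
proof (rule finite_measureI)
  have "emeasure lborel {y \<in> ball (0::'a) 1 - {0}. sgn y \<in> sphere 0 1} \<le> emeasure lborel (ball
      (0::'a) 1)"
    by (intro emeasure_mono) auto
  also have "\<dots> < \<infinity>" by (rule emeasure_lborel_ball_finite)
  finally show "emeasure (sphere_volume :: 'a measure) (space sphere_volume) \<noteq> \<infinity>"
    unfolding space_sphere_volume
    by (subst emeasure_sphere_volume) (auto simp: ennreal_mult_eq_top_iff sets_restrict_space_iff)
qed

interpretation sphere_volume: finite_measure "sphere_volume :: 'a::euclidean_space measure"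
  by (rule finite_measure_sphere_volume)

text \<open>\<open>sgn\<close> commutes with a linear isometry, so the cone over the preimage of
  \<open>A\<close> is the preimage of the cone over \<open>A\<close>; invariance of Lebesgue measure
  then carries over.\<close>

lemma distr_sphere_volume_orthogonal:
  fixes R :: "'a::euclidean_space \<Rightarrow> 'a"
  assumes R: "orthogonal_transformation R"
  shows "distr sphere_volume sphere_volume R = sphere_volume"
proof (rule measure_eqI)
  fix A assume "A \<in> sets (distr sphere_volume sphere_volume R)"
  then have A: "A \<in> sets (restrict_space borel (sphere 0 1))" by simp
  have lin: "linear R" and nR: "\<And>x. norm (R x) = norm x"
    using R orthogonal_transformation_linear orthogonal_transformation_norm by auto
  have Rm[measurable]: "R \<in> borel_measurable borel"
    by (intro borel_measurable_continuous_onI linear_continuous_on linear_conv_bounded_linear[THEN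
        iffD1] lin)
  have Rs: "R \<in> sphere_volume \<rightarrow>\<^sub>M sphere_volume"
    unfolding measurable_cong_sets[OF sets_sphere_volume sets_sphere_volume]
    by (intro measurable_restrict_space3) (auto simp: nR)
  let ?C = "\<lambda>A. {y \<in> ball (0::'a) 1 - {0}. sgn y \<in> A}"
  have C: "?C A \<in> sets borel"
  proof -
    have "sgn -` A \<inter> space (restrict_space lborel (ball 0 1 - {0})) \<in> sets (restrict_space lborel
        (ball (0::'a) 1 - {0}))"
      using measurable_sets[OF sgn_measurable_sphere A] .
    moreover have "sgn -` A \<inter> space (restrict_space lborel (ball 0 1 - {0})) = ?C A"
      by (auto simp: space_restrict_space)
    ultimately show ?thesis by (subst (asm) sets_restrict_space_iff) auto
  qed
  have z: "R y = 0 \<longleftrightarrow> y = 0" for y using nR[of y] by (metis norm_eq_zero)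
  have sR: "sgn (R y) = R (sgn y)" for y
    by (simp add: sgn_div_norm nR linear_scale[OF lin])
  have "emeasure (distr sphere_volume sphere_volume R) A =
      emeasure sphere_volume (R -` A \<inter> sphere 0 1)"
    using A Rs by (subst emeasure_distr) auto
  also have "\<dots> = DIM('a) * emeasure lborel (?C (R -` A \<inter> sphere 0 1))"
    using measurable_sets[OF Rs, of A] A by (intro emeasure_sphere_volume) simp
  also have "?C (R -` A \<inter> sphere 0 1) = R -` ?C A \<inter> space lborel"
    using z by (auto simp: sR norm_sgn nR)
  also have "emeasure lborel \<dots> = emeasure (distr lborel borel R) (?C A)"
    using C by (subst emeasure_distr) auto
  also have "DIM('a) * \<dots> = emeasure sphere_volume A"
    using A by (simp add: lborel_distr_orthogonal[OF R] emeasure_sphere_volume)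
  finally show "emeasure (distr sphere_volume sphere_volume R) A = emeasure sphere_volume A" .
qed simp

lemma integrable_sphere_continuous:
  fixes h :: "'a::euclidean_space \<Rightarrow> real"
  assumes h: "continuous_on (sphere 0 1) h"
  shows "integrable sphere_volume h"
proof -
  have "compact (h ` sphere 0 1)" using h by (intro compact_continuous_image) auto
  then obtain B where B: "\<And>x. x \<in> sphere 0 1 \<Longrightarrow> norm (h x) \<le> B"
    using compact_imp_bounded bounded_iff by (metis imageI)
  show ?thesis
  proof (rule sphere_volume.integrable_const_bound)
    show "AE x in sphere_volume. norm (h x) \<le> B" using B by (intro AE_I2) simp
    show "h \<in> borel_measurable sphere_volume"
      using borel_measurable_continuous_on_restrict[OF h]
      by (simp add: measurable_cong_sets[OF sets_sphere_volume refl])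
  qed
qed

lemma integral_sphere_orthogonal:
  fixes h :: "'a::euclidean_space \<Rightarrow> real" and R :: "'a \<Rightarrow> 'a"
  assumes R: "orthogonal_transformation R" and h: "continuous_on (sphere 0 1) h"
  shows "(\<integral>x. h (R x) \<partial>sphere_volume) = (\<integral>x. h x \<partial>sphere_volume)"
proof -
  have "linear R" "\<And>x. norm (R x) = norm x"
    using R orthogonal_transformation_linear orthogonal_transformation_norm by auto
  then have "R \<in> borel_measurable borel"
    by (intro borel_measurable_continuous_onI linear_continuous_on linear_conv_bounded_linear[THEN
        iffD1])
  then have Rs: "R \<in> sphere_volume \<rightarrow>\<^sub>M sphere_volume"
    unfolding measurable_cong_sets[OF sets_sphere_volume sets_sphere_volume]
    by (intro measurable_restrict_space3) (auto simp: \<open>\<And>x. norm (R x) = norm x\<close>)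
  have "(\<integral>x. h x \<partial>sphere_volume) = (\<integral>x. h x \<partial>distr sphere_volume sphere_volume R)"
    by (simp add: distr_sphere_volume_orthogonal[OF R])
  also have "\<dots> = (\<integral>x. h (R x) \<partial>sphere_volume)"
    using integrable_sphere_continuous[OF h] by (intro integral_distr Rs) auto
  finally show ?thesis by simp
qed

text \<open>If \<open>h\<close> were positive at \<open>x\<close>, the relatively open set where it
  is positive would be null. The cone over it would then be an open Lebesgue null set, hence empty,
  although it contains \<open>x / 2\<close>.\<close>

lemma integral_sphere_eq_0_imp:
  fixes h :: "'a::euclidean_space \<Rightarrow> real"
  assumes h: "continuous_on (sphere 0 1) h" and nn: "\<And>x. x \<in> sphere 0 1 \<Longrightarrow> h x \<ge> 0"
    and 0: "(\<integral>x. h x \<partial>sphere_volume) = 0" and x: "x \<in> sphere 0 1"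
  shows "h x = 0"
proof (rule ccontr)
  assume "h x \<noteq> 0"
  then have hx: "h x > 0" using nn[OF x] by simp
  have "AE y in sphere_volume. h y = 0"
    using 0 nn integral_nonneg_eq_0_iff_AE[OF integrable_sphere_continuous[OF h] AE_I2]
    by simp
  then have "AE y in sphere_volume. h y \<le> 0" by eventually_elim simp
  obtain U where U: "open U" "\<And>y. y \<in> sphere 0 1 \<Longrightarrow> y \<in> U \<longleftrightarrow> h y > 0"
  proof -
    have "\<exists>U. open U \<and> U \<inter> sphere 0 1 = h -` {0<..} \<inter> sphere 0 1"
      using h continuous_on_open_invariant[of "sphere 0 1" h] open_greaterThan by metis
    then show thesis using that by blast
  qed
  have m: "U \<inter> sphere 0 1 \<in> sets (restrict_space borel (sphere 0 1))"
    using U(1) by (auto simp: sets_restrict_space)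
  have "{y \<in> space sphere_volume. \<not> h y \<le> 0} = U \<inter> sphere 0 1"
    using U(2) by (auto simp: not_le)
  with \<open>AE y in sphere_volume. h y \<le> 0\<close> have "emeasure sphere_volume (U \<inter> sphere 0 1) = 0"
    using m AE_iff_measurable[of "U \<inter> sphere 0 1" sphere_volume "\<lambda>y. h y \<le> 0"] by simp
  then have e0: "emeasure lborel {y \<in> ball 0 1 - {0}. sgn y \<in> U \<inter> sphere 0 1} = 0"
    using emeasure_sphere_volume[OF m] by simp
  have "open (sgn -` U \<inter> (ball (0::'a) 1 - {0}))"
    by (subst Int_commute, rule continuous_open_preimage[OF _ _ U(1)])
      (auto intro!: continuous_on_sgn continuous_on_id)
  moreover have "sgn -` U \<inter> (ball (0::'a) 1 - {0}) = {y \<in> ball 0 1 - {0}. sgn y \<in> U \<inter> sphere 0 1}"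
    by (auto simp: norm_sgn)
  moreover have "(1/2) *\<^sub>R x \<in> sgn -` U \<inter> (ball (0::'a) 1 - {0})"
  proof -
    have "sgn ((1/2) *\<^sub>R x) = x" using x by (simp add: sgn_div_norm)
    then show ?thesis using x U(2)[OF x] hx by auto
  qed
  ultimately have op: "open {y \<in> ball (0::'a) 1 - {0}. sgn y \<in> U \<inter> sphere 0 1}"
    and ne: "{y \<in> ball (0::'a) 1 - {0}. sgn y \<in> U \<inter> sphere 0 1} \<noteq> {}" by auto
  have "{y \<in> ball (0::'a) 1 - {0}. sgn y \<in> U \<inter> sphere 0 1} \<in> null_sets lborel"
    using op e0 by (intro null_setsI) simp_all
  then have "negligible {y \<in> ball (0::'a) 1 - {0}. sgn y \<in> U \<inter> sphere 0 1}"
    unfolding negligible_iff_null_sets by (rule null_sets_completionI)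
  with open_not_negligible[OF op ne] show False by blast
qed

section \<open>Differentiation and integration by parts on the sphere\<close>

text \<open>The formula is the orthogonal projection onto \<open>tangent x\<close> when
  \<open>norm x = 1\<close>. The projections \<open>tproj x b\<close> of the ambient basis then form
  a Parseval frame of the tangent space, defined on the whole sphere, and stand in for local
  orthonormal frames.\<close>

definition tproj :: "'a::euclidean_space \<Rightarrow> 'a \<Rightarrow> 'a" where
  "tproj x a = a - (a \<bullet> x) *\<^sub>R x"

lemma tproj_tangent [simp]: "x \<in> sphere 0 1 \<Longrightarrow> tproj x a \<in> tangent x"
  by (simp add: tproj_def tangent_def inner_diff_right norm_eq_1 inner_commute)

lemma tproj_id: "v \<in> tangent x \<Longrightarrow> tproj x v = v"
  by (simp add: tproj_def tangent_def inner_commute)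

lemma inner_tproj_left: "tproj x a \<bullet> b = a \<bullet> tproj x b"
  by (simp add: tproj_def inner_diff_left inner_diff_right inner_commute)

lemma linear_tproj: "linear (tproj x)"
  unfolding tproj_def by (rule linearI) (simp_all add: inner_add_left algebra_simps)

lemma tproj_tproj: "x \<in> sphere 0 1 \<Longrightarrow> tproj x (tproj x a) = tproj x a"
  by (simp add: tproj_id)

lemma subspace_tangent: "subspace (tangent x)"
  unfolding tangent_def by (rule subspace_hyperplane)

text \<open>With \<open>P = tproj x\<close> symmetric and idempotent, this is
  \<open>P w = P (P w)\<close> with the inner value expanded in the ambient basis.\<close>

lemma tproj_expansion:
  assumes "x \<in> sphere 0 1"
  shows "tproj x w = (\<Sum>b\<in>Basis. (w \<bullet> tproj x b) *\<^sub>R tproj x b)"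
proof -
  have "tproj x w = tproj x (tproj x w)" using assms by (simp add: tproj_tproj)
  also have "\<dots> = tproj x (\<Sum>b\<in>Basis. (tproj x w \<bullet> b) *\<^sub>R b)" by (simp add: euclidean_representation)
  also have "\<dots> = (\<Sum>b\<in>Basis. (w \<bullet> tproj x b) *\<^sub>R tproj x b)"
    by (simp only: linear_sum[OF linear_tproj] linear_scale[OF linear_tproj] inner_tproj_left)
  finally show ?thesis .
qed

lemma sum_tproj_inner:
  assumes "x \<in> sphere 0 1" "v \<in> tangent x"
  shows "(\<Sum>b\<in>Basis. (v \<bullet> tproj x b) * (w \<bullet> tproj x b)) = v \<bullet> w"
proof -
  have "v \<bullet> w = tproj x v \<bullet> w" using assms by (simp add: tproj_id)
  also have "\<dots> = (\<Sum>b\<in>Basis. (v \<bullet> tproj x b) * (w \<bullet> tproj x b))"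
    by (subst tproj_expansion[OF assms(1)]) (simp add: inner_sum_left inner_sum_right inner_commute)
  finally show ?thesis by simp
qed

section \<open>Calculus of C1 maps on the sphere\<close>

text \<open>Continuity is demanded along the fields \<open>tproj x a\<close>, because
  \<open>sphere_deriv\<close> carries information in tangential directions only. One derivative is
  enough for the integrations by parts below, and composites with real powers stay in this class
  without returning to \<open>ck_on\<close>.\<close>

definition sphere_C1 :: "('a::euclidean_space \<Rightarrow> 'b::real_normed_vector) \<Rightarrow> bool" where
  "sphere_C1 u \<longleftrightarrow> (\<forall>x\<in>sphere 0 1. u differentiable (at x within sphere 0 1)) \<and>
     (\<forall>a. continuous_on (sphere 0 1) (\<lambda>x. sphere_deriv u x (tproj x a)))"

lemma sphere_C1_has_derivative:
  "sphere_C1 u \<Longrightarrow> x \<in> sphere 0 1 \<Longrightarrow> (u has_derivative sphere_deriv u x) (at x within sphere 0 1)"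
  unfolding sphere_C1_def sphere_deriv_def[abs_def] by (simp add: frechet_derivative_works)

lemma sphere_C1_continuous: "sphere_C1 u \<Longrightarrow> continuous_on (sphere 0 1) u"
  by (rule has_derivative_continuous_on) (rule sphere_C1_has_derivative)

lemma sphere_C1_linear: "sphere_C1 (u :: 'a::euclidean_space \<Rightarrow> 'b::real_normed_vector)
    \<Longrightarrow> x \<in> sphere 0 1 \<Longrightarrow> linear (sphere_deriv u x)"
  by (rule has_derivative_linear) (rule sphere_C1_has_derivative)

lemma sphere_C1I:
  assumes D: "\<And>x. x \<in> sphere 0 1 \<Longrightarrow> (u has_derivative D x) (at x within sphere 0 1)"
    and c: "\<And>a. continuous_on (sphere 0 1) (\<lambda>x. D x (tproj x a))"
  shows "sphere_C1 u"
  unfolding sphere_C1_def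
proof (intro conjI ballI allI)
  fix a
  have "continuous_on (sphere 0 1) (\<lambda>x. sphere_deriv u x (tproj x a)) \<longleftrightarrow>
        continuous_on (sphere 0 1) (\<lambda>x. D x (tproj x a))"
    by (rule continuous_on_cong) (auto intro!: sphere_deriv_eq D simp del: mem_sphere)
  with c show "continuous_on (sphere 0 1) (\<lambda>x. sphere_deriv u x (tproj x a))" by blast
qed (use D differentiable_def in blast)

lemma sphere_deriv_expansion:
  assumes "sphere_C1 u" "x \<in> sphere 0 1" "v \<in> tangent x"
  shows "sphere_deriv u x v = (\<Sum>b\<in>Basis. (v \<bullet> b) *\<^sub>R sphere_deriv u x (tproj x b))"
proof -
  have "v = tproj x (\<Sum>b\<in>Basis. (v \<bullet> b) *\<^sub>R b)" using assms(3) by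
      (simp add: euclidean_representation tproj_id)
  also have "\<dots> = (\<Sum>b\<in>Basis. (v \<bullet> b) *\<^sub>R tproj x b)"
    by (simp only: linear_sum[OF linear_tproj] linear_scale[OF linear_tproj])
  finally have "sphere_deriv u x v = sphere_deriv u x (\<Sum>b\<in>Basis. (v \<bullet> b) *\<^sub>R tproj x b)" by simp
  then show ?thesis
    by (simp only: linear_sum[OF sphere_C1_linear[OF assms(1,2)]] linear_scale[OF
        sphere_C1_linear[OF assms(1,2)]])
qed

lemma sphere_C1_continuous_deriv:
  assumes "sphere_C1 u" "continuous_on (sphere 0 1) X" "\<And>x. x \<in> sphere 0 1 \<Longrightarrow> X x \<in> tangent x"
  shows "continuous_on (sphere 0 1) (\<lambda>x. sphere_deriv u x (X x))"
proof -
  have "continuous_on (sphere 0 1) (\<lambda>x. \<Sum>b\<in>Basis. (X x \<bullet> b) *\<^sub>R sphere_deriv u x (tproj x b))"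
    using assms(1,2) by (auto simp: sphere_C1_def intro!: continuous_intros)
  moreover have "continuous_on (sphere 0 1) (\<lambda>x. sphere_deriv u x (X x)) \<longleftrightarrow> continuous_on
      (sphere 0 1) (\<lambda>x. \<Sum>b\<in>Basis. (X x \<bullet> b) *\<^sub>R sphere_deriv u x (tproj x b))"
    using assms by (intro continuous_on_cong refl sphere_deriv_expansion) auto
  ultimately show ?thesis by blast
qed

lemma sphere_deriv_bilinear:
  fixes u :: "'a::euclidean_space \<Rightarrow> 'b::real_normed_vector" and w :: "'a \<Rightarrow> 'c::real_normed_vector"
  assumes B: "bounded_bilinear B" and "sphere_C1 u" "sphere_C1 w" "x \<in> sphere 0 1" "v \<in> tangent x"
  shows "sphere_deriv (\<lambda>y. B (u y) (w y)) x v = B (u x) (sphere_deriv w x v) + B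
      (sphere_deriv u x v) (w x)"
  using assms by (intro sphere_deriv_eq bounded_bilinear.FDERIV[OF B] sphere_C1_has_derivative)

lemma sphere_C1_bilinear:
  fixes u :: "'a::euclidean_space \<Rightarrow> 'b::real_normed_vector" and w :: "'a \<Rightarrow> 'c::real_normed_vector"
  assumes B: "bounded_bilinear B" and u: "sphere_C1 u" and w: "sphere_C1 w"
  shows "sphere_C1 (\<lambda>y. B (u y) (w y))"
proof (rule sphere_C1I)
  fix x :: 'a assume "x \<in> sphere 0 1"
  then show "((\<lambda>y. B (u y) (w y)) has_derivative (\<lambda>v. B (u x) (sphere_deriv w x v) + B
      (sphere_deriv u x v) (w x)))
      (at x within sphere 0 1)"
    by (intro bounded_bilinear.FDERIV[OF B] sphere_C1_has_derivative u w)
next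
  fix a
  have "continuous_on (sphere 0 1) (\<lambda>x. sphere_deriv u x (tproj x a))" "continuous_on (sphere 0 1)
      (\<lambda>x. sphere_deriv w x (tproj x a))"
    using u w by (auto simp: sphere_C1_def)
  then show "continuous_on (sphere 0 1) (\<lambda>x. B (u x) (sphere_deriv w x (tproj x a)) + B
      (sphere_deriv u x (tproj x a)) (w x))"
    using sphere_C1_continuous[OF u] sphere_C1_continuous[OF w]
    by (intro continuous_on_add bounded_bilinear.continuous_on[OF B])
qed

lemmas sphere_C1_scaleR = sphere_C1_bilinear[OF bounded_bilinear_scaleR]
  and sphere_C1_mult = sphere_C1_bilinear[OF bounded_bilinear_mult]
  and sphere_C1_inner = sphere_C1_bilinear[OF bounded_bilinear_inner]
  and sphere_deriv_scaleR = sphere_deriv_bilinear[OF bounded_bilinear_scaleR]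
  and sphere_deriv_mult = sphere_deriv_bilinear[OF bounded_bilinear_mult]
  and sphere_deriv_inner = sphere_deriv_bilinear[OF bounded_bilinear_inner]

lemma sphere_deriv_diff:
  assumes "sphere_C1 u" "sphere_C1 w" "x \<in> sphere 0 1" "v \<in> tangent x"
  shows "sphere_deriv (\<lambda>y. u y - w y) x v = sphere_deriv u x v - sphere_deriv w x v"
  using assms by (intro sphere_deriv_eq has_derivative_diff sphere_C1_has_derivative)

lemma sphere_deriv_bounded_linear:
  assumes "bounded_linear L" "x \<in> sphere 0 1" "v \<in> tangent x"
  shows "sphere_deriv L x v = L v"
  using assms by (intro sphere_deriv_eq bounded_linear_imp_has_derivative)

lemma sphere_deriv_const:
  assumes "x \<in> sphere 0 1" "v \<in> tangent x"
  shows "sphere_deriv (\<lambda>y. c) x v = 0"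
  using assms by (intro sphere_deriv_eq has_derivative_const)

lemma sphere_C1_const: "sphere_C1 (\<lambda>x. c)"
  by (rule sphere_C1I, rule has_derivative_const) simp

lemma sphere_C1_bounded_linear:
  assumes "bounded_linear L" shows "sphere_C1 L"
proof (rule sphere_C1I, rule bounded_linear_imp_has_derivative[OF assms])
  show "continuous_on (sphere 0 1) (\<lambda>x. L (tproj x a))" for a
    unfolding tproj_def by (intro linear_continuous_on_compose[OF _ bounded_linear.linear[OF
        assms]] continuous_intros)
qed

lemma sphere_deriv_compose:
  fixes g :: "real \<Rightarrow> real"
  assumes "\<And>r. (g has_real_derivative g' r) (at r)" "sphere_C1 u" "x \<in> sphere 0 1" "v \<in> tangent x"
  shows "sphere_deriv (\<lambda>y. g (u y)) x v = g' (u x) * sphere_deriv u x v"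
proof (rule sphere_deriv_eq[OF _ assms(3,4)])
  show "((\<lambda>y. g (u y)) has_derivative (\<lambda>v. g' (u x) * sphere_deriv u x v)) (at x within sphere 0 1)"
    using has_derivative_compose[OF sphere_C1_has_derivative[OF assms(2,3)], of g "(*) (g' (u x))"]
      assms(1)[of "u x"] by (simp add: has_field_derivative_def)
qed

lemma sphere_C1_compose:
  fixes u :: "'a::euclidean_space \<Rightarrow> real" and g :: "real \<Rightarrow> real"
  assumes g: "\<And>r. (g has_real_derivative g' r) (at r)" and c: "continuous_on UNIV g'" and u:
      "sphere_C1 u"
  shows "sphere_C1 (\<lambda>y. g (u y))"
proof (rule sphere_C1I)
  fix x :: 'a assume x: "x \<in> sphere 0 1"
  show "((\<lambda>y. g (u y)) has_derivative (\<lambda>v. g' (u x) * sphere_deriv u x v)) (at x within sphere 0 1)"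
    using has_derivative_compose[OF sphere_C1_has_derivative[OF u x], of g "(*) (g' (u x))"]
      g[of "u x"] by (simp add: has_field_derivative_def)
next
  show "continuous_on (sphere 0 1) (\<lambda>x. g' (u x) * sphere_deriv u x (tproj x a))" for a
    by (intro continuous_on_mult continuous_on_compose2[OF c sphere_C1_continuous[OF u]])
      (use u in \<open>auto simp: sphere_C1_def\<close>)
qed

lemma vector_field_tproj: "vector_field (\<lambda>x. tproj x (a::'a::euclidean_space))"
proof -
  have "smooth_on (sphere 0 1) (\<lambda>x::'a. a + (-1) *\<^sub>R ((a \<bullet> x) *\<^sub>R x))"
    by (intro smooth_on_add smooth_on_const smooth_on_bilinear[OF bounded_bilinear_scaleR]
        smooth_on_bilinear[OF bounded_bilinear_inner] smooth_on_linear bounded_linear_ident)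
  then show ?thesis
    unfolding vector_field_def by (simp add: tproj_def tangent_def inner_diff_right norm_eq_1
        inner_commute)
qed

lemma smooth_on_continuous:
  assumes "smooth_on S g" shows "continuous_on S g"
  unfolding continuous_on_eq_continuous_within
proof
  fix x assume x: "x \<in> S"
  then obtain U F where "open U" "x \<in> U" "\<And>k. ck_on k U F" "\<And>y. y \<in> S \<inter> U \<Longrightarrow> F y = g y"
    using assms unfolding smooth_on_def by metis
  from has_derivative_continuous[OF local_extension_deriv[OF this x]]
  show "continuous (at x within S) g" .
qed

lemma sphere_C1_smooth:
  fixes u :: "'a::euclidean_space \<Rightarrow> 'b::real_normed_vector"
  assumes u: "smooth_on (sphere 0 1) u" shows "sphere_C1 u"
proof (rule sphere_C1I)
  show "(u has_derivative sphere_deriv u x) (at x within sphere 0 1)" if "x \<in> sphere 0 1" for x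
    using u that by (rule sphere_deriv_works)
  show "continuous_on (sphere 0 1) (\<lambda>x. sphere_deriv u x (tproj x a))" for a
    by (rule smooth_on_continuous) (rule smooth_on_sphere_deriv[OF vector_field_tproj u])
qed

section \<open>Rotations, Killing fields and integration by parts\<close>

lemma curve_derivative:
  assumes c: "(c has_vector_derivative c') (at t)" and "range c \<subseteq> S"
    and u: "(u has_derivative D) (at (c t) within S)"
  shows "((\<lambda>t. u (c t)) has_vector_derivative D c') (at t)"
proof -
  have u': "(u has_derivative D) (at (c t) within range c)"
    using has_derivative_subset[OF u assms(2)] .
  have "((u \<circ> c) has_derivative (D \<circ> (\<lambda>h. h *\<^sub>R c'))) (at t)"
    using diff_chain_within[of c "\<lambda>h. h *\<^sub>R c'" t UNIV u D] c u' by
        (simp add: has_vector_derivative_def)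
  moreover have "D \<circ> (\<lambda>h. h *\<^sub>R c') = (\<lambda>h. h *\<^sub>R D c')"
    using linear_scale[OF has_derivative_linear[OF u]] by (simp add: o_def)
  ultimately show ?thesis by (simp add: has_vector_derivative_def o_def)
qed

text \<open>For orthonormal \<open>e\<close> and \<open>g\<close>: the rotation by the angle
  \<open>t\<close> from \<open>e\<close> towards \<open>g\<close>, identity on the orthogonal
  complement, written as a perturbation of \<open>y\<close> so that no basis adapted to the plane
  has to be chosen.\<close>

definition plane_rotation :: "'a::euclidean_space \<Rightarrow> 'a \<Rightarrow> real \<Rightarrow> 'a \<Rightarrow> 'a" where
  "plane_rotation e g t y = y + ((cos t - 1) * (y \<bullet> e) - sin t * (y \<bullet> g)) *\<^sub>R e
     + (sin t * (y \<bullet> e) + (cos t - 1) * (y \<bullet> g)) *\<^sub>R g"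

lemma orthogonal_plane_rotation:
  assumes [simp]: "e \<bullet> e = 1" "g \<bullet> g = 1" "e \<bullet> g = 0"
  shows "orthogonal_transformation (plane_rotation e g t)"
  unfolding orthogonal_transformation
proof (intro conjI allI)
  show "linear (plane_rotation e g t)"
    unfolding plane_rotation_def by (rule linearI) (simp_all add: inner_add_left algebra_simps)
  fix y
  let ?A = "y \<bullet> e" and ?B = "y \<bullet> g"
  define p r where "p = (cos t - 1) * ?A - sin t * ?B" and "r = sin t * ?A + (cos t - 1) * ?B"
  have [simp]: "g \<bullet> e = 0" by (simp add: inner_commute)
  have alg: "2 * (((c - 1) * A - s * B) * A) + 2 * ((s * A + (c - 1) * B) * B) +
      ((c - 1) * A - s * B)\<^sup>2
      + (s * A + (c - 1) * B)\<^sup>2 = 0" if "c\<^sup>2 + s\<^sup>2 = 1" for c s A B :: real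
    using that by algebra
  have "plane_rotation e g t y \<bullet> plane_rotation e g t y = y \<bullet> y + (2 * (p * ?A) + 2 *
      (r * ?B) + p\<^sup>2 + r\<^sup>2)"
    unfolding plane_rotation_def p_def[symmetric] r_def[symmetric]
    by (simp add: inner_add_left inner_add_right power2_eq_square inner_commute algebra_simps)
  also have "\<dots> = y \<bullet> y"
    unfolding p_def r_def by (subst alg) simp_all
  finally have "plane_rotation e g t y \<bullet> plane_rotation e g t y = y \<bullet> y" .
  then show "norm (plane_rotation e g t y) = norm y" by (simp add: norm_eq_sqrt_inner)
qed

text \<open>The derivative is expressed at the rotated point, not at \<open>y\<close>: orbits are
  integral curves of the Killing field \<open>y \<mapsto> (y \<bullet> e) *\<^sub>R g - (y \<bullet>
  g) *\<^sub>R e\<close>. This form gives bounds uniform in the angle.\<close>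

lemma plane_rotation_derivative:
  assumes [simp]: "e \<bullet> e = 1" "g \<bullet> g = 1" "e \<bullet> g = 0"
  shows "((\<lambda>t. plane_rotation e g t y) has_vector_derivative
     (plane_rotation e g t y \<bullet> e) *\<^sub>R g - (plane_rotation e g t y \<bullet> g) *\<^sub>R e) (at t)"
proof -
  have [simp]: "g \<bullet> e = 0" by (simp add: inner_commute)
  have "plane_rotation e g t y \<bullet> e = cos t * (y \<bullet> e) - sin t * (y \<bullet> g)"
       "plane_rotation e g t y \<bullet> g = sin t * (y \<bullet> e) + cos t * (y \<bullet> g)"
    by (simp_all add: plane_rotation_def inner_add_left algebra_simps)
  then have eq: "(plane_rotation e g t y \<bullet> e) *\<^sub>R g - (plane_rotation e g t y \<bullet> g) *\<^sub>R e =
     0 + (- sin t * (y \<bullet> e) - cos t * (y \<bullet> g)) *\<^sub>R e + (cos t * (y \<bullet> e) - sin t * (y \<bullet> g)) *\<^sub>R g"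
    by (simp only:) (simp add: algebra_simps)
  have "((\<lambda>t. (cos t - 1) * (y \<bullet> e) - sin t * (y \<bullet> g)) has_vector_derivative (- sin t *
      (y \<bullet> e) - cos t * (y \<bullet> g))) (at t)"
    "((\<lambda>t. sin t * (y \<bullet> e) + (cos t - 1) * (y \<bullet> g)) has_vector_derivative (cos t *
        (y \<bullet> e) - sin t * (y \<bullet> g))) (at t)"
    unfolding has_real_derivative_iff_has_vector_derivative[symmetric]
    by (rule DERIV_cong, (rule derivative_intros)+, simp)+
  note * = this[THEN bounded_linear.has_vector_derivative[OF bounded_linear_scaleR_left]]
  show ?thesis
    unfolding eq unfolding plane_rotation_def
    by (intro has_vector_derivative_add has_vector_derivative_const *)
qed

text \<open>The integral of \<open>u\<close> composed with a rotation does not depend on the angle,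
  and its derivative at angle 0 is the integral of \<open>u\<close> differentiated along the Killing
  field. Derivative and integral are exchanged by dominated convergence along the angles
  \<open>1 / Suc n\<close>.\<close>

lemma integral_sphere_killing:
  fixes u :: "'a::euclidean_space \<Rightarrow> real"
  assumes eg: "e \<bullet> e = 1" "g \<bullet> g = 1" "e \<bullet> g = 0" and u: "sphere_C1 u"
  shows "(\<integral>x. sphere_deriv u x ((x \<bullet> e) *\<^sub>R g - (x \<bullet> g) *\<^sub>R e) \<partial>sphere_volume) = 0"
proof -
  let ?S = "sphere (0::'a) 1" and ?R = "plane_rotation e g"
  define k where "k x = sphere_deriv u x ((x \<bullet> e) *\<^sub>R g - (x \<bullet> g) *\<^sub>R e)" for x
  define s where "s n x = real (Suc n) * (u (?R (1 / real (Suc n)) x) - u x)" for n x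
  have orth: "orthogonal_transformation (?R t)" for t
    by (rule orthogonal_plane_rotation[OF eg])
  have RS: "?R t x \<in> ?S" if "x \<in> ?S" for t x
    using orthogonal_transformation_norm[OF orth] that by simp
  have R0: "?R 0 x = x" for x by (simp add: plane_rotation_def)
  have uc: "continuous_on ?S u" by (rule sphere_C1_continuous[OF u])
  have kc: "continuous_on ?S k"
    unfolding k_def
    by (intro sphere_C1_continuous_deriv u continuous_intros)
       (simp add: tangent_def inner_diff_right)
  have d: "((\<lambda>t. u (?R t x)) has_real_derivative k (?R t x)) (at t)" if "x \<in> ?S" for x t
    unfolding has_real_derivative_iff_has_vector_derivative k_def
    by (rule curve_derivative[OF plane_rotation_derivative[OF eg], of _ "?S"])
       (use RS[OF that] in \<open>auto intro!: sphere_C1_has_derivative u simp del: mem_sphere\<close>)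
  obtain K where K: "\<And>x. x \<in> ?S \<Longrightarrow> \<bar>k x\<bar> \<le> K"
  proof -
    have "compact (k ` ?S)" using kc by (intro compact_continuous_image) auto
    then show thesis using that compact_imp_bounded bounded_iff by (metis imageI real_norm_def)
  qed
  have suR: "continuous_on ?S (\<lambda>x. u (?R t x))" for t
  proof (rule continuous_on_compose2[OF uc])
    show "continuous_on ?S (?R t)"
      using orth orthogonal_transformation_linear linear_continuous_on linear_conv_bounded_linear
          by blast
  qed (use RS in auto)
  have "(\<integral>x. s n x \<partial>sphere_volume) = 0" for n
    unfolding s_def using suR uc
    by (simp add: Bochner_Integration.integral_diff integrable_sphere_continuous
        integral_sphere_orthogonal[OF orth])
  moreover have "(\<lambda>n. \<integral>x. s n x \<partial>sphere_volume) \<longlonglongrightarrow> (\<integral>x. k x \<partial>sphere_volume)"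
  proof (rule integral_dominated_convergence[where w = "\<lambda>_. K"])
    show "k \<in> borel_measurable sphere_volume"
      using integrable_sphere_continuous[OF kc] by simp
    show "s n \<in> borel_measurable sphere_volume" for n
      by (rule borel_measurable_integrable, rule integrable_sphere_continuous)
         (auto simp: s_def[abs_def] intro!: continuous_intros suR uc)
    show "integrable sphere_volume (\<lambda>_::'a. K)" by simp
    show "AE x in sphere_volume. (\<lambda>n. s n x) \<longlonglongrightarrow> k x"
    proof (rule AE_I2)
      fix x :: 'a assume "x \<in> space sphere_volume"
      then have x: "x \<in> ?S" by simp
      have "((\<lambda>h. (u (?R h x) - u x) / h) \<longlongrightarrow> k x) (at 0)"
        using d[OF x, of 0] by (simp add: DERIV_def R0)
      moreover have "filterlim (\<lambda>n. 1 / real (Suc n)) (at 0) sequentially"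
        by (rule filterlim_atI) (use LIMSEQ_inverse_real_of_nat in \<open>auto simp: inverse_eq_divide\<close>)
      ultimately have "(\<lambda>n. (u (?R (1 / real (Suc n)) x) - u x) / (1 / real (Suc n))) \<longlonglongrightarrow> k x"
        by (rule filterlim_compose)
      then show "(\<lambda>n. s n x) \<longlonglongrightarrow> k x" by (simp add: s_def mult.commute)
    qed
    show "AE x in sphere_volume. norm (s n x) \<le> K" for n
    proof (rule AE_I2)
      fix x :: 'a assume "x \<in> space sphere_volume"
      then have x: "x \<in> ?S" by simp
      \<comment> \<open>By the mean value theorem the difference quotient is a value of
        \<open>k\<close> at another point of the orbit of \<open>x\<close>, so the bound
        \<open>K\<close> of \<open>k\<close> on the sphere dominates all quotients.\<close>
      obtain z where "u (?R (1 / real (Suc n)) x) - u (?R 0 x) = (1 / real (Suc n) - 0) * k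
          (?R z x)"
        using MVT2[of 0 "1 / real (Suc n)" "\<lambda>t. u (?R t x)" "\<lambda>t. k (?R t x)"] d[OF x] by auto
      then have "s n x = k (?R z x)" by (simp add: s_def R0)
      then show "norm (s n x) \<le> K" using K[OF RS[OF x]] by simp
    qed
  qed
  ultimately have "(\<lambda>n. 0) \<longlonglongrightarrow> (\<integral>x. k x \<partial>sphere_volume)" by simp
  then show ?thesis unfolding k_def using LIMSEQ_unique tendsto_const by metis
qed

lemma sphere_C1_inner_left: "sphere_C1 (\<lambda>x. x \<bullet> b)"
  by (rule sphere_C1_bounded_linear[OF bounded_linear_inner_left])

lemma continuous_on_sphere_deriv_tproj:
  "sphere_C1 u \<Longrightarrow> continuous_on (sphere 0 1) (\<lambda>x. sphere_deriv u x (tproj x a))"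
  by (simp add: sphere_C1_def)

text \<open>The field \<open>tproj x c\<close> is the sum over \<open>b\<close> of
  \<open>x \<bullet> b\<close> times the Killing field \<open>K b\<close>. The Killing identity for
  \<open>(x \<bullet> b) * u\<close> leaves the Leibniz terms \<open>K b x \<bullet> b\<close>,
  which sum to \<open>(1 - DIM('a)) * (c \<bullet> x)\<close>; the constant is the dimension of the
  sphere.\<close>

lemma integral_sphere_tproj_Basis:
  fixes u :: "'a::euclidean_space \<Rightarrow> real"
  assumes u: "sphere_C1 u" and c: "c \<in> Basis"
  shows "(\<integral>x. sphere_deriv u x (tproj x c) \<partial>sphere_volume) =
         (real DIM('a) - 1) * (\<integral>x. u x * (c \<bullet> x) \<partial>sphere_volume)"
proof -
  let ?S = "sphere (0::'a) 1"
  define K :: "'a \<Rightarrow> 'a \<Rightarrow> 'a" where "K b x = (x \<bullet> b) *\<^sub>R c - (x \<bullet> c) *\<^sub>R b" for b x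
  define k where "k b x = (x \<bullet> b) * sphere_deriv u x (K b x) + (K b x \<bullet> b) * u x" for b x
  have cc: "c \<bullet> c = 1" using c by (simp add: inner_Basis)
  have Kt: "K b x \<in> tangent x" for b x by (simp add: K_def tangent_def inner_diff_right)
  have uc: "continuous_on ?S u" by (rule sphere_C1_continuous[OF u])
  have Kc: "continuous_on ?S (K b)" for b unfolding K_def by (intro continuous_intros)
  have kc: "continuous_on ?S (k b)" for b
    unfolding k_def by (intro continuous_intros uc Kc sphere_C1_continuous_deriv u Kt)
  have int0: "(\<integral>x. k b x \<partial>sphere_volume) = 0" if b: "b \<in> Basis" for b
  \<comment> \<open>A plane rotation takes two orthogonal directions, so \<open>b = c\<close> is a
    case of its own; there \<open>K b\<close> vanishes identically.\<close>
  proof (cases "b = c")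
    case True
    then have "K b x = 0" for x by (simp add: K_def)
    then have "k b x = 0" if "x \<in> ?S" for x
      using linear_0[OF sphere_C1_linear[OF u that]] by (simp add: k_def)
    then have "(\<integral>x. k b x \<partial>sphere_volume) = (\<integral>x. 0 \<partial>(sphere_volume :: 'a measure))"
      by (intro Bochner_Integration.integral_cong) auto
    then show ?thesis by simp
  next
    case False
    then have "b \<bullet> b = 1" "c \<bullet> c = 1" "b \<bullet> c = 0" using b c by (simp_all add: inner_Basis)
    from integral_sphere_killing[OF this sphere_C1_mult[OF sphere_C1_inner_left[of b] u]]
    have "0 = (\<integral>x. sphere_deriv (\<lambda>y. (y \<bullet> b) * u y) x (K b x) \<partial>sphere_volume)"
      by (simp add: K_def)
    also have "\<dots> = (\<integral>x. k b x \<partial>sphere_volume)"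
    proof (rule Bochner_Integration.integral_cong[OF refl])
      fix x :: 'a assume "x \<in> space sphere_volume"
      then have x: "x \<in> ?S" by simp
      show "sphere_deriv (\<lambda>y. (y \<bullet> b) * u y) x (K b x) = k b x"
        unfolding sphere_deriv_mult[OF sphere_C1_inner_left u x Kt] k_def
          sphere_deriv_bounded_linear[OF bounded_linear_inner_left x Kt] by simp
    qed
    finally show ?thesis by simp
  qed
  have "(\<Sum>b\<in>Basis. k b x) = sphere_deriv u x (tproj x c) - (real DIM('a) - 1) * (u x * (c \<bullet> x))"
    if x: "x \<in> ?S" for x
  proof -
    note lin = sphere_C1_linear[OF u x]
    have xx: "x \<bullet> x = 1" using x by (simp add: norm_eq_1)
    have 1: "(\<Sum>b\<in>Basis. (x \<bullet> b) *\<^sub>R K b x) = tproj x c"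
    proof -
      have "(\<Sum>b\<in>Basis. (x \<bullet> b) *\<^sub>R K b x) =
          (\<Sum>b\<in>Basis. (x \<bullet> b) * (x \<bullet> b)) *\<^sub>R c - (x \<bullet> c) *\<^sub>R (\<Sum>b\<in>Basis. (x \<bullet> b) *\<^sub>R b)"
        by (simp add: K_def scaleR_diff_right sum_subtractf scaleR_sum_left scaleR_sum_right
            mult.commute)
      also have "(\<Sum>b\<in>Basis. (x \<bullet> b) * (x \<bullet> b)) = 1"
        using xx euclidean_inner[of x x] by simp
      finally show ?thesis by (simp add: tproj_def inner_commute[of x c] euclidean_representation)
    qed
    have 2: "(\<Sum>b\<in>Basis. K b x \<bullet> b) = (1 - real DIM('a)) * (c \<bullet> x)"
    proof -
      have "(\<Sum>b\<in>Basis. K b x \<bullet> b) = (\<Sum>b\<in>Basis. (x \<bullet> b) * (c \<bullet> b) - (x \<bullet> c))"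
        by (rule sum.cong) (simp_all add: K_def inner_diff_left inner_Basis)
      also have "\<dots> = x \<bullet> c - real DIM('a) * (x \<bullet> c)"
        using euclidean_inner[of x c] by (simp add: sum_subtractf)
      finally show ?thesis by (simp add: inner_commute algebra_simps)
    qed
    have "(\<Sum>b\<in>Basis. k b x) = sphere_deriv u x (\<Sum>b\<in>Basis. (x \<bullet> b) *\<^sub>R K b x) +
        (\<Sum>b\<in>Basis. K b x \<bullet> b) * u x"
      by (simp add: k_def sum.distrib linear_sum[OF lin] linear_scale[OF lin] sum_distrib_right)
    then show ?thesis unfolding 1 2 by (simp add: algebra_simps)
  qed
  then have "(\<integral>x. (\<Sum>b\<in>Basis. k b x) \<partial>sphere_volume) =
      (\<integral>x. sphere_deriv u x (tproj x c) - (real DIM('a) - 1) * (u x * (c \<bullet> x)) \<partial>sphere_volume)"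
    by (intro Bochner_Integration.integral_cong) auto
  also have "\<dots> = (\<integral>x. sphere_deriv u x (tproj x c) \<partial>sphere_volume) -
      (\<integral>x. (real DIM('a) - 1) * (u x * (c \<bullet> x)) \<partial>sphere_volume)"
    by (intro Bochner_Integration.integral_diff integrable_sphere_continuous
        continuous_on_sphere_deriv_tproj u continuous_intros uc)
  also have "(\<integral>x. (\<Sum>b\<in>Basis. k b x) \<partial>sphere_volume) = 0"
    by (subst Bochner_Integration.integral_sum) (auto intro: integrable_sphere_continuous kc
        simp: int0)
  finally show ?thesis by simp
qed

lemma integral_sphere_tproj:
  fixes u :: "'a::euclidean_space \<Rightarrow> real"
  assumes u: "sphere_C1 u"
  shows "(\<integral>x. sphere_deriv u x (tproj x a) \<partial>sphere_volume) =
         (real DIM('a) - 1) * (\<integral>x. u x * (a \<bullet> x) \<partial>sphere_volume)"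
proof -
  have uc: "continuous_on (sphere 0 1) u" by (rule sphere_C1_continuous[OF u])
  have "(\<integral>x. sphere_deriv u x (tproj x a) \<partial>sphere_volume) =
      (\<integral>x. (\<Sum>c\<in>Basis. (a \<bullet> c) * sphere_deriv u x (tproj x c)) \<partial>sphere_volume)"
  proof (rule Bochner_Integration.integral_cong[OF refl])
    fix x :: 'a assume "x \<in> space sphere_volume"
    then have lin: "linear (sphere_deriv u x)" using sphere_C1_linear[OF u] by simp
    have "tproj x a = tproj x (\<Sum>c\<in>Basis. (a \<bullet> c) *\<^sub>R c)" by (simp add: euclidean_representation)
    then show "sphere_deriv u x (tproj x a) = (\<Sum>c\<in>Basis. (a \<bullet> c) * sphere_deriv u x (tproj x c))"
      by (simp only: linear_sum[OF linear_tproj] linear_scale[OF linear_tproj] linear_sum[OF lin]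
          linear_scale[OF lin] real_scaleR_def)
  qed
  also have "\<dots> = (\<Sum>c\<in>Basis. (a \<bullet> c) * ((real DIM('a) - 1) * (\<integral>x. u x * (c \<bullet> x) \<partial>sphere_volume)))"
    by (subst Bochner_Integration.integral_sum)
       (auto intro!: integrable_mult_right integrable_sphere_continuous
           continuous_on_sphere_deriv_tproj u
             simp: integral_sphere_tproj_Basis[OF u])
  also have "\<dots> = (real DIM('a) - 1) * (\<Sum>c\<in>Basis. \<integral>x. (a \<bullet> c) * (u x * (c \<bullet> x)) \<partial>sphere_volume)"
    unfolding integral_mult_right_zero sum_distrib_left by (intro sum.cong) (simp_all only: mult_ac)
  also have "(\<Sum>c\<in>Basis. \<integral>x. (a \<bullet> c) * (u x * (c \<bullet> x)) \<partial>sphere_volume) =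
      (\<integral>x. (\<Sum>c\<in>Basis. (a \<bullet> c) * (u x * (c \<bullet> x))) \<partial>sphere_volume)"
    by (rule Bochner_Integration.integral_sum[symmetric])
       (intro integrable_sphere_continuous continuous_intros uc)
  also have "\<dots> = (\<integral>x. u x * (a \<bullet> x) \<partial>sphere_volume)"
    by (rule Bochner_Integration.integral_cong[OF refl], subst (3) euclidean_inner)
       (simp add: sum_distrib_left inner_commute mult_ac)
  finally show ?thesis .
qed

text \<open>Expanding in components and moving \<open>J\<close> to the other side turns the
  integrand into the sum over \<open>c\<close> of the derivatives of \<open>u \<bullet> c\<close>
  along \<open>tproj x (- J c)\<close>, to which the divergence formula applies one component at a
  time. Skewness is used again to sum the right-hand sides. With \<open>J = hopf\<close> this
  removes derivatives from test fields.\<close>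

lemma integral_sphere_skew_divergence:
  fixes u :: "'a::euclidean_space \<Rightarrow> 'a" and J :: "'a \<Rightarrow> 'a"
  assumes u: "sphere_C1 u" and J: "linear J" and skew: "\<And>x y. J x \<bullet> y = - (x \<bullet> J y)"
  shows "(\<integral>x. (\<Sum>b\<in>Basis. J (tproj x b) \<bullet> sphere_deriv u x (tproj x b)) \<partial>sphere_volume) =
         (real DIM('a) - 1) * (\<integral>x. u x \<bullet> J x \<partial>sphere_volume)"
proof -
  have uc: "continuous_on (sphere 0 1) u" by (rule sphere_C1_continuous[OF u])
  have Jc: "continuous_on (sphere 0 1) J"
    using J linear_continuous_on linear_conv_bounded_linear by blast
  have ui: "sphere_C1 (\<lambda>x. u x \<bullet> c)" for c by (rule sphere_C1_inner[OF u sphere_C1_const])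
  have "(\<integral>x. (\<Sum>b\<in>Basis. J (tproj x b) \<bullet> sphere_deriv u x (tproj x b)) \<partial>sphere_volume) =
      (\<integral>x. (\<Sum>c\<in>Basis. sphere_deriv (\<lambda>y. u y \<bullet> c) x (tproj x (- J c))) \<partial>sphere_volume)"
  proof (rule Bochner_Integration.integral_cong[OF refl])
    fix x :: 'a assume "x \<in> space sphere_volume"
    then have x: "x \<in> sphere 0 1" by simp
    have D: "sphere_deriv (\<lambda>y. u y \<bullet> c) x v = sphere_deriv u x v \<bullet> c" if "v \<in> tangent x" for c v
      using sphere_deriv_inner[OF u sphere_C1_const x that] by
          (simp add: sphere_deriv_const[OF x that])
    have "(\<Sum>c\<in>Basis. sphere_deriv (\<lambda>y. u y \<bullet> c) x (tproj x (- J c))) =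
      (\<Sum>c\<in>Basis. \<Sum>b\<in>Basis. (- J c \<bullet> tproj x b) * (sphere_deriv u x (tproj x b) \<bullet> c))"
    proof (rule sum.cong[OF refl])
      fix c :: 'a
      have lin: "linear (sphere_deriv (\<lambda>y. u y \<bullet> c) x)" by (rule sphere_C1_linear[OF ui x])
      show "sphere_deriv (\<lambda>y. u y \<bullet> c) x (tproj x (- J c)) =
          (\<Sum>b\<in>Basis. (- J c \<bullet> tproj x b) * (sphere_deriv u x (tproj x b) \<bullet> c))"
        using x by (subst tproj_expansion[OF x]) (simp add: linear_sum[OF lin] linear_scale[OF
            lin] linear_neg[OF lin] D del: mem_sphere)
    qed
    also have "\<dots> = (\<Sum>b\<in>Basis. \<Sum>c\<in>Basis. (J (tproj x b) \<bullet> c) * (sphere_deriv u x (tproj x b) \<bullet> c))"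
      by (subst sum.swap) (simp add: skew inner_commute)
    also have "\<dots> = (\<Sum>b\<in>Basis. J (tproj x b) \<bullet> sphere_deriv u x (tproj x b))"
      by (simp add: euclidean_inner[symmetric])
    finally show "(\<Sum>b\<in>Basis. J (tproj x b) \<bullet> sphere_deriv u x (tproj x b)) =
      (\<Sum>c\<in>Basis. sphere_deriv (\<lambda>y. u y \<bullet> c) x (tproj x (- J c)))" by simp
  qed
  also have "\<dots> = (\<Sum>c\<in>Basis. (real DIM('a) - 1) * (\<integral>x. (u x \<bullet> c) * (- J c \<bullet> x) \<partial>sphere_volume))"
    by (subst Bochner_Integration.integral_sum)
       (auto intro!: integrable_sphere_continuous continuous_on_sphere_deriv_tproj ui
             simp: integral_sphere_tproj[OF ui] simp del: inner_minus_left)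
  also have "\<dots> = (real DIM('a) - 1) * (\<integral>x. (\<Sum>c\<in>Basis. (u x \<bullet> c) * (- J c \<bullet> x)) \<partial>sphere_volume)"
    by (subst Bochner_Integration.integral_sum)
       (auto intro!: integrable_sphere_continuous continuous_intros uc simp: sum_distrib_left
           simp del: inner_minus_left)
  also have "(\<lambda>x. \<Sum>c\<in>Basis. (u x \<bullet> c) * (- J c \<bullet> x)) = (\<lambda>x. u x \<bullet> J x)"
  proof
    fix x
    have "- J c \<bullet> x = J x \<bullet> c" for c using skew[of c x] by (simp add: inner_commute)
    then show "(\<Sum>c\<in>Basis. (u x \<bullet> c) * (- J c \<bullet> x)) = u x \<bullet> J x"
      by (simp add: euclidean_inner[of "u x" "J x"] del: inner_minus_left)
  qed
  finally show ?thesis .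
qed

section \<open>The Levi-Civita connection and the energy in ambient terms\<close>

lemma levi_civitaD:
  assumes "levi_civita nabla"
  shows levi_civita_vector_field:
      "\<forall>X Y. vector_field X \<longrightarrow> vector_field Y \<longrightarrow> vector_field (\<lambda>x. nabla x (X x) Y)"
    and levi_civita_metric: "\<forall>x\<in>sphere 0 1. \<forall>v\<in>tangent x. \<forall>Y Z. vector_field Y \<longrightarrow> vector_field Z \<longrightarrow>
        sphere_deriv (\<lambda>y. Y y \<bullet> Z y) x v = nabla x v Y \<bullet> Z x + Y x \<bullet> nabla x v Z"
    and levi_civita_torsion: "\<forall>x\<in>sphere 0 1. \<forall>X Y. vector_field X \<longrightarrow> vector_field Y \<longrightarrow>
        nabla x (X x) Y - nabla x (Y x) X = lie_bracket X Y x"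
  using assms unfolding levi_civita_def by - (elim conjE, assumption)+

text \<open>The difference of two Levi-Civita connections is symmetric in its first two arguments and
  skew in its last two, hence zero.\<close>

lemma levi_civita_unique:
  fixes nabla nabla' :: "'a::euclidean_space \<Rightarrow> 'a \<Rightarrow> ('a \<Rightarrow> 'a) \<Rightarrow> 'a"
  assumes n: "levi_civita nabla" and n': "levi_civita nabla'"
    and x: "x \<in> sphere 0 1" and v: "v \<in> tangent x" and Y: "vector_field Y"
  shows "nabla x v Y = nabla' x v Y"
proof -
  define T where "T X Y Z = (nabla x (X x) Y - nabla' x (X x) Y) \<bullet> Z x" for X Y Z
  have tg: "X x \<in> tangent x" if "vector_field X" for X using that x by (auto simp: vector_field_def)
  have sym: "T X Y Z = T Y X Z" if "vector_field X" "vector_field Y" for X Y Z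
  proof -
    have "nabla x (X x) Y - nabla x (Y x) X = lie_bracket X Y x"
         "nabla' x (X x) Y - nabla' x (Y x) X = lie_bracket X Y x"
      using levi_civita_torsion[OF n] levi_civita_torsion[OF n'] x that by blast+
    then have "nabla x (X x) Y - nabla' x (X x) Y = nabla x (Y x) X - nabla' x (Y x) X"
      by (metis (no_types, opaque_lifting) add_diff_cancel_left' diff_add_cancel diff_diff_eq2)
    then show ?thesis by (simp add: T_def)
  qed
  have skew: "T X Y Z = - T X Z Y" if X: "vector_field X" and Y: "vector_field Y" "vector_field Z"
      for X Y Z
  proof -
    have "sphere_deriv (\<lambda>y. Y y \<bullet> Z y) x (X x) = nabla x (X x) Y \<bullet> Z x + Y x \<bullet> nabla x (X x) Z"
         "sphere_deriv (\<lambda>y. Y y \<bullet> Z y) x (X x) = nabla' x (X x) Y \<bullet> Z x + Y x \<bullet> nabla' x (X x) Z"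
      using levi_civita_metric[OF n] levi_civita_metric[OF n'] x Y tg[OF X] by blast+
    then show ?thesis by (simp add: T_def inner_diff_left inner_diff_right inner_commute)
  qed
  have T0: "T X Y Z = 0" if "vector_field X" "vector_field Y" "vector_field Z" for X Y Z
    using sym[of X Y Z] skew[of Y X Z] sym[of Y Z X] skew[of Z Y X] sym[of Z X Y] skew[of X Z Y]
        that by linarith
  \<comment> \<open>\<open>T\<close> takes vector fields, so the tangent vectors \<open>v\<close>
    and, later, \<open>w\<close> are extended by projecting them as constant ambient vectors; the
    extensions have the right value at \<open>x\<close>.\<close>
  define V where "V = (\<lambda>y. tproj y v)"
  have V: "vector_field V" "V x = v" using v by (auto simp: V_def vector_field_tproj tproj_id)
  define w where "w = nabla x v Y - nabla' x v Y"
  have "vector_field (\<lambda>x. nabla x (V x) Y)" "vector_field (\<lambda>x. nabla' x (V x) Y)"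
    using levi_civita_vector_field[OF n] levi_civita_vector_field[OF n'] V(1) Y by blast+
  then have "nabla x v Y \<in> tangent x" "nabla' x v Y \<in> tangent x"
    using x V(2) unfolding vector_field_def by (metis (no_types, lifting))+
  then have w: "w \<in> tangent x" by (simp add: w_def tangent_def inner_diff_right)
  have "T V Y (\<lambda>y. tproj y w) = 0" by (intro T0 V Y vector_field_tproj)
  then have "w \<bullet> w = 0" using V(2) w by (simp add: T_def w_def[symmetric] tproj_id)
  then show ?thesis by (simp add: w_def)
qed

lemma levi_civita_sphere:
  assumes "levi_civita nabla" "x \<in> sphere 0 1" "v \<in> tangent x" "vector_field Y"
  shows "nabla x v Y = tproj x (sphere_deriv Y x v)"
  using levi_civita_unique[OF assms(1) levi_civita_tangential assms(2-4)]
  by (simp add: tproj_def inner_commute)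

lemma tangent_onb_exists: "\<exists>B. tangent_onb x B"
  using orthonormal_basis_subspace[OF subspace_tangent[of x]] unfolding tangent_onb_def by metis

lemma tangent_onb_expansion:
  assumes B: "tangent_onb x B" and v: "v \<in> tangent x"
  shows "finite B" "v = (\<Sum>e\<in>B. (v \<bullet> e) *\<^sub>R e)"
proof -
  have o: "pairwise orthogonal B" and 1: "\<And>b. b \<in> B \<Longrightarrow> norm b = 1" and s: "span B = tangent x"
    using B by (auto simp: tangent_onb_def)
  have "0 \<notin> B" using 1 by force
  with o have "independent B" by (rule pairwise_orthogonal_independent)
  then show f: "finite B" by (rule independent_imp_finite)
  define w where "w = v - (\<Sum>e\<in>B. (v \<bullet> e) *\<^sub>R e)"
  have "w \<bullet> b = 0" if b: "b \<in> B" for b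
  proof -
    have "(\<Sum>e\<in>B. (v \<bullet> e) * (e \<bullet> b)) = (\<Sum>e\<in>B. if e = b then v \<bullet> b else 0)"
      using o b 1[OF b] by (intro sum.cong) (auto simp: pairwise_def orthogonal_def norm_eq_1)
    then show ?thesis using f b by (simp add: w_def inner_diff_left inner_sum_left)
  qed
  moreover have "w \<in> span B"
  proof -
    have "v \<in> span B" using v s by simp
    then show ?thesis unfolding w_def by (intro span_diff span_sum span_scale)
        (simp_all add: span_base)
  qed
  ultimately have "orthogonal w w"
    by (intro orthogonal_to_span[of w B]) (auto simp: orthogonal_def)
  then have "w = 0" by (simp add: orthogonal_def)
  then show "v = (\<Sum>e\<in>B. (v \<bullet> e) *\<^sub>R e)" by (simp add: w_def)
qed

text \<open>Both sides are the squared Hilbert-Schmidt norm of \<open>L\<close> on the tangent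
  space: \<open>tproj x b\<close> is expanded in \<open>B\<close>, and the sum over \<open>b\<close>
  is then collapsed by the frame expansion of each \<open>e\<close>. This replaces the basis chosen
  by \<open>SOME\<close> in \<open>nabla_norm_sq\<close> with the projected ambient one.\<close>

lemma sum_onb_norm_sq:
  fixes L :: "'a::euclidean_space \<Rightarrow> 'b::euclidean_space"
  assumes x: "x \<in> sphere 0 1" and B: "tangent_onb x B" and L: "linear L"
  shows "(\<Sum>e\<in>B. (norm (L e))\<^sup>2) = (\<Sum>b\<in>Basis. (norm (L (tproj x b)))\<^sup>2)"
proof -
  have f: "finite B" and t: "\<And>e. e \<in> B \<Longrightarrow> e \<in> tangent x"
    using tangent_onb_expansion(1)[OF B, of 0] B by (auto simp: tangent_onb_def tangent_def)
  have L1: "L (tproj x b) = (\<Sum>e\<in>B. (tproj x b \<bullet> e) *\<^sub>R L e)" for b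
    using tangent_onb_expansion(2)[OF B tproj_tangent[OF x, of b]]
      linear_sum[OF L, of "\<lambda>e. (tproj x b \<bullet> e) *\<^sub>R e" B] by (simp add: linear_scale[OF L])
  have "(\<Sum>b\<in>Basis. (norm (L (tproj x b)))\<^sup>2) = (\<Sum>b\<in>Basis. L (tproj x b) \<bullet> L (tproj x b))"
    by (simp add: power2_norm_eq_inner)
  also have "\<dots> = (\<Sum>b\<in>Basis. \<Sum>e\<in>B. (e \<bullet> tproj x b) * (L e \<bullet> L (tproj x b)))"
    by (subst (2) L1) (simp add: inner_sum_right inner_commute)
  also have "\<dots> = (\<Sum>e\<in>B. L e \<bullet> L (\<Sum>b\<in>Basis. (e \<bullet> tproj x b) *\<^sub>R tproj x b))"
    by (subst sum.swap) (simp add: linear_sum[OF L] linear_scale[OF L] inner_sum_right)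
  also have "\<dots> = (\<Sum>e\<in>B. (norm (L e))\<^sup>2)"
    by (intro sum.cong) (simp_all add: tproj_expansion[OF x, symmetric] tproj_id[OF t]
        power2_norm_eq_inner)
  finally show ?thesis by simp
qed

lemma vector_field_C1: "vector_field s \<Longrightarrow> sphere_C1 s"
  by (simp add: vector_field_def sphere_C1_smooth)

text \<open>Differentiating \<open>y \<bullet> s y = 0\<close> along the sphere gives the normal
  part of the ambient derivative, that is, the second fundamental form.\<close>

lemma inner_sphere_deriv_vector_field:
  assumes s: "vector_field s" and x: "x \<in> sphere 0 1" and v: "v \<in> tangent x"
  shows "x \<bullet> sphere_deriv s x v = - (v \<bullet> s x)"
proof -
  have "sphere_deriv (\<lambda>y. y \<bullet> s y) x v = x \<bullet> sphere_deriv s x v + v \<bullet> s x"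
    using sphere_deriv_inner[OF sphere_C1_bounded_linear[OF bounded_linear_ident]
        vector_field_C1[OF s] x v]
    by (simp add: sphere_deriv_bounded_linear[OF bounded_linear_ident x v])
  moreover have "sphere_deriv (\<lambda>y. y \<bullet> s y) x v = 0"
  proof (rule sphere_deriv_eq[OF _ x v])
    show "((\<lambda>y. y \<bullet> s y) has_derivative (\<lambda>v. 0)) (at x within sphere 0 1)"
      using x s by (intro has_derivative_transform[OF x _ has_derivative_const[of 0]])
        (auto simp: vector_field_def tangent_def)
  qed
  ultimately show ?thesis by simp
qed

text \<open>Gauss formula: the covariant derivative is the tangential part of the ambient one, and
  the squared normal parts \<open>(s x \<bullet> tproj x b)\<^sup>2\<close> sum to
  \<open>(norm (s x))\<^sup>2\<close> by the frame identity. This is the origin of the zeroth-order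
  term in the energy.\<close>

lemma nabla_norm_sq_eq:
  assumes n: "levi_civita nabla" and s: "vector_field s" and x: "x \<in> sphere 0 1"
  shows "nabla_norm_sq nabla s x = (\<Sum>b\<in>Basis. (norm (sphere_deriv s x (tproj x b)))\<^sup>2) - (norm
      (s x))\<^sup>2"
proof -
  let ?B = "SOME B. tangent_onb x B"
  have B: "tangent_onb x ?B" by (rule someI_ex[OF tangent_onb_exists])
  then have t: "e \<in> tangent x" if "e \<in> ?B" for e using that by (auto simp: tangent_onb_def)
  have lin: "linear (sphere_deriv s x)" by (rule sphere_C1_linear[OF vector_field_C1[OF s] x])
  have xx: "x \<bullet> x = 1" using x by (simp add: norm_eq_1)
  have sx: "s x \<in> tangent x" using s x by (auto simp: vector_field_def)
  have pyth: "(norm (tproj x w))\<^sup>2 = (norm w)\<^sup>2 - (x \<bullet> w)\<^sup>2" for w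
    unfolding power2_norm_eq_inner
    by (simp add: tproj_def inner_diff_left inner_diff_right xx inner_commute power2_eq_square)
  have "nabla_norm_sq nabla s x = (\<Sum>e\<in>?B. (norm (tproj x (sphere_deriv s x e)))\<^sup>2)"
    unfolding nabla_norm_sq_def by (intro sum.cong refl) (simp add: levi_civita_sphere[OF n x t s])
  also have "\<dots> = (\<Sum>b\<in>Basis. (norm (tproj x (sphere_deriv s x (tproj x b))))\<^sup>2)"
    using sum_onb_norm_sq[OF x B linear_compose[OF lin linear_tproj]] by (simp add: o_def)
  also have "\<dots> = (\<Sum>b\<in>Basis. (norm (sphere_deriv s x (tproj x b)))\<^sup>2 - (s x \<bullet> tproj x b)\<^sup>2)"
    using x by (intro sum.cong refl)
      (simp add: pyth inner_sphere_deriv_vector_field[OF s] inner_commute del: mem_sphere)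
  also have "\<dots> = (\<Sum>b\<in>Basis. (norm (sphere_deriv s x (tproj x b)))\<^sup>2) - (norm (s x))\<^sup>2"
    using sum_tproj_inner[OF x sx, of "s x"] by (simp add: sum_subtractf power2_eq_square
        power2_norm_eq_inner[symmetric])
  finally show ?thesis .
qed

text \<open>The definite description in \<open>sphere_grad\<close> is resolved by an explicit
  vector, the representative of \<open>v \<mapsto> sphere_deriv u x (tproj x v)\<close> on the
  ambient space; it is tangent because \<open>tproj x x = 0\<close>.\<close>

lemma sphere_grad_norm_sq:
  fixes u :: "'a::euclidean_space \<Rightarrow> real"
  assumes u: "sphere_C1 u" and x: "x \<in> sphere 0 1"
  shows "(norm (sphere_grad u x))\<^sup>2 = (\<Sum>b\<in>Basis. (sphere_deriv u x (tproj x b))\<^sup>2)"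
proof -
  define w where "w = (\<Sum>b\<in>Basis. sphere_deriv u x (tproj x b) *\<^sub>R b)"
  have lin: "linear (sphere_deriv u x)" by (rule sphere_C1_linear[OF u x])
  have wv: "w \<bullet> v = sphere_deriv u x (tproj x v)" for v
  proof -
    have "sphere_deriv u x (tproj x (\<Sum>b\<in>Basis. (v \<bullet> b) *\<^sub>R b)) = v \<bullet> w"
      by (simp only: linear_sum[OF linear_tproj] linear_scale[OF linear_tproj] linear_sum[OF lin]
          linear_scale[OF lin])
         (simp add: w_def inner_sum_right mult.commute)
    then show ?thesis by (simp add: euclidean_representation inner_commute[of w v])
  qed
  have "tproj x x = 0" using x by (simp add: tproj_def norm_eq_1)
  then have wt: "w \<in> tangent x"
    using wv[of x] linear_0[OF lin] by (simp add: tangent_def inner_commute)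
  have "sphere_grad u x = w"
    unfolding sphere_grad_def
  proof (rule the_equality)
    show "w \<in> tangent x \<and> (\<forall>v\<in>tangent x. w \<bullet> v = sphere_deriv u x v)"
      using wt wv by (simp add: tproj_id)
    fix w' assume w': "w' \<in> tangent x \<and> (\<forall>v\<in>tangent x. w' \<bullet> v = sphere_deriv u x v)"
    have "w' - w \<in> tangent x" using wt w' by (simp add: tangent_def inner_diff_right)
    then have "(w' - w) \<bullet> (w' - w) = 0"
      using w' wv[of "w' - w"] by (simp add: tproj_id inner_diff_left)
    then show "w' = w" by simp
  qed
  moreover have "(norm w)\<^sup>2 = (\<Sum>b\<in>Basis. (w \<bullet> b) * (w \<bullet> b))"
    unfolding power2_norm_eq_inner by (rule euclidean_inner)
  ultimately show ?thesis by (simp add: wv power2_eq_square)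
qed

text \<open>The connection disappears from the energy here: what remains are ambient derivatives
  along \<open>tproj x b\<close>. The form of the \<open>q\<close>-term comes from differentiating
  half the square of the norm of \<open>s\<close>.\<close>

lemma vertical_energy_eq:
  fixes s :: "'a::euclidean_space \<Rightarrow> 'a"
  assumes n: "levi_civita nabla" and s: "vector_field s"
  shows "vertical_energy nabla p q s = (1/2) * (\<integral>x. (1 + s x \<bullet> s x) powr - p *
     ((\<Sum>b\<in>Basis. sphere_deriv s x (tproj x b) \<bullet> sphere_deriv s x (tproj x b)) - s x \<bullet> s x
       + q * (\<Sum>b\<in>Basis. (s x \<bullet> sphere_deriv s x (tproj x b))\<^sup>2)) \<partial>sphere_volume)"
  unfolding vertical_energy_def
proof (intro arg_cong[of _ _ "\<lambda>z. 1 / 2 * z"] Bochner_Integration.integral_cong refl)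
  fix x :: 'a assume "x \<in> space sphere_volume"
  then have x: "x \<in> sphere 0 1" by simp
  note C = vector_field_C1[OF s]
  have F: "(\<lambda>y. (norm (s y))\<^sup>2 / 2) = (\<lambda>y. (1/2) * (s y \<bullet> s y))" by (auto
      simp: power2_norm_eq_inner)
  have CF: "sphere_C1 (\<lambda>y. (1/2) * (s y \<bullet> s y))"
    by (rule sphere_C1_mult[OF sphere_C1_const sphere_C1_inner[OF C C]])
  have "sphere_deriv (\<lambda>y. (1/2) * (s y \<bullet> s y)) x v = s x \<bullet> sphere_deriv s x v" if "v \<in> tangent x"
      for v
    unfolding sphere_deriv_mult[OF sphere_C1_const sphere_C1_inner[OF C C] x that]
      sphere_deriv_inner[OF C C x that] sphere_deriv_const[OF x that]
    by (simp add: inner_commute)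
  then have "(norm (sphere_grad (\<lambda>y. (norm (s y))\<^sup>2 / 2) x))\<^sup>2 = (\<Sum>b\<in>Basis.
      (s x \<bullet> sphere_deriv s x (tproj x b))\<^sup>2)"
    unfolding F sphere_grad_norm_sq[OF CF x] using x by (intro sum.cong) auto
  then show "1 / (1 + (norm (s x))\<^sup>2) powr p * (nabla_norm_sq nabla s x + q * (norm (sphere_grad
      (\<lambda>y. (norm (s y))\<^sup>2 / 2) x))\<^sup>2) =
     (1 + s x \<bullet> s x) powr - p *
     ((\<Sum>b\<in>Basis. sphere_deriv s x (tproj x b) \<bullet> sphere_deriv s x (tproj x b)) - s x \<bullet> s x
       + q * (\<Sum>b\<in>Basis. (s x \<bullet> sphere_deriv s x (tproj x b))\<^sup>2))"
    by (simp add: nabla_norm_sq_eq[OF n s x] power2_norm_eq_inner powr_minus divide_simps)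
qed

section \<open>Smooth families\<close>

text \<open>The induction varies \<open>G\<close>: the derivative of the slice along
  \<open>v\<close> is the slice of the derivative of \<open>G\<close> along \<open>(0, v)\<close>,
  which is again of the assumed kind.\<close>

lemma ck_on_slice:
  assumes "open W" "open V" "{t} \<times> V \<subseteq> W" "ck_on k W G"
  shows "ck_on k V (\<lambda>x. G (t, x))"
  using assms(4)
proof (induction k arbitrary: G)
  case 0
  have "continuous_on V (\<lambda>x. (t, x))" by (intro continuous_intros)
  then show ?case using 0 assms(3) by (auto intro!: continuous_on_compose2[of W G])
next
  case (Suc k)
  have d: "((\<lambda>x. G (t, x)) has_derivative (\<lambda>v. frechet_derivative G (at (t, x)) (0, v))) (at x)"
    if "x \<in> V" for x
  proof (rule has_derivative_compose[where g = G])
    show "(Pair t has_derivative Pair 0) (at x)"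
      by (auto intro!: derivative_eq_intros)
    show "(G has_derivative frechet_derivative G (at (t, x))) (at (t, x))"
      using Suc.prems that assms(3) by (auto simp flip: frechet_derivative_works)
  qed
  have "ck_on k V (\<lambda>x. frechet_derivative G (at (t, x)) (0, v))" for v
    using Suc by auto
  then have "ck_on k V (\<lambda>x. frechet_derivative (\<lambda>x. G (t, x)) (at x) v)" for v
    by (rule ck_on_cong[OF assms(2)]) (simp add: frechet_derivative_at[OF d, symmetric])
  moreover have "\<forall>x\<in>V. (\<lambda>x. G (t, x)) differentiable (at x)"
    using d unfolding differentiable_def by blast
  ultimately show ?case by simp
qed

lemma ck_on_snd:
  fixes g :: "'b::euclidean_space \<Rightarrow> 'c::real_normed_vector"
  assumes U: "open U" and "ck_on k U g"
  shows "ck_on k (UNIV \<times> U) (\<lambda>z :: 'a::euclidean_space \<times> 'b. g (snd z))"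
  using assms(2)
proof (induction k arbitrary: g)
  case 0
  then show ?case by (auto intro!: continuous_on_compose2[of U g] continuous_intros)
next
  case (Suc k)
  let ?W = "UNIV \<times> U :: ('a \<times> 'b) set"
  have d: "((\<lambda>z :: 'a \<times> 'b. g (snd z)) has_derivative (\<lambda>v. frechet_derivative g (at (snd z))
      (snd v))) (at z)"
    if "z \<in> ?W" for z
  proof (rule has_derivative_compose[where g = g])
    show "(snd has_derivative snd) (at z)" by (rule bounded_linear_imp_has_derivative[OF
        bounded_linear_snd])
    show "(g has_derivative frechet_derivative g (at (snd z))) (at (snd z))"
      using Suc.prems that by (auto simp flip: frechet_derivative_works)
  qed
  have "ck_on k ?W (\<lambda>z. frechet_derivative g (at (snd z)) (snd v))" for v :: "'a \<times> 'b"
    using Suc by auto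
  then have "ck_on k ?W (\<lambda>z. frechet_derivative (\<lambda>z. g (snd z)) (at z) v)" for v
    by (rule ck_on_cong[OF open_Times[OF open_UNIV U]]) (simp add: frechet_derivative_at[OF d,
        symmetric])
  moreover have "\<forall>z\<in>?W. (\<lambda>z. g (snd z)) differentiable (at z)"
    using d unfolding differentiable_def by blast
  ultimately show ?case by simp
qed

lemma smooth_on_snd:
  assumes "smooth_on S g"
  shows "smooth_on (I \<times> S) (\<lambda>z :: 'a::euclidean_space \<times> 'b::euclidean_space. g (snd z))"
  unfolding smooth_on_def
proof
  fix z :: "'a \<times> 'b" assume "z \<in> I \<times> S"
  then obtain U G where U: "open U" "snd z \<in> U" "\<And>k. ck_on k U G" "\<And>y. y \<in> S \<inter> U \<Longrightarrow> G y = g y"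
    using assms unfolding smooth_on_def by (metis SigmaE2 prod.collapse)
  show "\<exists>W H. open W \<and> z \<in> W \<and> (\<forall>k. ck_on k W H) \<and> (\<forall>y\<in>I \<times> S \<inter> W. H y = g (snd y))"
    using U by (intro exI[of _ "UNIV \<times> U"] exI[of _ "\<lambda>z. G (snd z)"])
      (auto intro: ck_on_snd open_Times simp: mem_Times_iff)
qed

lemma product_neighbourhood:
  assumes "open W" "(t, x) \<in> W"
  obtains U V where "open U" "open V" "t \<in> U" "x \<in> V" "U \<times> V \<subseteq> W"
  using open_prod_elim[OF assms] by (metis mem_Sigma_iff)

lemma smooth_on_slice:
  assumes s: "smooth_on (I \<times> S) (\<lambda>(t, x). g t x)" and t: "t \<in> I"
  shows "smooth_on S (g t)"
  unfolding smooth_on_def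
proof
  fix x assume x: "x \<in> S"
  then obtain W G where W: "open W" "(t, x) \<in> W" "\<And>k. ck_on k W G"
      "\<And>y. y \<in> (I \<times> S) \<inter> W \<Longrightarrow> G y = (\<lambda>(t, x). g t x) y"
    using s t unfolding smooth_on_def by (metis SigmaI)
  obtain U V where V: "open U" "open V" "t \<in> U" "x \<in> V" "U \<times> V \<subseteq> W"
    using product_neighbourhood[OF W(1,2)] .
  have "ck_on k V (\<lambda>x. G (t, x))" for k
    by (rule ck_on_slice[OF W(1) V(2) _ W(3)]) (use V in auto)
  moreover have "G (t, y) = g t y" if "y \<in> S \<inter> V" for y
    using W(4)[of "(t, y)"] V that t by auto
  ultimately show "\<exists>U h. open U \<and> x \<in> U \<and> (\<forall>k. ck_on k U h) \<and> (\<forall>y\<in>S \<inter> U. h y = g t y)"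
    using V by (intro exI[of _ V] exI[of _ "\<lambda>x. G (t, x)"]) auto
qed

text \<open>A local extension \<open>G\<close> in both variables yields the spatial derivative as
  its own derivative along the directions \<open>(0, b)\<close>, so joint smoothness is inherited.
  This makes the Lipschitz bound in \<open>t\<close> available for the derivatives of a
  variation.\<close>

lemma smooth_on_slice_deriv:
  fixes g :: "real \<Rightarrow> 'a::euclidean_space \<Rightarrow> 'b::real_normed_vector"
  assumes s: "smooth_on (I \<times> sphere 0 1) (\<lambda>(t, x). g t x)"
  shows "smooth_on (I \<times> sphere 0 1) (\<lambda>(t, x). sphere_deriv (g t) x (tproj x a))"
  unfolding smooth_on_def
proof
  let ?S = "sphere (0::'a) 1"
  fix z :: "real \<times> 'a" assume z: "z \<in> I \<times> ?S"
  then obtain W G where W: "open W" "z \<in> W" "\<And>k. ck_on k W G"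
      "\<And>y. y \<in> (I \<times> ?S) \<inter> W \<Longrightarrow> G y = (\<lambda>(t, x). g t x) y"
    using s unfolding smooth_on_def by metis
  \<comment> \<open>The direction \<open>tproj (snd z) a\<close> moves with the point, whereas
    \<open>ck_on\<close> controls derivatives in fixed directions; hence the expansion in the
    basis.\<close>
  define H where "H = (\<lambda>z. \<Sum>b\<in>Basis. (tproj (snd z) a \<bullet> b) *\<^sub>R frechet_derivative G (at z) (0, b))"
  have dG: "ck_on k W (\<lambda>z. frechet_derivative G (at z) v)" for k v
    using W(3)[of "Suc k"] unfolding ck_on.simps by blast
  have p: "ck_on k W (\<lambda>z. tproj (snd z) a)" for k
  proof -
    have "ck_on k W (\<lambda>z::real \<times> 'a. a + (-1) *\<^sub>R ((a \<bullet> snd z) *\<^sub>R snd z))"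
      by (intro ck_on_add W(1) ck_on_const ck_on_bilinear[OF W(1) bounded_bilinear_scaleR]
        ck_on_bilinear[OF W(1) bounded_bilinear_inner] ck_on_linear bounded_linear_snd)
    then show ?thesis by (simp add: tproj_def)
  qed
  have "ck_on k W H" for k
    unfolding H_def
    by (intro ck_on_sum W(1) ck_on_bilinear[OF W(1) bounded_bilinear_scaleR]
        ck_on_bilinear[OF W(1) bounded_bilinear_inner] dG p ck_on_const finite_Basis)
  moreover have "H y = (\<lambda>(t, x). sphere_deriv (g t) x (tproj x a)) y" if y: "y \<in> (I \<times> ?S) \<inter> W" for y
  proof -
    obtain t x where tx: "y = (t, x)" "t \<in> I" "x \<in> ?S" "(t, x) \<in> W" using y by auto
    obtain U V where V: "open U" "open V" "t \<in> U" "x \<in> V" "U \<times> V \<subseteq> W"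
      using product_neighbourhood[OF W(1) tx(4)] .
    have GD: "(G has_derivative frechet_derivative G (at (t, x))) (at (t, x))"
      using W(3)[of 1] tx(4) by (simp flip: frechet_derivative_works)
    have "((\<lambda>x. G (t, x)) has_derivative (\<lambda>v. frechet_derivative G (at (t, x)) (0, v))) (at x)"
    proof (rule has_derivative_compose[where g = G and f = "Pair t", OF _ GD])
      show "(Pair t has_derivative Pair 0) (at x)" by (auto intro!: derivative_eq_intros)
    qed
    then have fd: "frechet_derivative (\<lambda>x. G (t, x)) (at x) = (\<lambda>v. frechet_derivative G (at
        (t, x)) (0, v))"
      by (rule frechet_derivative_at[symmetric])
    have "(g t has_derivative frechet_derivative (\<lambda>x. G (t, x)) (at x)) (at x within ?S)"
    proof (rule local_extension_deriv[OF V(2,4) _ _ tx(3)])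
      show "ck_on k V (\<lambda>x. G (t, x))" for k
        by (rule ck_on_slice[OF W(1) V(2) _ W(3)]) (use V in auto)
      show "G (t, y) = g t y" if "y \<in> ?S \<inter> V" for y
        using W(4)[of "(t, y)"] V that tx by auto
    qed
    then have "sphere_deriv (g t) x (tproj x a) = frechet_derivative G (at (t, x)) (0, tproj x a)"
      unfolding fd by (rule sphere_deriv_eq) (use tx in auto)
    also have "(0, tproj x a) = (\<Sum>b\<in>Basis. (tproj x a \<bullet> b) *\<^sub>R (0::real, b))"
      by (rule prod_eqI) (simp_all add: fst_sum snd_sum euclidean_representation)
    also have "frechet_derivative G (at (t, x)) \<dots> = H y"
      using has_derivative_linear[OF GD] by (simp add: H_def tx(1) linear_sum linear_scale del:
          scaleR_Pair)
    finally show ?thesis by (simp add: tx(1))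
  qed
  ultimately show "\<exists>W H. open W \<and> z \<in> W \<and> (\<forall>k. ck_on k W H) \<and>
      (\<forall>y\<in>I \<times> ?S \<inter> W. H y = (\<lambda>(t, x). sphere_deriv (g t) x (tproj x a)) y)"
    using W(1,2) by blast
qed

text \<open>The \<open>t\<close>-derivative of a local extension is continuous, hence bounded on a
  compact box around \<open>(0, x)\<close>, and the mean value inequality in \<open>t\<close> turns
  this bound into the constant.\<close>

lemma smooth_on_lipschitz_local:
  fixes g :: "real \<Rightarrow> 'a::euclidean_space \<Rightarrow> 'b::real_normed_vector"
  assumes s: "smooth_on ({-\<epsilon><..<\<epsilon>} \<times> S) (\<lambda>(t, x). g t x)" and e: "\<epsilon> > 0" and x: "x \<in> S"
  shows "\<exists>V C \<delta>. open V \<and> x \<in> V \<and> C \<ge> 0 \<and> \<delta> > 0 \<and>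
     (\<forall>t y. \<bar>t\<bar> < \<delta> \<longrightarrow> y \<in> S \<inter> V \<longrightarrow> norm (g t y - g 0 y) \<le> C * \<bar>t\<bar>)"
proof -
  obtain W G where W: "open W" "(0, x) \<in> W" "\<And>k. ck_on k W G"
      "\<And>y. y \<in> ({-\<epsilon><..<\<epsilon>} \<times> S) \<inter> W \<Longrightarrow> G y = (\<lambda>(t, x). g t x) y"
    using s e x unfolding smooth_on_def by (metis SigmaI greaterThanLessThan_iff
        neg_less_0_iff_less)
  obtain U V where V: "open U" "open V" "0 \<in> U" "x \<in> V" "U \<times> V \<subseteq> W"
    using product_neighbourhood[OF W(1,2)] .
  obtain a where a: "a > 0" "cball 0 a \<subseteq> U" using V(1,3) open_contains_cball by blast
  obtain r where r: "r > 0" "cball x r \<subseteq> V" using V(2,4) open_contains_cball by blast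
  define H where "H = (\<lambda>z. frechet_derivative G (at z) (1, 0))"
  have KW: "cball 0 a \<times> cball x r \<subseteq> W" using V(5) a r by blast
  have "continuous_on W H" using W(3)[of "Suc 0"] by (simp add: H_def)
  then have "compact (H ` (cball 0 a \<times> cball x r))"
    using KW by (intro compact_continuous_image compact_Times compact_cball)
        (rule continuous_on_subset)
  then obtain C where C: "\<And>z. z \<in> cball 0 a \<times> cball x r \<Longrightarrow> norm (H z) \<le> C"
    using compact_imp_bounded bounded_iff by (metis imageI)
  have "norm (H (0, x)) \<le> C" using a r by (intro C) simp
  then have C0: "C \<ge> 0" by (rule order_trans[OF norm_ge_zero])
  \<comment> \<open>The box controls \<open>G\<close> for times up to \<open>a\<close>, but
    \<open>G\<close> is known to agree with \<open>g\<close> only for times below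
    \<open>\<epsilon>\<close>; hence the minimum.\<close>
  have "norm (g t y - g 0 y) \<le> C * \<bar>t\<bar>" if t: "\<bar>t\<bar> < min a \<epsilon>" and y: "y \<in> S \<inter> ball x r" for t y
  proof -
    have "((\<lambda>s. G (s, y)) has_derivative (\<lambda>h. h *\<^sub>R H (s, y))) (at s within cball 0 a)" if s:
        "s \<in> cball 0 a" for s
    proof -
      have "(s, y) \<in> W" using KW s y by auto
      then have GD: "(G has_derivative frechet_derivative G (at (s, y))) (at (s, y))"
        using W(3)[of 1] by (simp flip: frechet_derivative_works)
      have "((\<lambda>s. G (s, y)) has_derivative (\<lambda>h. frechet_derivative G (at (s, y)) (h, 0))) (at s)"
        by (rule has_derivative_compose[where g = G and f = "\<lambda>s. (s, y)", OF _ GD])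
            (auto intro!: derivative_eq_intros)
      moreover have "frechet_derivative G (at (s, y)) (h, 0) = h *\<^sub>R H (s, y)" for h
        using linear_scale[OF has_derivative_linear[OF GD], of h "(1, 0)"] by (simp add: H_def)
      ultimately show ?thesis by (simp add: has_derivative_at_withinI)
    qed
    moreover have "onorm (\<lambda>h. h *\<^sub>R H (s, y)) \<le> C" if s: "s \<in> cball 0 a" for s
    proof (rule onorm_le)
      fix h :: real
      have "norm (H (s, y)) \<le> C" using C[of "(s, y)"] s y by auto
      then show "norm (h *\<^sub>R H (s, y)) \<le> C * norm h"
        by (simp add: mult.commute[of C] mult_left_mono)
    qed
    ultimately have "norm (G (t, y) - G (0, y)) \<le> C * norm (t - 0)"
      using a t by (intro differentiable_bound[of "cball 0 a"]) (auto simp: convex_cball)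
    moreover have "(t, y) \<in> W" "(0, y) \<in> W" using KW t a y by auto
    then have "G (t, y) = g t y" "G (0, y) = g 0 y"
      using W(4)[of "(t, y)"] W(4)[of "(0, y)"] t y e by (auto simp: abs_less_iff)
    ultimately show ?thesis by simp
  qed
  then show ?thesis
    using C0 a(1) e r(1) by (intro exI[of _ "ball x r"] exI[of _ C] exI[of _ "min a \<epsilon>"]) auto
qed

lemma smooth_on_lipschitz:
  fixes g :: "real \<Rightarrow> 'a::euclidean_space \<Rightarrow> 'b::real_normed_vector"
  assumes s: "smooth_on ({-\<epsilon><..<\<epsilon>} \<times> S) (\<lambda>(t, x). g t x)" and e: "\<epsilon> > 0" and S: "compact S"
  obtains C \<delta> where "\<delta> > 0" "\<And>t y. \<bar>t\<bar> < \<delta> \<Longrightarrow> y \<in> S \<Longrightarrow> norm (g t y - g 0 y) \<le> C * \<bar>t\<bar>"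
proof -
  define P where "P x V C \<delta> \<longleftrightarrow> open V \<and> x \<in> V \<and> C \<ge> 0 \<and> \<delta> > 0 \<and>
     (\<forall>t y. \<bar>t\<bar> < \<delta> \<longrightarrow> y \<in> S \<inter> V \<longrightarrow> norm (g t y - g 0 y) \<le> C * \<bar>t\<bar>)" for x V C \<delta>
  have "\<exists>V C \<delta>. P x V C \<delta>" if "x \<in> S" for x
    unfolding P_def by (rule smooth_on_lipschitz_local[OF s e that])
  then obtain V C \<delta> where P: "\<And>x. x \<in> S \<Longrightarrow> P x (V x) (C x) (\<delta> x)" by metis
  note V = P[unfolded P_def, THEN conjunct1] P[unfolded P_def, THEN conjunct2, THEN conjunct1]
  note C = P[unfolded P_def, THEN conjunct2, THEN conjunct2, THEN conjunct1]
  note d = P[unfolded P_def, THEN conjunct2, THEN conjunct2, THEN conjunct2, THEN conjunct1]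
  have b: "norm (g t y - g 0 y) \<le> C x * \<bar>t\<bar>" if "x \<in> S" "\<bar>t\<bar> < \<delta> x" "y \<in> S \<inter> V x" for x t y
    using P[OF that(1)] that unfolding P_def by blast
  obtain F where F: "F \<subseteq> S" "finite F" "S \<subseteq> (\<Union>x\<in>F. V x)"
    by (rule compactE_image[OF S, of S V]) (use V in auto)
  show thesis
  proof
    \<comment> \<open>The inserted 1 keeps the minimum meaningful when the finite cover is
      empty.\<close>
    show "Min (insert 1 (\<delta> ` F)) > 0" using F d by auto
    fix t y assume t: "\<bar>t\<bar> < Min (insert 1 (\<delta> ` F))" and y: "y \<in> S"
    obtain x where x: "x \<in> F" "y \<in> V x" using F y by blast
    have "norm (g t y - g 0 y) \<le> C x * \<bar>t\<bar>"
      using x F t y by (intro b) auto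
    \<comment> \<open>All \<open>C x\<close> are nonnegative, so their sum serves as a single
      constant for the whole cover.\<close>
    also have "\<dots> \<le> (\<Sum>x\<in>F. C x) * \<bar>t\<bar>"
      using x F C by (intro mult_right_mono member_le_sum) auto
    finally show "norm (g t y - g 0 y) \<le> (\<Sum>x\<in>F. C x) * \<bar>t\<bar>" .
  qed
qed

section \<open>Uniform first-order expansions\<close>

text \<open>The first-order term \<open>g1\<close> may depend on \<open>t\<close> arbitrarily. Taking the full increment of a
  variation for it makes differentiation in \<open>t\<close>, hence mixed partial derivatives, unnecessary.\<close>

definition expands :: "(real \<Rightarrow> 'a::euclidean_space \<Rightarrow> 'b::real_normed_vector) \<Rightarrow> ('a \<Rightarrow> 'b)
    \<Rightarrow> (real \<Rightarrow> 'a \<Rightarrow> 'b) \<Rightarrow> bool" where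
  "expands g g0 g1 \<longleftrightarrow> (\<exists>C \<delta>. \<delta> > 0 \<and> (\<forall>t x. \<bar>t\<bar> < \<delta> \<longrightarrow> x \<in> sphere 0 1 \<longrightarrow>
     norm (g0 x) \<le> C \<and> norm (g1 t x) \<le> C * \<bar>t\<bar> \<and> norm (g t x - g0 x - g1 t x) \<le> C * t\<^sup>2))"

text \<open>Shrinking \<open>\<delta>\<close> to at most 1 gives
  \<open>t\<^sup>2 \<le> \<bar>t\<bar>\<close>, which absorbs the remainder: the increment is at
  most \<open>(C + C) * \<bar>t\<bar>\<close> and the value at most
  \<open>C + 2 * C\<close>.\<close>

lemma expandsE:
  fixes g :: "real \<Rightarrow> 'a::euclidean_space \<Rightarrow> 'b::real_normed_vector"
  assumes "expands g g0 g1"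
  obtains C \<delta> where "\<delta> > 0" "\<delta> \<le> 1" "C \<ge> 0"
    "\<And>t x. \<bar>t\<bar> < \<delta> \<Longrightarrow> x \<in> sphere 0 1 \<Longrightarrow> norm (g0 x) \<le> C"
    "\<And>t x. \<bar>t\<bar> < \<delta> \<Longrightarrow> x \<in> sphere 0 1 \<Longrightarrow> norm (g1 t x) \<le> C * \<bar>t\<bar>"
    "\<And>t x. \<bar>t\<bar> < \<delta> \<Longrightarrow> x \<in> sphere 0 1 \<Longrightarrow> norm (g t x - g0 x - g1 t x) \<le> C * t\<^sup>2"
    "\<And>t x. \<bar>t\<bar> < \<delta> \<Longrightarrow> x \<in> sphere 0 1 \<Longrightarrow> norm (g t x - g0 x) \<le> 2 * C * \<bar>t\<bar>"
    "\<And>t x. \<bar>t\<bar> < \<delta> \<Longrightarrow> x \<in> sphere 0 1 \<Longrightarrow> norm (g t x) \<le> 3 * C"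
proof -
  obtain C \<delta> where d: "\<delta> > 0" and b: "\<And>t x. \<bar>t\<bar> < \<delta> \<Longrightarrow> x \<in> sphere 0 1 \<Longrightarrow>
     norm (g0 x) \<le> C \<and> norm (g1 t x) \<le> C * \<bar>t\<bar> \<and> norm (g t x - g0 x - g1 t x) \<le> C * t\<^sup>2"
    using assms unfolding expands_def by blast
  define D where "D = \<bar>C\<bar>"
  have D: "D \<ge> 0" and CD: "C \<le> D" by (simp_all add: D_def)
  have 1: "norm (g0 x) \<le> D" "norm (g1 t x) \<le> D * \<bar>t\<bar>" "norm (g t x - g0 x - g1 t x) \<le> D * t\<^sup>2"
    if "\<bar>t\<bar> < \<delta>" "x \<in> sphere 0 1" for t x
    using b[OF that] mult_right_mono[OF CD, of "\<bar>t\<bar>"] mult_right_mono[OF CD, of "t\<^sup>2"] CD by auto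
  have 2: "norm (g t x - g0 x) \<le> 2 * D * \<bar>t\<bar>" if t: "\<bar>t\<bar> < min \<delta> 1" and x: "x \<in> sphere 0 1" for t x
  proof -
    have "t\<^sup>2 \<le> \<bar>t\<bar>" using t mult_left_le_one_le[of "\<bar>t\<bar>" "\<bar>t\<bar>"] by (simp add: power2_eq_square)
    then have "D * t\<^sup>2 \<le> D * \<bar>t\<bar>" using D by (rule mult_left_mono)
    moreover have "norm (g t x - g0 x) \<le> norm (g1 t x) + norm (g t x - g0 x - g1 t x)"
      using norm_triangle_ineq[of "g1 t x" "g t x - g0 x - g1 t x"] by simp
    moreover have "\<bar>t\<bar> < \<delta>" using t by simp
    ultimately show ?thesis using 1(2,3)[OF \<open>\<bar>t\<bar> < \<delta>\<close> x] by linarith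
  qed
  have 3: "norm (g t x) \<le> 3 * D" if t: "\<bar>t\<bar> < min \<delta> 1" and x: "x \<in> sphere 0 1" for t x
  proof -
    have "2 * D * \<bar>t\<bar> \<le> 2 * D" using t D by (simp add: mult_left_le)
    moreover have "norm (g t x) \<le> norm (g0 x) + norm (g t x - g0 x)"
      using norm_triangle_ineq[of "g0 x" "g t x - g0 x"] by simp
    moreover have "norm (g0 x) \<le> D" using 1(1)[of t x] t x by simp
    ultimately show ?thesis using 2[OF t x] by linarith
  qed
  show thesis
    by (rule that[of "min \<delta> 1" D]) (use d D 1 2 3 in auto)
qed

lemma expandsI:
  fixes g :: "real \<Rightarrow> 'a::euclidean_space \<Rightarrow> 'b::real_normed_vector"
  assumes "\<delta> > 0"
    "\<And>t x. \<bar>t\<bar> < \<delta> \<Longrightarrow> x \<in> sphere 0 1 \<Longrightarrow> norm (g0 x) \<le> A"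
    "\<And>t x. \<bar>t\<bar> < \<delta> \<Longrightarrow> x \<in> sphere 0 1 \<Longrightarrow> norm (g1 t x) \<le> B * \<bar>t\<bar>"
    "\<And>t x. \<bar>t\<bar> < \<delta> \<Longrightarrow> x \<in> sphere 0 1 \<Longrightarrow> norm (g t x - g0 x - g1 t x) \<le> C * t\<^sup>2"
  shows "expands g g0 g1"
  unfolding expands_def
proof (rule exI[of _ "max A (max B C)"], rule exI[of _ \<delta>], intro conjI allI impI)
  fix t x assume tx: "\<bar>t\<bar> < \<delta>" "x \<in> sphere (0::'a) 1"
  show "norm (g0 x) \<le> max A (max B C)" using assms(2)[OF tx] by simp
  show "norm (g1 t x) \<le> max A (max B C) * \<bar>t\<bar>"
    by (rule order_trans[OF assms(3)[OF tx] mult_right_mono]) auto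
  show "norm (g t x - g0 x - g1 t x) \<le> max A (max B C) * t\<^sup>2"
    by (rule order_trans[OF assms(4)[OF tx] mult_right_mono]) auto
qed (use assms in auto)

lemma expands_const:
  fixes g :: "'a::euclidean_space \<Rightarrow> 'b::real_normed_vector"
  assumes "\<And>x. x \<in> sphere 0 1 \<Longrightarrow> norm (g x) \<le> C"
  shows "expands (\<lambda>t. g) g (\<lambda>t x. 0)"
  by (rule expandsI[of 1 _ C _ 0 _ 0]) (use assms in auto)

lemma expands_add:
  fixes g :: "real \<Rightarrow> 'a::euclidean_space \<Rightarrow> 'b::real_normed_vector"
  assumes "expands g g0 g1" "expands h h0 h1"
  shows "expands (\<lambda>t x. g t x + h t x) (\<lambda>x. g0 x + h0 x) (\<lambda>t x. g1 t x + h1 t x)"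
proof -
  from assms(1) obtain C \<delta> where G: "\<delta> > 0"
    "\<And>t x. \<bar>t\<bar> < \<delta> \<Longrightarrow> x \<in> sphere 0 1 \<Longrightarrow> norm (g0 x) \<le> C"
    "\<And>t x. \<bar>t\<bar> < \<delta> \<Longrightarrow> x \<in> sphere 0 1 \<Longrightarrow> norm (g1 t x) \<le> C * \<bar>t\<bar>"
    "\<And>t x. \<bar>t\<bar> < \<delta> \<Longrightarrow> x \<in> sphere 0 1 \<Longrightarrow> norm (g t x - g0 x - g1 t x) \<le> C * t\<^sup>2"
    by (rule expandsE) blast
  from assms(2) obtain C' \<delta>' where H: "\<delta>' > 0"
    "\<And>t x. \<bar>t\<bar> < \<delta>' \<Longrightarrow> x \<in> sphere 0 1 \<Longrightarrow> norm (h0 x) \<le> C'"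
    "\<And>t x. \<bar>t\<bar> < \<delta>' \<Longrightarrow> x \<in> sphere 0 1 \<Longrightarrow> norm (h1 t x) \<le> C' * \<bar>t\<bar>"
    "\<And>t x. \<bar>t\<bar> < \<delta>' \<Longrightarrow> x \<in> sphere 0 1 \<Longrightarrow> norm (h t x - h0 x - h1 t x) \<le> C' * t\<^sup>2"
    by (rule expandsE) blast
  show ?thesis
  proof (rule expandsI[of "min \<delta> \<delta>'" _ "C + C'" _ "C + C'" _ "C + C'"])
    fix t x assume t: "\<bar>t\<bar> < min \<delta> \<delta>'" and x: "x \<in> sphere (0::'a) 1"
    then have t: "\<bar>t\<bar> < \<delta>" "\<bar>t\<bar> < \<delta>'" by auto
    show "norm (g0 x + h0 x) \<le> C + C'"
      by (rule norm_triangle_le[OF add_mono[OF G(2)[OF t(1) x] H(2)[OF t(2) x]]])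
    show "norm (g1 t x + h1 t x) \<le> (C + C') * \<bar>t\<bar>"
      using norm_triangle_le[OF add_mono[OF G(3)[OF t(1) x] H(3)[OF t(2) x]]] by
          (simp add: algebra_simps)
    have "g t x + h t x - (g0 x + h0 x) - (g1 t x + h1 t x) = (g t x - g0 x - g1 t x) +
        (h t x - h0 x - h1 t x)"
      by simp
    then show "norm (g t x + h t x - (g0 x + h0 x) - (g1 t x + h1 t x)) \<le> (C + C') * t\<^sup>2"
      using norm_triangle_le[OF add_mono[OF G(4)[OF t(1) x] H(4)[OF t(2) x]]] by
          (simp add: algebra_simps)
  qed (use G H in auto)
qed

lemma expands_sum:
  fixes g :: "'i \<Rightarrow> real \<Rightarrow> 'a::euclidean_space \<Rightarrow> 'b::real_normed_vector"
  assumes "finite I" "\<And>i. i \<in> I \<Longrightarrow> expands (g i) (g0 i) (g1 i)"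
  shows "expands (\<lambda>t x. \<Sum>i\<in>I. g i t x) (\<lambda>x. \<Sum>i\<in>I. g0 i x) (\<lambda>t x. \<Sum>i\<in>I. g1 i t x)"
  using assms
proof (induction I rule: finite_induct)
  case empty
  show ?case using expands_const[of "\<lambda>x. 0" 0] by simp
next
  case (insert i I)
  then show ?case using expands_add[of "g i" "g0 i" "g1 i"] by simp
qed

lemma expands_bilinear:
  fixes g :: "real \<Rightarrow> 'a::euclidean_space \<Rightarrow> 'b::real_normed_vector"
    and h :: "real \<Rightarrow> 'a \<Rightarrow> 'c::real_normed_vector"
  assumes B: "bounded_bilinear B" and g: "expands g g0 g1" and h: "expands h h0 h1"
  shows "expands (\<lambda>t x. B (g t x) (h t x)) (\<lambda>x. B (g0 x) (h0 x)) (\<lambda>t x. B (g0 x) (h1 t x) + B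
      (g1 t x) (h0 x))"
proof -
  interpret B: bounded_bilinear B by fact
  from g obtain C \<delta> where G: "\<delta> > 0" "C \<ge> 0"
    "\<And>t x. \<bar>t\<bar> < \<delta> \<Longrightarrow> x \<in> sphere 0 1 \<Longrightarrow> norm (g0 x) \<le> C"
    "\<And>t x. \<bar>t\<bar> < \<delta> \<Longrightarrow> x \<in> sphere 0 1 \<Longrightarrow> norm (g1 t x) \<le> C * \<bar>t\<bar>"
    "\<And>t x. \<bar>t\<bar> < \<delta> \<Longrightarrow> x \<in> sphere 0 1 \<Longrightarrow> norm (g t x - g0 x - g1 t x) \<le> C * t\<^sup>2"
    by (rule expandsE) blast
  from h obtain C' \<delta>' where H: "\<delta>' > 0" "C' \<ge> 0"
    "\<And>t x. \<bar>t\<bar> < \<delta>' \<Longrightarrow> x \<in> sphere 0 1 \<Longrightarrow> norm (h0 x) \<le> C'"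
    "\<And>t x. \<bar>t\<bar> < \<delta>' \<Longrightarrow> x \<in> sphere 0 1 \<Longrightarrow> norm (h1 t x) \<le> C' * \<bar>t\<bar>"
    "\<And>t x. \<bar>t\<bar> < \<delta>' \<Longrightarrow> x \<in> sphere 0 1 \<Longrightarrow> norm (h t x - h0 x - h1 t x) \<le> C' * t\<^sup>2"
    "\<And>t x. \<bar>t\<bar> < \<delta>' \<Longrightarrow> x \<in> sphere 0 1 \<Longrightarrow> norm (h t x - h0 x) \<le> 2 * C' * \<bar>t\<bar>"
    "\<And>t x. \<bar>t\<bar> < \<delta>' \<Longrightarrow> x \<in> sphere 0 1 \<Longrightarrow> norm (h t x) \<le> 3 * C'"
    by (rule expandsE) blast
  obtain K where K: "K \<ge> 0" "\<And>a b. norm (B a b) \<le> norm a * norm b * K" using B.nonneg_bounded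
      by blast
  have bd: "norm (B a b) \<le> K * (M * N)" if "norm a \<le> M" "norm b \<le> N" for a b M N
  proof -
    have "norm a * norm b \<le> M * N"
      using that by (intro mult_mono) (auto intro: order_trans[OF norm_ge_zero])
    then show ?thesis using K order_trans[OF K(2)] by (simp add: mult.commute mult_left_mono)
  qed
  show ?thesis
  proof (rule expandsI[of "min \<delta> \<delta>'" _ "K * (C * C')" _ "2 * (K * (C * C'))" _ "6 * (K *
      (C * C'))"])
    fix t x assume t: "\<bar>t\<bar> < min \<delta> \<delta>'" and x: "x \<in> sphere (0::'a) 1"
    then have t: "\<bar>t\<bar> < \<delta>" "\<bar>t\<bar> < \<delta>'" by auto
    note g = G(3-)[OF t(1) x] and h = H(3-)[OF t(2) x]
    show "norm (B (g0 x) (h0 x)) \<le> K * (C * C')"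
      by (rule bd[OF g(1) h(1)])
    show "norm (B (g0 x) (h1 t x) + B (g1 t x) (h0 x)) \<le> 2 * (K * (C * C')) * \<bar>t\<bar>"
      using norm_triangle_le[OF add_mono[OF bd[OF g(1) h(2)] bd[OF g(2) h(1)]]] by
          (simp add: algebra_simps)
    have sq: "\<bar>t\<bar> * (\<bar>t\<bar> * z) = t\<^sup>2 * z" for z :: real by (simp add: power2_eq_square)
    \<comment> \<open>The remainder telescopes into three terms of second order. The factors coming
      from \<open>h\<close> are bounded by \<open>C' * t\<^sup>2\<close>,
      \<open>2 * C' * \<bar>t\<bar>\<close> and \<open>3 * C'\<close>, so the terms contribute 1, 2
      and 3 times \<open>K * (C * C') * t\<^sup>2\<close>; hence the constant 6.\<close>
    have "B (g t x) (h t x) - B (g0 x) (h0 x) - (B (g0 x) (h1 t x) + B (g1 t x) (h0 x)) =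
        B (g0 x) (h t x - h0 x - h1 t x) + B (g1 t x) (h t x - h0 x) + B (g t x - g0 x - g1 t x)
            (h t x)"
      by (simp add: B.diff_left B.diff_right)
    also have "norm \<dots> \<le> K * (C * (C' * t\<^sup>2)) + K * (C * \<bar>t\<bar> * (2 * C' * \<bar>t\<bar>)) + K * (C * t\<^sup>2 *
        (3 * C'))"
      by (rule norm_triangle_le[OF add_mono[OF norm_triangle_le[OF add_mono]]])
        (rule bd g h)+
    also have "\<dots> = 6 * (K * (C * C')) * t\<^sup>2"
      using sq by (simp add: algebra_simps)
    finally show "norm (B (g t x) (h t x) - B (g0 x) (h0 x) - (B (g0 x) (h1 t x) + B (g1 t x)
        (h0 x)))
      \<le> 6 * (K * (C * C')) * t\<^sup>2" .
  qed (use G H in auto)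
qed

lemmas expands_mult = expands_bilinear[OF bounded_bilinear_mult]
  and expands_inner = expands_bilinear[OF bounded_bilinear_inner]

text \<open>Two uses of the mean value theorem: \<open>W b - W a = (b - a) * W' z\<close> with
  \<open>z\<close> between \<open>a\<close> and \<open>b\<close>, then
  \<open>W' z - W' a = (z - a) * W'' y\<close>, where \<open>z\<close> is no farther from
  \<open>a\<close> than \<open>b\<close> is. The sharp factor 1/2 is given up, and \<open>a\<close>,
  \<open>b\<close> may come in either order.\<close>

lemma taylor_remainder_bound:
  fixes W W' W'' :: "real \<Rightarrow> real"
  assumes W: "\<And>r. r \<ge> 0 \<Longrightarrow> (W has_real_derivative W' r) (at r)"
    and W': "\<And>r. r \<ge> 0 \<Longrightarrow> (W' has_real_derivative W'' r) (at r)"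
    and K: "\<And>r. 0 \<le> r \<Longrightarrow> r \<le> M \<Longrightarrow> \<bar>W'' r\<bar> \<le> K"
    and ab: "0 \<le> a" "a \<le> M" "0 \<le> b" "b \<le> M"
  shows "\<bar>W b - W a - W' a * (b - a)\<bar> \<le> K * (b - a)\<^sup>2"
proof -
  have mvt: "\<exists>z. min a b \<le> z \<and> z \<le> max a b \<and> f b - f a = (b - a) * f' z"
    if f: "\<And>r. r \<ge> 0 \<Longrightarrow> (f has_real_derivative f' r) (at r)" and ab: "0 \<le> a" "0 \<le> b" for f f' ::
        "real \<Rightarrow> real" and a b
  proof (cases a b rule: linorder_cases)
    case less
    then obtain z where "a < z" "z < b" "f b - f a = (b - a) * f' z"
      using MVT2[of a b f f'] f ab by (metis less_eq_real_def order_trans)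
    then show ?thesis using less by (intro exI[of _ z]) auto
  next
    case greater
    then obtain z where "b < z" "z < a" "f a - f b = (a - b) * f' z"
      using MVT2[of b a f f'] f ab by (metis less_eq_real_def order_trans)
    then show ?thesis using greater by (intro exI[of _ z]) (auto simp: algebra_simps)
  qed auto
  obtain z where z: "min a b \<le> z" "z \<le> max a b" "W b - W a = (b - a) * W' z"
    using mvt[OF W ab(1,3)] by blast
  have z0: "0 \<le> z" using z(1) ab by auto
  obtain y where y: "min a z \<le> y" "y \<le> max a z" "W' z - W' a = (z - a) * W'' y"
    using mvt[OF W' ab(1) z0] by blast
  have yM: "\<bar>W'' y\<bar> \<le> K" by (rule K) (use y z z0 ab in auto)
  have "W b - W a - W' a * (b - a) = (b - a) * (W' z - W' a)"
    using z(3) by (simp add: algebra_simps)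
  also have "\<dots> = (b - a) * ((z - a) * W'' y)" by (simp only: y(3))
  finally have "W b - W a - W' a * (b - a) = (b - a) * ((z - a) * W'' y)" .
  then have "\<bar>W b - W a - W' a * (b - a)\<bar> = \<bar>b - a\<bar> * (\<bar>z - a\<bar> * \<bar>W'' y\<bar>)"
    by (simp add: abs_mult)
  also have "\<dots> \<le> \<bar>b - a\<bar> * (\<bar>b - a\<bar> * K)"
    using z(1,2) yM by (intro mult_left_mono mult_mono) auto
  also have "\<dots> = K * \<bar>b - a\<bar>\<^sup>2" by (simp only: power2_eq_square mult_ac)
  finally show ?thesis by simp
qed

text \<open>Values of \<open>g\<close> stay in \<open>{0..3 * C}\<close>, where \<open>W\<close> and
  its two derivatives are bounded. Taylor's formula linearises \<open>W\<close> up to the square of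
  the increment of \<open>g\<close>, and replacing that increment by \<open>g1\<close> costs another
  error of second order. The half-line as domain suits real powers of \<open>1 + r\<close>.\<close>

lemma expands_compose:
  fixes W W' W'' :: "real \<Rightarrow> real" and g :: "real \<Rightarrow> 'a::euclidean_space \<Rightarrow> real"
  assumes W: "\<And>r. r \<ge> 0 \<Longrightarrow> (W has_real_derivative W' r) (at r)"
    and W': "\<And>r. r \<ge> 0 \<Longrightarrow> (W' has_real_derivative W'' r) (at r)"
    and W'': "continuous_on {0..} W''"
    and g: "expands g g0 g1" and nn: "\<And>t x. g t x \<ge> 0" "\<And>x. g0 x \<ge> 0"
  shows "expands (\<lambda>t x. W (g t x)) (\<lambda>x. W (g0 x)) (\<lambda>t x. W' (g0 x) * g1 t x)"
proof -
  from g obtain C \<delta> where G: "\<delta> > 0" "C \<ge> 0"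
    "\<And>t x. \<bar>t\<bar> < \<delta> \<Longrightarrow> x \<in> sphere 0 1 \<Longrightarrow> norm (g0 x) \<le> C"
    "\<And>t x. \<bar>t\<bar> < \<delta> \<Longrightarrow> x \<in> sphere 0 1 \<Longrightarrow> norm (g1 t x) \<le> C * \<bar>t\<bar>"
    "\<And>t x. \<bar>t\<bar> < \<delta> \<Longrightarrow> x \<in> sphere 0 1 \<Longrightarrow> norm (g t x - g0 x - g1 t x) \<le> C * t\<^sup>2"
    "\<And>t x. \<bar>t\<bar> < \<delta> \<Longrightarrow> x \<in> sphere 0 1 \<Longrightarrow> norm (g t x - g0 x) \<le> 2 * C * \<bar>t\<bar>"
    "\<And>t x. \<bar>t\<bar> < \<delta> \<Longrightarrow> x \<in> sphere 0 1 \<Longrightarrow> norm (g t x) \<le> 3 * C"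
    by (rule expandsE) blast
  have bounded: "\<exists>K\<ge>0. \<forall>r\<in>{0..3*C}. \<bar>f r\<bar> \<le> K" if "continuous_on {0..} f" for f :: "real \<Rightarrow> real"
  proof -
    have "continuous_on {0..3*C} f" using that by (rule continuous_on_subset) auto
    then have "bounded (f ` {0..3*C})" by (intro compact_imp_bounded compact_continuous_image) auto
    then obtain K where "\<forall>r\<in>{0..3*C}. \<bar>f r\<bar> \<le> K" unfolding bounded_iff by auto
    then show ?thesis by (intro exI[of _ "\<bar>K\<bar>"]) force
  qed
  have "continuous_on {0..} W" "continuous_on {0..} W'"
    using W W' by (auto intro!: continuous_at_imp_continuous_on DERIV_isCont)
  with W'' obtain K0 K1 K2 where K: "\<And>r. 0 \<le> r \<Longrightarrow> r \<le> 3 * C \<Longrightarrow> \<bar>W r\<bar> \<le> K0"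
     "\<And>r. 0 \<le> r \<Longrightarrow> r \<le> 3 * C \<Longrightarrow> \<bar>W' r\<bar> \<le> K1" "\<And>r. 0 \<le> r \<Longrightarrow> r \<le> 3 * C \<Longrightarrow> \<bar>W'' r\<bar> \<le> K2"
     and Kn: "K1 \<ge> 0" "K2 \<ge> 0"
    using bounded[of W] bounded[of W'] bounded[of W''] by (metis atLeastAtMost_iff)
  show ?thesis
  proof (rule expandsI[of \<delta> _ K0 _ "K1 * C" _ "K2 * (4 * C\<^sup>2) + K1 * C"])
    fix t x assume t: "\<bar>t\<bar> < \<delta>" and x: "x \<in> sphere (0::'a) 1"
    note b = G(3-)[OF t x]
    have r: "0 \<le> g0 x" "g0 x \<le> 3 * C" "0 \<le> g t x" "g t x \<le> 3 * C"
      using b(1,5) nn G(2) by auto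
    show "norm (W (g0 x)) \<le> K0" using K(1) r by simp
    show "norm (W' (g0 x) * g1 t x) \<le> K1 * C * \<bar>t\<bar>"
      unfolding norm_mult mult.assoc using K(2)[of "g0 x"] r b(2) Kn by (intro mult_mono) auto
    have "\<bar>W (g t x) - W (g0 x) - W' (g0 x) * (g t x - g0 x)\<bar> \<le> K2 * (g t x - g0 x)\<^sup>2"
      by (rule taylor_remainder_bound[OF W W' K(3)]) (use r in auto)
    also have "\<dots> \<le> K2 * (2 * C * \<bar>t\<bar>)\<^sup>2"
      using b(4) Kn power_mono[of "\<bar>g t x - g0 x\<bar>" "2 * C * \<bar>t\<bar>" 2] by (intro mult_left_mono) auto
    finally have 1: "\<bar>W (g t x) - W (g0 x) - W' (g0 x) * (g t x - g0 x)\<bar> \<le> K2 * (4 * C\<^sup>2) * t\<^sup>2"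
      by (simp add: power_mult_distrib)
    have 2: "\<bar>W' (g0 x) * (g t x - g0 x - g1 t x)\<bar> \<le> K1 * (C * t\<^sup>2)"
      unfolding abs_mult using K(2)[of "g0 x"] r b(3) Kn by (intro mult_mono) auto
    have "W (g t x) - W (g0 x) - W' (g0 x) * g1 t x =
        (W (g t x) - W (g0 x) - W' (g0 x) * (g t x - g0 x)) + W' (g0 x) * (g t x - g0 x - g1 t x)"
      by (simp add: algebra_simps)
    then have "\<bar>W (g t x) - W (g0 x) - W' (g0 x) * g1 t x\<bar> \<le> K2 * (4 * C\<^sup>2) * t\<^sup>2 + K1 * (C * t\<^sup>2)"
      using abs_triangle_ineq[of "W (g t x) - W (g0 x) - W' (g0 x) * (g t x - g0 x)" "W' (g0 x) *
          (g t x - g0 x - g1 t x)"] 1 2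
      by linarith
    then show "norm (W (g t x) - W (g0 x) - W' (g0 x) * g1 t x) \<le> (K2 * (4 * C\<^sup>2) + K1 * C) * t\<^sup>2"
      by (simp add: algebra_simps)
  qed (use G in auto)
qed

lemma powr_expansion_derivatives:
  fixes p :: real
  assumes "r \<ge> 0"
  shows "((\<lambda>r. (1 + r) powr - p) has_real_derivative - p * (1 + r) powr (- p - 1)) (at r)"
    and "((\<lambda>r. - p * (1 + r) powr (- p - 1)) has_real_derivative p * (p + 1) * (1 + r) powr
        (- p - 2)) (at r)"
proof -
  have d: "((\<lambda>r. (1 + r) powr a) has_real_derivative a * (1 + r) powr (a - 1)) (at r)" for a
    using assms by (auto intro!: derivative_eq_intros)
  show "((\<lambda>r. (1 + r) powr - p) has_real_derivative - p * (1 + r) powr (- p - 1)) (at r)"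
    using d[of "- p"] by simp
  show "((\<lambda>r. - p * (1 + r) powr (- p - 1)) has_real_derivative p * (p + 1) * (1 + r) powr
      (- p - 2)) (at r)"
    using DERIV_cmult[OF d[of "- p - 1"], of "- p"] by (rule DERIV_cong) (simp add: algebra_simps)
qed

lemma expands_powr:
  fixes p :: real
  assumes "expands g g0 g1" "\<And>t x. g t x \<ge> 0" "\<And>x. g0 x \<ge> 0"
  shows "expands (\<lambda>t x. (1 + g t x) powr - p) (\<lambda>x. (1 + g0 x) powr - p)
     (\<lambda>t x. - p * (1 + g0 x) powr (- p - 1) * g1 t x)"
proof (rule expands_compose[OF powr_expansion_derivatives _ assms])
  show "continuous_on {0..} (\<lambda>r. p * (p + 1) * (1 + r) powr (- p - 2))"
    by (intro continuous_intros) auto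
qed

text \<open>The uniform remainder \<open>C * t\<^sup>2\<close> survives integration because the
  sphere has finite volume. Linearity in \<open>t\<close> is asked of the integral of
  \<open>g1 t\<close>, not of \<open>g1 t\<close> itself.\<close>

lemma integral_expands:
  fixes g :: "real \<Rightarrow> 'a::euclidean_space \<Rightarrow> real"
  assumes g: "expands g g0 g1" and e: "\<epsilon> > 0"
    and c: "\<And>t. \<bar>t\<bar> < \<epsilon> \<Longrightarrow> continuous_on (sphere 0 1) (g t)" "continuous_on (sphere 0 1) g0"
      "\<And>t. \<bar>t\<bar> < \<epsilon> \<Longrightarrow> continuous_on (sphere 0 1) (g1 t)"
    and L: "\<And>t. \<bar>t\<bar> < \<epsilon> \<Longrightarrow> (\<integral>x. g1 t x \<partial>sphere_volume) = L * t"
  shows "((\<lambda>t. \<integral>x. g t x \<partial>sphere_volume) has_real_derivative L) (at 0)"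
proof -
  let ?I = "\<lambda>t. \<integral>x. g t x \<partial>sphere_volume" and ?V = "measure (sphere_volume :: 'a measure)
      (sphere 0 1)"
  from g obtain C \<delta> where G: "\<delta> > 0" "C \<ge> 0"
    "\<And>t x. \<bar>t\<bar> < \<delta> \<Longrightarrow> x \<in> sphere 0 1 \<Longrightarrow> norm (g t x - g0 x - g1 t x) \<le> C * t\<^sup>2"
    by (rule expandsE) blast
  have b: "\<bar>?I t - (\<integral>x. g0 x \<partial>sphere_volume) - L * t\<bar> \<le> C * ?V * t\<^sup>2" if t: "\<bar>t\<bar> < min \<delta> \<epsilon>" for t
  proof -
    have t': "\<bar>t\<bar> < \<delta>" "\<bar>t\<bar> < \<epsilon>" using t by auto
    note int = integrable_sphere_continuous[OF c(1)[OF t'(2)]] integrable_sphere_continuous[OF c(2)]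
      integrable_sphere_continuous[OF c(3)[OF t'(2)]]
    have "?I t - (\<integral>x. g0 x \<partial>sphere_volume) - L * t = (\<integral>x. g t x - g0 x - g1 t x \<partial>sphere_volume)"
      using int by (simp add: L[OF t'(2)])
    also have "\<bar>\<dots>\<bar> \<le> (\<integral>x. \<bar>g t x - g0 x - g1 t x\<bar> \<partial>sphere_volume)"
      by (rule integral_abs_bound)
    also have "\<dots> \<le> (\<integral>x. C * t\<^sup>2 \<partial>(sphere_volume :: 'a measure))"
      using int G(3)[OF t'(1)] by (intro integral_mono) auto
    finally show ?thesis by (simp add: mult_ac)
  qed
  have I0: "?I 0 = (\<integral>x. g0 x \<partial>sphere_volume)" using b[of 0] G e by simp
  have "((\<lambda>t. (?I t - ?I 0) / t - L) \<longlongrightarrow> 0) (at 0)"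
  proof (rule Lim_null_comparison)
    have "((\<lambda>t. C * ?V * \<bar>t\<bar>) \<longlongrightarrow> C * ?V * \<bar>0\<bar>) (at 0)" by (intro tendsto_intros)
    then show "((\<lambda>t. C * ?V * \<bar>t\<bar>) \<longlongrightarrow> 0) (at 0)" by simp
    have "\<forall>\<^sub>F t in at 0. t \<noteq> 0 \<and> \<bar>t\<bar> < min \<delta> \<epsilon>"
      unfolding eventually_at using G e by (intro exI[of _ "min \<delta> \<epsilon>"]) auto
    then show "\<forall>\<^sub>F t in at 0. norm ((?I t - ?I 0) / t - L) \<le> C * ?V * \<bar>t\<bar>"
    proof eventually_elim
      case (elim t)
      then have "norm ((?I t - ?I 0) / t - L) = \<bar>?I t - ?I 0 - L * t\<bar> / \<bar>t\<bar>"
        by (simp add: abs_divide[symmetric] diff_divide_distrib)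
      also have "\<dots> \<le> C * ?V * t\<^sup>2 / \<bar>t\<bar>"
        using b[of t] elim I0 by (intro divide_right_mono) auto
      also have "\<dots> = C * ?V * \<bar>t\<bar>"  by (simp add: divide_simps power2_eq_square)
      finally show ?case .
    qed
  qed
  then have "((\<lambda>t. (?I t - ?I 0) / t) \<longlongrightarrow> L) (at 0)" by (rule Lim_null[THEN iffD2])
  then show ?thesis by (simp add: DERIV_def)
qed

section \<open>First variation of the vertical energy\<close>

text \<open>The sum of \<open>|\<nabla>s|^2\<close> and \<open>q |\<nabla>F|^2\<close> in the
  ambient form of \<open>vertical_energy_eq\<close>.\<close>

definition energy_quadratic :: "real \<Rightarrow> ('a::euclidean_space \<Rightarrow> 'a) \<Rightarrow> 'a \<Rightarrow> real" where
  "energy_quadratic q s x =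
     (\<Sum>b\<in>Basis. sphere_deriv s x (tproj x b) \<bullet> sphere_deriv s x (tproj x b)) - s x \<bullet> s x
       + q * (\<Sum>b\<in>Basis. (s x \<bullet> sphere_deriv s x (tproj x b))\<^sup>2)"

text \<open>Half the linearisation of \<open>energy_quadratic q\<close> at \<open>s\<close> in the
  direction \<open>\<eta>\<close>.\<close>

definition energy_bilinear :: "real \<Rightarrow> ('a::euclidean_space \<Rightarrow> 'a) \<Rightarrow> ('a \<Rightarrow> 'a) \<Rightarrow> 'a \<Rightarrow> real" where
  "energy_bilinear q s \<eta> x =
     (\<Sum>b\<in>Basis. sphere_deriv s x (tproj x b) \<bullet> sphere_deriv \<eta> x (tproj x b)) - s x \<bullet> \<eta> x
       + q * (\<Sum>b\<in>Basis. (s x \<bullet> sphere_deriv s x (tproj x b)) *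
           (s x \<bullet> sphere_deriv \<eta> x (tproj x b) + \<eta> x \<bullet> sphere_deriv s x (tproj x b)))"

text \<open>Half the linearisation at \<open>s\<close> of the energy density, weight included; with
  the factor 1/2 of the energy, its integral is the first variation itself.\<close>

definition energy_variation :: "real \<Rightarrow> real \<Rightarrow> ('a::euclidean_space \<Rightarrow> 'a) \<Rightarrow>
    ('a \<Rightarrow> 'a) \<Rightarrow> 'a \<Rightarrow> real" where
  "energy_variation p q s \<eta> x =
     (1 + s x \<bullet> s x) powr - p * energy_bilinear q s \<eta> x
     - p * (1 + s x \<bullet> s x) powr (- p - 1) * (s x \<bullet> \<eta> x) * energy_quadratic q s x"

lemma expands_cmult:
  fixes g :: "real \<Rightarrow> 'a::euclidean_space \<Rightarrow> real"
  assumes "expands g g0 g1"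
  shows "expands (\<lambda>t x. c * g t x) (\<lambda>x. c * g0 x) (\<lambda>t x. c * g1 t x)"
  using expands_mult[OF expands_const[of "\<lambda>x. c" "norm c"] assms] by simp

lemma expands_cong:
  fixes g :: "real \<Rightarrow> 'a::euclidean_space \<Rightarrow> 'b::real_normed_vector"
  assumes "expands g g0 g1" and e: "\<epsilon> > 0"
    and eq: "\<And>t x. \<bar>t\<bar> < \<epsilon> \<Longrightarrow> x \<in> sphere 0 1 \<Longrightarrow> g1 t x = h1 t x"
  shows "expands g g0 h1"
proof -
  from assms(1) obtain C \<delta> where G: "\<delta> > 0"
    "\<And>t x. \<bar>t\<bar> < \<delta> \<Longrightarrow> x \<in> sphere 0 1 \<Longrightarrow> norm (g0 x) \<le> C"
    "\<And>t x. \<bar>t\<bar> < \<delta> \<Longrightarrow> x \<in> sphere 0 1 \<Longrightarrow> norm (g1 t x) \<le> C * \<bar>t\<bar>"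
    "\<And>t x. \<bar>t\<bar> < \<delta> \<Longrightarrow> x \<in> sphere 0 1 \<Longrightarrow> norm (g t x - g0 x - g1 t x) \<le> C * t\<^sup>2"
    by (rule expandsE) blast
  show ?thesis
  proof (rule expandsI[of "min \<delta> \<epsilon>" _ C _ C _ C])
    fix t x assume t: "\<bar>t\<bar> < min \<delta> \<epsilon>" and x: "x \<in> sphere (0::'a) 1"
    then have t: "\<bar>t\<bar> < \<delta>" and "g1 t x = h1 t x" by (auto intro: eq)
    then show "norm (g0 x) \<le> C" "norm (h1 t x) \<le> C * \<bar>t\<bar>" "norm (g t x - g0 x - h1 t x) \<le> C * t\<^sup>2"
      using G(2-4)[OF t x] by auto
  qed (use G e in auto)
qed

lemma expands_lipschitz:
  fixes g :: "real \<Rightarrow> 'a::euclidean_space \<Rightarrow> 'b::real_normed_vector"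
  assumes s: "smooth_on ({-\<epsilon><..<\<epsilon>} \<times> sphere 0 1) (\<lambda>(t, x). g t x)" and e: "\<epsilon> > 0"
    and g0: "\<And>x. x \<in> sphere 0 1 \<Longrightarrow> g 0 x = g0 x"
  shows "expands g g0 (\<lambda>t x. g t x - g0 x)"
proof -
  obtain \<delta> C where C: "\<delta> > 0" "\<And>t y. \<bar>t\<bar> < \<delta> \<Longrightarrow> y \<in> sphere 0 1 \<Longrightarrow> norm (g t y - g 0 y) \<le> C * \<bar>t\<bar>"
    by (rule smooth_on_lipschitz[OF s e compact_sphere], rule that)
  have "continuous_on (sphere 0 1) (g 0)"
    by (rule smooth_on_continuous, rule smooth_on_slice[OF s]) (use e in auto)
  then have "bounded (g 0 ` sphere 0 1)" by (intro compact_imp_bounded compact_continuous_image)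
      auto
  then obtain A where A: "\<And>x. x \<in> sphere 0 1 \<Longrightarrow> norm (g 0 x) \<le> A" unfolding bounded_iff by
      (metis imageI)
  show ?thesis
    by (rule expandsI[of \<delta> _ A _ C _ 0]) (use A C g0 in \<open>auto simp del: mem_sphere\<close>)
qed

lemma expands_energy_quadratic:
  fixes \<Sigma> :: "real \<Rightarrow> 'a::euclidean_space \<Rightarrow> 'a"
  assumes s: "expands \<Sigma> s \<eta>"
    and d: "\<And>b. expands (\<lambda>t x. sphere_deriv (\<Sigma> t) x (tproj x b)) (\<lambda>x. sphere_deriv s x (tproj x b))
        (\<lambda>t x. sphere_deriv (\<eta> t) x (tproj x b))"
  shows "expands (\<lambda>t. energy_quadratic q (\<Sigma> t)) (energy_quadratic q s)
      (\<lambda>t x. 2 * energy_bilinear q s (\<eta> t) x)"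
proof -
  note f = finite_Basis
  have 1: "expands (\<lambda>t x. \<Sum>b\<in>Basis. sphere_deriv (\<Sigma> t) x (tproj x b) \<bullet> sphere_deriv (\<Sigma> t) x
      (tproj x b))
     (\<lambda>x. \<Sum>b\<in>Basis. sphere_deriv s x (tproj x b) \<bullet> sphere_deriv s x (tproj x b))
     (\<lambda>t x. \<Sum>b\<in>Basis. sphere_deriv s x (tproj x b) \<bullet> sphere_deriv (\<eta> t) x (tproj x b) +
        sphere_deriv (\<eta> t) x (tproj x b) \<bullet> sphere_deriv s x (tproj x b))"
    by (rule expands_sum[OF f]) (rule expands_inner[OF d d])
  have 2: "expands (\<lambda>t x. \<Sigma> t x \<bullet> \<Sigma> t x) (\<lambda>x. s x \<bullet> s x) (\<lambda>t x. s x \<bullet> \<eta> t x + \<eta> t x \<bullet> s x)"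
    by (rule expands_inner[OF s s])
  note 3 = expands_inner[OF s d]
  have 4: "expands (\<lambda>t x. \<Sum>b\<in>Basis. (\<Sigma> t x \<bullet> sphere_deriv (\<Sigma> t) x (tproj x b)) *
      (\<Sigma> t x \<bullet> sphere_deriv (\<Sigma> t) x (tproj x b)))
     (\<lambda>x. \<Sum>b\<in>Basis. (s x \<bullet> sphere_deriv s x (tproj x b)) * (s x \<bullet> sphere_deriv s x (tproj x b)))
     (\<lambda>t x. \<Sum>b\<in>Basis. (s x \<bullet> sphere_deriv s x (tproj x b)) *
          (s x \<bullet> sphere_deriv (\<eta> t) x (tproj x b) + \<eta> t x \<bullet> sphere_deriv s x (tproj x b)) +
        (s x \<bullet> sphere_deriv (\<eta> t) x (tproj x b) + \<eta> t x \<bullet> sphere_deriv s x (tproj x b)) *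
          (s x \<bullet> sphere_deriv s x (tproj x b)))"
    by (rule expands_sum[OF f]) (rule expands_mult[OF 3 3])
  note 5 = expands_add[OF expands_add[OF 1 expands_cmult[OF 2, of "- 1"]] expands_cmult[OF 4, of q]]
  have eq: "energy_quadratic q s' = (\<lambda>x. (\<Sum>b\<in>Basis. sphere_deriv s' x
      (tproj x b) \<bullet> sphere_deriv s' x (tproj x b)) + - 1 * (s' x \<bullet> s' x) +
      q * (\<Sum>b\<in>Basis. (s' x \<bullet> sphere_deriv s' x (tproj x b)) * (s' x \<bullet> sphere_deriv s' x
          (tproj x b))))" for s' :: "'a \<Rightarrow> 'a"
    by (simp add: fun_eq_iff energy_quadratic_def power2_eq_square)
  show ?thesis
    unfolding eq
    by (rule expands_cong[OF 5 zero_less_one])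
       (simp add: energy_bilinear_def inner_commute sum.distrib sum_distrib_left algebra_simps)
qed

lemma expands_energy_density:
  fixes \<Sigma> :: "real \<Rightarrow> 'a::euclidean_space \<Rightarrow> 'a"
  assumes s: "expands \<Sigma> s \<eta>"
    and d: "\<And>b. expands (\<lambda>t x. sphere_deriv (\<Sigma> t) x (tproj x b)) (\<lambda>x. sphere_deriv s x (tproj x b))
        (\<lambda>t x. sphere_deriv (\<eta> t) x (tproj x b))"
  shows "expands (\<lambda>t x. (1 + \<Sigma> t x \<bullet> \<Sigma> t x) powr - p * energy_quadratic q (\<Sigma> t) x)
     (\<lambda>x. (1 + s x \<bullet> s x) powr - p * energy_quadratic q s x) (\<lambda>t x. 2 * energy_variation p q s
         (\<eta> t) x)"
  by (rule expands_cong[OF expands_mult[OF expands_powr[OF expands_inner[OF s s]]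
      expands_energy_quadratic[OF s d]] zero_less_one])
     (auto simp: energy_variation_def inner_commute algebra_simps)

lemma continuous_on_energy_quadratic:
  assumes s: "sphere_C1 s"
  shows "continuous_on (sphere 0 1) (energy_quadratic q s)"
proof -
  note c = sphere_C1_continuous[OF s] continuous_on_sphere_deriv_tproj[OF s]
  show ?thesis unfolding energy_quadratic_def[abs_def] by (intro continuous_intros c)
qed

lemma continuous_on_energy_bilinear:
  assumes s: "sphere_C1 s" and h: "sphere_C1 \<eta>"
  shows "continuous_on (sphere 0 1) (energy_bilinear q s \<eta>)"
proof -
  note c = sphere_C1_continuous[OF s] continuous_on_sphere_deriv_tproj[OF s]
    sphere_C1_continuous[OF h] continuous_on_sphere_deriv_tproj[OF h]
  show ?thesis unfolding energy_bilinear_def[abs_def] by (intro continuous_intros c)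
qed

lemma one_plus_inner_neq_0: "1 + v \<bullet> v \<noteq> (0::real)"
  using inner_ge_zero[of v] by linarith

lemma continuous_on_energy_variation:
  assumes s: "sphere_C1 s" and h: "sphere_C1 \<eta>"
  shows "continuous_on (sphere 0 1) (energy_variation p q s \<eta>)"
proof -
  note c = sphere_C1_continuous[OF s] sphere_C1_continuous[OF h]
    continuous_on_energy_quadratic[OF s] continuous_on_energy_bilinear[OF s h]
  show ?thesis unfolding energy_variation_def[abs_def]
    by (intro continuous_intros c) (simp_all add: one_plus_inner_neq_0)
qed

lemma energy_variation_scaleR:
  assumes h: "sphere_C1 \<eta>" and x: "x \<in> sphere 0 1"
  shows "energy_variation p q s (\<lambda>y. t *\<^sub>R \<eta> y) x = t * energy_variation p q s \<eta> x"
proof -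
  have d: "sphere_deriv (\<lambda>y. t *\<^sub>R \<eta> y) x (tproj x b) = t *\<^sub>R sphere_deriv \<eta> x (tproj x b)" for b
    using sphere_deriv_scaleR[OF sphere_C1_const h x tproj_tangent[OF x], of t b]
    by (simp add: sphere_deriv_const[OF x tproj_tangent[OF x]])
  have "energy_bilinear q s (\<lambda>y. t *\<^sub>R \<eta> y) x = t * energy_bilinear q s \<eta> x"
    unfolding energy_bilinear_def d by (simp add: sum_distrib_left algebra_simps)
  then show ?thesis by (simp add: energy_variation_def algebra_simps)
qed

lemma smooth_variation_slice:
  assumes v: "smooth_variation s \<epsilon> \<Sigma>" and t: "\<bar>t\<bar> < \<epsilon>"
  shows "vector_field (\<Sigma> t)"
proof -
  have "t \<in> {-\<epsilon><..<\<epsilon>}" using t by auto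
  then show ?thesis
    using v smooth_on_slice unfolding smooth_variation_def vector_field_def by blast
qed

text \<open>The hypothesis on \<open>L\<close> wants the integrated variation of the full increment
  to be exactly \<open>L * t\<close>. This holds for \<open>s + t \<eta>\<close> by linearity, and
  with \<open>L = 0\<close> for every variation once the linearised energy vanishes on all vector
  fields, so one statement serves both directions of the characterisation.\<close>

lemma first_variation:
  assumes n: "levi_civita nabla" and s: "vector_field s" and v: "smooth_variation s \<epsilon> \<Sigma>"
    and L: "\<And>t. \<bar>t\<bar> < \<epsilon> \<Longrightarrow> (\<integral>x. energy_variation p q s (\<lambda>y. \<Sigma> t y - s y) x \<partial>sphere_volume) = L * t"
  shows "((\<lambda>t. vertical_energy nabla p q (\<Sigma> t)) has_real_derivative L) (at 0)"
proof -
  let ?S = "sphere (0::'a) 1"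
  have e: "\<epsilon> > 0" and sm: "smooth_on ({-\<epsilon><..<\<epsilon>} \<times> ?S) (\<lambda>(t, x). \<Sigma> t x)"
    and S0: "\<And>x. x \<in> ?S \<Longrightarrow> \<Sigma> 0 x = s x"
    using v by (auto simp: smooth_variation_def)
  note vf = smooth_variation_slice[OF v]
  note C1 = vector_field_C1[OF s] vector_field_C1[OF vf]
  let ?\<eta> = "\<lambda>t y. \<Sigma> t y - s y"
  have \<eta>C: "sphere_C1 (?\<eta> t)" if "\<bar>t\<bar> < \<epsilon>" for t
  proof (rule sphere_C1I)
    show "(?\<eta> t has_derivative (\<lambda>v. sphere_deriv (\<Sigma> t) x v - sphere_deriv s x v))
        (at x within ?S)" if "x \<in> ?S" for x
      by (intro has_derivative_diff sphere_C1_has_derivative C1 \<open>\<bar>t\<bar> < \<epsilon>\<close> that)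
    show "continuous_on ?S (\<lambda>x. sphere_deriv (\<Sigma> t) x (tproj x a) - sphere_deriv s x (tproj x a))"
        for a
      using continuous_on_sphere_deriv_tproj[OF C1(1)] continuous_on_sphere_deriv_tproj[OF
          C1(2)[OF that]]
      by (intro continuous_on_diff)
  qed
  have ex: "expands \<Sigma> s ?\<eta>" by (rule expands_lipschitz[OF sm e S0])
  \<comment> \<open>The spatial derivative of the increment is the increment of the spatial
    derivatives, and the latter is Lipschitz in \<open>t\<close> by joint smoothness.\<close>
  have exd: "expands (\<lambda>t x. sphere_deriv (\<Sigma> t) x (tproj x b)) (\<lambda>x. sphere_deriv s x (tproj x b))
      (\<lambda>t x. sphere_deriv (?\<eta> t) x (tproj x b))" for b
  proof (rule expands_cong[OF _ e])
    show "expands (\<lambda>t x. sphere_deriv (\<Sigma> t) x (tproj x b)) (\<lambda>x. sphere_deriv s x (tproj x b))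
      (\<lambda>t x. sphere_deriv (\<Sigma> t) x (tproj x b) - sphere_deriv s x (tproj x b))"
    proof (rule expands_lipschitz[OF smooth_on_slice_deriv[OF sm] e])
      fix x assume x: "x \<in> ?S"
      \<comment> \<open>\<open>\<Sigma> 0\<close> and \<open>s\<close> are only known to agree on
        the sphere, so the derivative is transferred within the sphere.\<close>
      have "(\<Sigma> 0 has_derivative sphere_deriv s x) (at x within ?S)"
        by (rule has_derivative_transform[OF x S0 sphere_C1_has_derivative[OF C1(1) x]])
      then show "sphere_deriv (\<Sigma> 0) x (tproj x b) = sphere_deriv s x (tproj x b)"
        by (rule sphere_deriv_eq[OF _ x tproj_tangent[OF x]])
    qed
    show "sphere_deriv (\<Sigma> t) x (tproj x b) - sphere_deriv s x (tproj x b) = sphere_deriv (?\<eta> t) x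
        (tproj x b)"
      if "\<bar>t\<bar> < \<epsilon>" "x \<in> ?S" for t x
      using sphere_deriv_diff[OF C1(2)[OF that(1)] C1(1) that(2) tproj_tangent[OF that(2)]] by simp
  qed
  have dc: "continuous_on ?S (\<lambda>x. (1 + s' x \<bullet> s' x) powr - p * energy_quadratic q s' x)" if
      "sphere_C1 s'" for s'
    using sphere_C1_continuous[OF that] continuous_on_energy_quadratic[OF that]
    by (intro continuous_intros) (simp_all add: one_plus_inner_neq_0)
  have "((\<lambda>t. \<integral>x. (1 + \<Sigma> t x \<bullet> \<Sigma> t x) powr - p * energy_quadratic q
      (\<Sigma> t) x \<partial>sphere_volume) has_real_derivative 2 * L) (at 0)"
  proof (rule integral_expands[OF expands_energy_density[OF ex exd] e])
    show "continuous_on ?S (\<lambda>x. 2 * energy_variation p q s (?\<eta> t) x)" if "\<bar>t\<bar> < \<epsilon>" for t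
      by (intro continuous_on_mult continuous_on_const continuous_on_energy_variation C1 \<eta>C that)
  qed (auto simp: L intro: dc C1)
  from DERIV_cmult[OF this, of "1/2"]
  have "((\<lambda>t. 1 / 2 * (\<integral>x. (1 + \<Sigma> t x \<bullet> \<Sigma> t x) powr - p * energy_quadratic q
      (\<Sigma> t) x \<partial>sphere_volume)) has_real_derivative L) (at 0)"
    by simp
  then show ?thesis
  \<comment> \<open>The ambient form of the energy requires \<open>\<Sigma> t\<close> to be a vector
    field, which is known for \<open>\<bar>t\<bar> < \<epsilon>\<close>.\<close>
  proof (rule has_field_derivative_transform_within_open)
    show "open {-\<epsilon><..<\<epsilon>}" "0 \<in> {-\<epsilon><..<\<epsilon>}" using e by auto
    show "1 / 2 * (\<integral>x. (1 + \<Sigma> t x \<bullet> \<Sigma> t x) powr - p * energy_quadratic q (\<Sigma> t) x \<partial>sphere_volume)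
        = vertical_energy nabla p q (\<Sigma> t)"
      if "t \<in> {-\<epsilon><..<\<epsilon>}" for t
    proof -
      have "\<bar>t\<bar> < \<epsilon>" using that by auto
      then show ?thesis by (simp add: vertical_energy_eq[OF n vf] energy_quadratic_def)
    qed
  qed
qed

text \<open>Forward, the affine family \<open>s + t \<eta>\<close> realises any vector field as a
  direction. Backward, the increment of an arbitrary variation is at each time itself a vector
  field, since tangent spaces are linear, so the vanishing applies to it directly.\<close>

lemma harmonic_section_iff:
  fixes s :: "'a::euclidean_space \<Rightarrow> 'a"
  assumes n: "levi_civita nabla"
  shows "harmonic_section nabla p q s \<longleftrightarrow> vector_field s \<and>
     (\<forall>\<eta>. vector_field \<eta> \<longrightarrow> (\<integral>x. energy_variation p q s \<eta> x \<partial>sphere_volume) = 0)"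
    (is "_ \<longleftrightarrow> _ \<and> ?R")
proof -
  have "?R" if s: "vector_field s" and h: "harmonic_section nabla p q s"
  proof (intro allI impI)
    fix \<eta> :: "'a \<Rightarrow> 'a" assume \<eta>: "vector_field \<eta>"
    define \<Sigma> where "\<Sigma> t x = s x + t *\<^sub>R \<eta> x" for t x
    have "smooth_on ({-1<..<1::real} \<times> sphere 0 1) (\<lambda>z. s (snd z) + fst z *\<^sub>R \<eta> (snd z))"
      using s \<eta> unfolding vector_field_def
      by (intro smooth_on_add smooth_on_bilinear[OF bounded_bilinear_scaleR] smooth_on_snd
          smooth_on_linear[OF bounded_linear_fst]) auto
    then have "smooth_on ({-1<..<1} \<times> sphere 0 1) (\<lambda>(t, x). \<Sigma> t x)"
      by (simp add: \<Sigma>_def case_prod_beta')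
    then have v: "smooth_variation s 1 \<Sigma>"
      using s \<eta> by (auto simp: smooth_variation_def \<Sigma>_def vector_field_def tangent_def
          inner_add_right)
    have "((\<lambda>t. vertical_energy nabla p q (\<Sigma> t)) has_real_derivative
        (\<integral>x. energy_variation p q s \<eta> x \<partial>sphere_volume)) (at 0)"
    proof (rule first_variation[OF n s v])
      fix t
      have "(\<lambda>y. \<Sigma> t y - s y) = (\<lambda>y. t *\<^sub>R \<eta> y)" by (simp add: \<Sigma>_def)
      moreover have "(\<integral>x. energy_variation p q s (\<lambda>y. t *\<^sub>R \<eta> y) x \<partial>sphere_volume) =
          (\<integral>x. t * energy_variation p q s \<eta> x \<partial>sphere_volume)"
        by (rule Bochner_Integration.integral_cong[OF refl]) (simp add: energy_variation_scaleR[OF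
            vector_field_C1[OF \<eta>]])
      ultimately show "(\<integral>x. energy_variation p q s (\<lambda>y. \<Sigma> t y - s y) x \<partial>sphere_volume) =
          (\<integral>x. energy_variation p q s \<eta> x \<partial>sphere_volume) * t" by (simp add: mult.commute)
    qed
    moreover have "((\<lambda>t. vertical_energy nabla p q (\<Sigma> t)) has_real_derivative 0) (at 0)"
      using h v by (auto simp: harmonic_section_def)
    ultimately show "(\<integral>x. energy_variation p q s \<eta> x \<partial>sphere_volume) = 0" by (rule DERIV_unique)
  qed
  moreover have "harmonic_section nabla p q s" if s: "vector_field s" and R: "?R"
    unfolding harmonic_section_def
  proof (intro conjI allI impI s)
    fix \<epsilon> \<Sigma> assume v: "smooth_variation s \<epsilon> \<Sigma>"
    show "((\<lambda>t. vertical_energy nabla p q (\<Sigma> t)) has_real_derivative 0) (at 0)"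
    proof (rule first_variation[OF n s v])
      fix t assume t: "\<bar>t\<bar> < \<epsilon>"
      have "smooth_on (sphere 0 1) (\<lambda>y. \<Sigma> t y + (- 1) *\<^sub>R s y)"
        using smooth_variation_slice[OF v t] s unfolding vector_field_def
        by (intro smooth_on_add smooth_on_bilinear[OF bounded_bilinear_scaleR] smooth_on_const) auto
      then have "vector_field (\<lambda>y. \<Sigma> t y - s y)"
        using smooth_variation_slice[OF v t] s by (auto simp: vector_field_def tangent_def
            inner_diff_right)
      then show "(\<integral>x. energy_variation p q s (\<lambda>y. \<Sigma> t y - s y) x \<partial>sphere_volume) = 0 * t" using R
          by simp
    qed
  qed
  moreover have "vector_field s" if "harmonic_section nabla p q s" using that by
      (simp add: harmonic_section_def)
  ultimately show ?thesis by blast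
qed

section \<open>Multiples of the Hopf field\<close>

lemma linear_hopf: "linear (hopf :: complex ^ 'n \<Rightarrow> _)"
  unfolding hopf_def by (rule linearI) (simp_all add: vec_eq_iff algebra_simps)

lemma bounded_linear_hopf: "bounded_linear (hopf :: complex ^ 'n \<Rightarrow> _)"
  using linear_hopf by (rule linear_conv_bounded_linear[THEN iffD1])

lemma hopf_hopf [simp]: "hopf (hopf x) = - x"
  by (simp add: hopf_def vec_eq_iff)

lemma inner_hopf_skew: "hopf x \<bullet> y = - (x \<bullet> hopf y)"
  by (simp add: hopf_def inner_vec_def inner_complex_def sum_negf[symmetric] algebra_simps)

lemma inner_hopf_hopf [simp]: "hopf x \<bullet> hopf y = x \<bullet> y"
  by (simp add: inner_hopf_skew)

lemma inner_hopf_self [simp]: "hopf x \<bullet> x = 0" "x \<bullet> hopf x = 0"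
proof -
  show "hopf x \<bullet> x = 0" using inner_hopf_skew[of x x] by (simp add: inner_commute)
  then show "x \<bullet> hopf x = 0" by (simp add: inner_commute)
qed

lemmas hopf_simps = linear_add[OF linear_hopf] linear_diff[OF linear_hopf] linear_scale[OF
    linear_hopf]

lemma vector_field_hopf: "vector_field hopf"
  by (simp add: vector_field_def tangent_def smooth_on_linear[OF bounded_linear_hopf])

lemma vector_field_scaleR:
  assumes "smooth_on (sphere 0 1) u" "vector_field X"
  shows "vector_field (\<lambda>x. u x *\<^sub>R X x)"
  using assms smooth_on_bilinear[OF bounded_bilinear_scaleR] by (auto
      simp: vector_field_def tangent_def)

lemma sphere_deriv_cong:
  assumes w: "sphere_C1 w" and eq: "\<And>y. y \<in> sphere 0 1 \<Longrightarrow> u y = w y"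
    and x: "x \<in> sphere 0 1" "v \<in> tangent x"
  shows "sphere_deriv u x v = sphere_deriv w x v"
  by (rule sphere_deriv_eq[OF has_derivative_transform[OF x(1) eq sphere_C1_has_derivative[OF w
      x(1)]] x])

lemma sphere_deriv_eq_0:
  assumes "\<And>y. y \<in> sphere 0 1 \<Longrightarrow> u y = c" "x \<in> sphere 0 1" "v \<in> tangent x"
  shows "sphere_deriv u x v = 0"
  using sphere_deriv_cong[OF sphere_C1_const, of u c x v] sphere_deriv_const[of x v c] assms by simp

lemma sphere_deriv_scaleR_hopf:
  fixes f :: "complex ^ 'n \<Rightarrow> real"
  assumes f: "sphere_C1 f" and x: "x \<in> sphere 0 1" "v \<in> tangent x"
  shows "sphere_deriv (\<lambda>y. f y *\<^sub>R hopf y) x v = f x *\<^sub>R hopf v + sphere_deriv f x v *\<^sub>R hopf x"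
  using sphere_deriv_scaleR[OF f sphere_C1_bounded_linear[OF bounded_linear_hopf] x]
  by (simp add: sphere_deriv_bounded_linear[OF bounded_linear_hopf x])

section \<open>Horizontal variations force a constant factor\<close>

text \<open>The function \<open>(1 + r\<^sup>2) powr - p * r\<close> at \<open>r = f x\<close> is
  the coefficient of the derivatives of the test field in the linearised energy; integration by
  parts moves a derivative onto it. Lowering the exponent to \<open>- p - 1\<close> exposes the
  polynomial factor.\<close>

lemma weight_derivative:
  fixes p :: real
  shows "((\<lambda>r. (1 + r\<^sup>2) powr - p * r) has_real_derivative
     (1 + r\<^sup>2) powr (- p - 1) * (1 + r\<^sup>2 - 2 * p * r\<^sup>2)) (at r)"
proof -
  have pos: "1 + r\<^sup>2 > 0" using zero_le_power2[of r] by linarith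
  have e: "(1 + r\<^sup>2) powr - p = (1 + r\<^sup>2) powr (- p - 1) * (1 + r\<^sup>2)"
    using powr_add[of "1 + r\<^sup>2" "- p - 1" 1] pos by simp
  have i: "((\<lambda>r. 1 + r\<^sup>2) has_real_derivative 2 * r) (at r)"
    by (auto intro!: derivative_eq_intros)
  have d: "((\<lambda>r. (1 + r\<^sup>2) powr - p) has_real_derivative - p * (1 + r\<^sup>2) powr (- p - 1) * (2 * r))
      (at r)"
    using DERIV_chain2[OF has_real_derivative_powr[OF pos, of "- p"] i] by simp
  have alg: "- p * X * (2 * r) * r + 1 * (X * (1 + r\<^sup>2)) = X * (1 + r\<^sup>2 - 2 * p * r\<^sup>2)"
      for X :: real
    by (simp add: power2_eq_square algebra_simps)
  show ?thesis
    by (rule DERIV_cong[OF DERIV_mult[OF d DERIV_ident]]) (simp only: e alg)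
qed

text \<open>Orthogonality kills the variation of the weight and the \<open>q\<close>-term, leaving
  \<open>(1 + f^2) powr - p\<close> times \<open>f dv + df(hopf \<alpha>)\<close>. Integrating the
  \<open>dv\<close> term by parts turns it into a second multiple of
  \<open>df(hopf \<alpha>)\<close>, and the coefficients add up as
  \<open>(1 + f^2) + (1 + f^2 - 2 p f^2) = 2 (1 + (1 - p) f^2)\<close>.\<close>

lemma integral_energy_variation_horizontal:
  fixes f :: "complex ^ 'n \<Rightarrow> real"
  assumes f: "sphere_C1 f" and a: "vector_field \<alpha>" and h: "\<And>x. x \<in> sphere 0 1 \<Longrightarrow> hopf x \<bullet> \<alpha> x = 0"
  shows "(\<integral>x. energy_variation p q (\<lambda>x. f x *\<^sub>R hopf x) \<alpha> x \<partial>sphere_volume) =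
    (\<integral>x. 2 * (1 + (f x)\<^sup>2) powr (- p - 1) * (1 + (1 - p) * (f x)\<^sup>2) * sphere_deriv f x (hopf
        (\<alpha> x)) \<partial>sphere_volume)"
proof -
  let ?S = "sphere (0 :: complex ^ 'n) 1" and ?\<sigma> = "\<lambda>x. f x *\<^sub>R hopf x"
  define W where "W x = (1 + (f x)\<^sup>2) powr - p * f x" for x
  define W' where "W' r = (1 + r\<^sup>2) powr (- p - 1) * (1 + r\<^sup>2 - 2 * p * r\<^sup>2)" for r :: real
  define dv where "dv x = (\<Sum>b\<in>Basis. hopf (tproj x b) \<bullet> sphere_deriv \<alpha> x (tproj x b))" for x
  have nz: "1 + r\<^sup>2 \<noteq> 0" for r :: real using zero_le_power2[of r] by linarith
  have hC: "sphere_C1 (hopf :: complex ^ 'n \<Rightarrow> _)" by (rule sphere_C1_bounded_linear[OF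
      bounded_linear_hopf])
  have \<alpha>C: "sphere_C1 \<alpha>" by (rule vector_field_C1[OF a])
  have \<sigma>C: "sphere_C1 ?\<sigma>" by (rule sphere_C1_scaleR[OF f hC])
  have cW': "continuous_on UNIV W'" unfolding W'_def by (intro continuous_intros) (simp add: nz)
  have dWr: "((\<lambda>r. (1 + r\<^sup>2) powr - p * r) has_real_derivative W' r) (at r)" for r
    unfolding W'_def by (rule weight_derivative)
  have WC: "sphere_C1 W" unfolding W_def by (rule sphere_C1_compose[OF dWr cW' f])
  have dW: "sphere_deriv W x v = W' (f x) * sphere_deriv f x v" if "x \<in> ?S" "v \<in> tangent x" for x v
    unfolding W_def by (rule sphere_deriv_compose[OF dWr f that])
  have ht: "hopf (\<alpha> x) \<in> tangent x" if "x \<in> ?S" for x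
    using h[OF that] by (simp add: tangent_def inner_hopf_skew)
  have fc: "continuous_on ?S f" by (rule sphere_C1_continuous[OF f])
  have dfc: "continuous_on ?S (\<lambda>x. sphere_deriv f x (hopf (\<alpha> x)))"
    by (rule sphere_C1_continuous_deriv[OF f linear_continuous_on_compose[OF
        sphere_C1_continuous[OF \<alpha>C] linear_hopf] ht])
  have dvc: "continuous_on ?S dv"
    unfolding dv_def tproj_def
    by (intro continuous_intros linear_continuous_on_compose[OF _ linear_hopf]
        continuous_on_sphere_deriv_tproj[OF \<alpha>C, unfolded tproj_def])
  have Wc: "continuous_on ?S W" by (rule sphere_C1_continuous[OF WC])
  have W'c: "continuous_on ?S (\<lambda>x. W' (f x))" by (rule continuous_on_compose2[OF cW' fc]) auto
  have ev: "energy_variation p q ?\<sigma> \<alpha> x = (1 + (f x)\<^sup>2) powr - p * sphere_deriv f x (hopf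
      (\<alpha> x)) + W x * dv x"
    if x: "x \<in> ?S" for x
  proof -
    have xx: "x \<bullet> x = 1" using x by (simp add: norm_eq_1)
    have 0: "?\<sigma> x \<bullet> \<alpha> x = 0" using h[OF x] by simp
    \<comment> \<open>This is the derivative of \<open>?\<sigma> y \<bullet> \<alpha> y = 0\<close>,
      and exactly the second factor of each \<open>q\<close>-summand in
      \<open>energy_bilinear\<close>.\<close>
    have 1: "?\<sigma> x \<bullet> sphere_deriv \<alpha> x (tproj x b) + \<alpha> x \<bullet> sphere_deriv ?\<sigma> x (tproj x b) = 0" for b
      using sphere_deriv_inner[OF \<sigma>C \<alpha>C x tproj_tangent[OF x], of b]
        sphere_deriv_eq_0[of "\<lambda>y. ?\<sigma> y \<bullet> \<alpha> y" 0, OF _ x tproj_tangent[OF x]] h by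
            (simp add: inner_commute)
    \<comment> \<open>Differentiating \<open>hopf y \<bullet> \<alpha> y = 0\<close> trades a
      derivative of \<open>\<alpha>\<close> for \<open>\<alpha>\<close> itself.\<close>
    have 2: "hopf x \<bullet> sphere_deriv \<alpha> x (tproj x b) = hopf (\<alpha> x) \<bullet> tproj x b" for b
    proof -
      have "hopf x \<bullet> sphere_deriv \<alpha> x (tproj x b) + hopf (tproj x b) \<bullet> \<alpha> x = 0"
        using sphere_deriv_inner[OF hC \<alpha>C x tproj_tangent[OF x], of b]
          sphere_deriv_eq_0[of "\<lambda>y. hopf y \<bullet> \<alpha> y" 0, OF _ x tproj_tangent[OF x]] h
        by (simp add: sphere_deriv_bounded_linear[OF bounded_linear_hopf x tproj_tangent[OF x]])
      moreover have "hopf (tproj x b) \<bullet> \<alpha> x = - (hopf (\<alpha> x) \<bullet> tproj x b)"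
        by (metis inner_hopf_skew inner_commute)
      ultimately show ?thesis by linarith
    qed
    have "(\<Sum>b\<in>Basis. sphere_deriv ?\<sigma> x (tproj x b) \<bullet> sphere_deriv \<alpha> x (tproj x b)) =
        f x * dv x + (\<Sum>b\<in>Basis. (hopf (\<alpha> x) \<bullet> tproj x b) * sphere_deriv f x (tproj x b))"
      by (simp add: sphere_deriv_scaleR_hopf[OF f x tproj_tangent[OF x]] inner_add_left
          sum.distrib dv_def
          sum_distrib_left 2 mult.commute)
    also have "(\<Sum>b\<in>Basis. (hopf (\<alpha> x) \<bullet> tproj x b) * sphere_deriv f x (tproj x b))
        = sphere_deriv f x (hopf (\<alpha> x))"
    proof -
      have "hopf (\<alpha> x) \<bullet> tproj x b = hopf (\<alpha> x) \<bullet> b" for b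
        by (simp add: inner_tproj_left[symmetric] tproj_id[OF ht[OF x]])
      then show ?thesis using sphere_deriv_expansion[OF f x ht[OF x]] by simp
    qed
    finally have "energy_bilinear q ?\<sigma> \<alpha> x = f x * dv x + sphere_deriv f x (hopf (\<alpha> x))"
      unfolding energy_bilinear_def 1 using 0 by simp
    moreover have "?\<sigma> x \<bullet> ?\<sigma> x = (f x)\<^sup>2" using xx by (simp add: power2_eq_square)
    ultimately show ?thesis
      unfolding energy_variation_def using 0 by (simp only: W_def) (simp add: algebra_simps)
  qed
  \<comment> \<open>The skew divergence formula for the field
    \<open>W x *\<^sub>R \<alpha> x\<close>; its right-hand side contains
    \<open>\<alpha> x \<bullet> hopf x\<close> and therefore vanishes.\<close>
  have "(\<integral>x. W x * dv x - W' (f x) * sphere_deriv f x (hopf (\<alpha> x)) \<partial>sphere_volume) =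
      (\<integral>x. (\<Sum>b\<in>Basis. hopf (tproj x b) \<bullet> sphere_deriv (\<lambda>x. W x *\<^sub>R \<alpha> x) x
          (tproj x b)) \<partial>sphere_volume)"
  proof (rule Bochner_Integration.integral_cong[OF refl])
    fix x :: "complex ^ 'n" assume "x \<in> space sphere_volume"
    then have x: "x \<in> ?S" by simp
    note t = tproj_tangent[OF x]
    have "(\<Sum>b\<in>Basis. hopf (tproj x b) \<bullet> sphere_deriv (\<lambda>x. W x *\<^sub>R \<alpha> x) x (tproj x b)) =
        W x * dv x - (\<Sum>b\<in>Basis. (hopf (\<alpha> x) \<bullet> tproj x b) * sphere_deriv W x (tproj x b))"
      by (simp add: sphere_deriv_scaleR[OF WC \<alpha>C x t] inner_add_right sum.distrib dv_def
          sum_distrib_left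
          inner_hopf_skew[of "tproj _ _" "\<alpha> _"] sum_subtractf mult.commute inner_commute[of _
              "hopf (\<alpha> _)"])
    also have "(\<Sum>b\<in>Basis. (hopf (\<alpha> x) \<bullet> tproj x b) * sphere_deriv W x (tproj x b))
        = sphere_deriv W x (hopf (\<alpha> x))"
    proof -
      have "hopf (\<alpha> x) \<bullet> tproj x b = hopf (\<alpha> x) \<bullet> b" for b
        by (simp add: inner_tproj_left[symmetric] tproj_id[OF ht[OF x]])
      then show ?thesis using sphere_deriv_expansion[OF WC x ht[OF x]] by simp
    qed
    finally show "W x * dv x - W' (f x) * sphere_deriv f x (hopf (\<alpha> x)) =
        (\<Sum>b\<in>Basis. hopf (tproj x b) \<bullet> sphere_deriv (\<lambda>x. W x *\<^sub>R \<alpha> x) x (tproj x b))"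
      by (simp add: dW[OF x ht[OF x]])
  qed
  also have "\<dots> = (real DIM(complex ^ 'n) - 1) * (\<integral>x. (W x *\<^sub>R \<alpha> x) \<bullet> hopf x \<partial>sphere_volume)"
    by (rule integral_sphere_skew_divergence[OF sphere_C1_scaleR[OF WC \<alpha>C] linear_hopf
        inner_hopf_skew])
  also have "(\<integral>x. (W x *\<^sub>R \<alpha> x) \<bullet> hopf x \<partial>sphere_volume) = (\<integral>x. 0 \<partial>(sphere_volume ::
      (complex ^ 'n) measure))"
    by (rule Bochner_Integration.integral_cong[OF refl]) (simp add: h inner_commute)
  finally have 0: "(\<integral>x. W x * dv x - W' (f x) * sphere_deriv f x (hopf (\<alpha> x)) \<partial>sphere_volume) = 0"
      by simp
  have "(\<integral>x. energy_variation p q ?\<sigma> \<alpha> x \<partial>sphere_volume) =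
      (\<integral>x. (2 * (1 + (f x)\<^sup>2) powr (- p - 1) * (1 + (1 - p) * (f x)\<^sup>2) * sphere_deriv f x (hopf
          (\<alpha> x)))
        + (W x * dv x - W' (f x) * sphere_deriv f x (hopf (\<alpha> x))) \<partial>sphere_volume)"
  proof (rule Bochner_Integration.integral_cong[OF refl])
    fix x :: "complex ^ 'n" assume "x \<in> space sphere_volume"
    then have x: "x \<in> ?S" by simp
    have pos: "1 + (f x)\<^sup>2 > 0" using zero_le_power2[of "f x"] by linarith
    have e: "(1 + (f x)\<^sup>2) powr - p = (1 + (f x)\<^sup>2) powr (- p - 1) * (1 + (f x)\<^sup>2)"
      using powr_add[of "1 + (f x)\<^sup>2" "- p - 1" 1] pos by simp
    show "energy_variation p q ?\<sigma> \<alpha> x =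
        (2 * (1 + (f x)\<^sup>2) powr (- p - 1) * (1 + (1 - p) * (f x)\<^sup>2) * sphere_deriv f x (hopf (\<alpha> x)))
        + (W x * dv x - W' (f x) * sphere_deriv f x (hopf (\<alpha> x)))"
      unfolding ev[OF x] W'_def e by (simp add: algebra_simps)
  qed
  also have "\<dots> = (\<integral>x. 2 * (1 + (f x)\<^sup>2) powr (- p - 1) * (1 + (1 - p) *
      (f x)\<^sup>2) * sphere_deriv f x (hopf (\<alpha> x)) \<partial>sphere_volume)
      + (\<integral>x. W x * dv x - W' (f x) * sphere_deriv f x (hopf (\<alpha> x)) \<partial>sphere_volume)"
    by (intro Bochner_Integration.integral_add integrable_sphere_continuous continuous_intros fc
        dfc dvc Wc W'c) (simp add: nz)
  finally show ?thesis using 0 by simp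
qed

text \<open>The test field is built from the quantity that has to vanish: with
  \<open>u = (1 + (1 - p) f^2) df(H)\<close> and \<open>\<alpha> = u hopf(H)\<close> one has
  \<open>hopf \<alpha> = - u H\<close>, so the linearised energy is minus the integral of a positive
  weight times \<open>u^2\<close>. Hence \<open>u = 0\<close> everywhere, in particular at
  \<open>x\<close>, where \<open>H\<close> takes the value \<open>v\<close>.\<close>

lemma harmonic_horizontal_derivative:
  fixes f :: "complex ^ 'n \<Rightarrow> real"
  assumes n: "levi_civita nabla" and fs: "smooth_on (sphere 0 1) f"
    and har: "harmonic_section nabla p q (\<lambda>x. f x *\<^sub>R hopf x)"
    and x: "x \<in> sphere 0 1" and v: "v \<bullet> x = 0" "v \<bullet> hopf x = 0"
  shows "(1 + (1 - p) * (f x)\<^sup>2) * sphere_deriv f x v = 0"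
proof -
  let ?S = "sphere (0 :: complex ^ 'n) 1"
  \<comment> \<open>On the sphere this is the part of the constant vector \<open>v\<close>
    orthogonal to \<open>y\<close> and \<open>hopf y\<close>, written with sums and multiples by -1
    to fit the closure rules of \<open>smooth_on\<close>.\<close>
  define H where "H y = v + (- 1) *\<^sub>R ((v \<bullet> y) *\<^sub>R y) + (- 1) *\<^sub>R ((v \<bullet> hopf y) *\<^sub>R hopf y)" for y
  define u where "u y = (1 + (1 - p) * (f y * f y)) * sphere_deriv f y (H y)" for y
  define \<alpha> where "\<alpha> y = u y *\<^sub>R hopf (H y)" for y
  have yy: "y \<bullet> y = 1" if "y \<in> ?S" for y using that by (simp add: norm_eq_1)
  have Hy: "y \<bullet> H y = 0" "hopf y \<bullet> H y = 0" if "y \<in> ?S" for y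
    using yy[OF that] by (simp_all add: H_def inner_add_right inner_diff_right inner_commute)
  have sl: "smooth_on ?S (\<lambda>y. y)" "smooth_on ?S hopf"
    by (rule smooth_on_linear[OF bounded_linear_ident], rule smooth_on_linear[OF
        bounded_linear_hopf])
  note sb = smooth_on_bilinear[OF bounded_bilinear_scaleR] smooth_on_bilinear[OF
      bounded_bilinear_inner]
    smooth_on_bilinear[OF bounded_bilinear_mult]
  have Hs: "smooth_on ?S H"
    unfolding H_def by (intro smooth_on_add sb smooth_on_const sl)
  have HV: "vector_field H" using Hs Hy by (simp add: vector_field_def tangent_def)
  have us: "smooth_on ?S u"
    unfolding u_def by (rule sb(3)[OF smooth_on_add[OF smooth_on_const sb(3)[OF smooth_on_const
        sb(3)[OF fs fs]]] smooth_on_sphere_deriv[OF HV fs]])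
  have hH: "smooth_on ?S (\<lambda>y. hopf (H y))"
  proof -
    have "hopf (H y) = hopf v + (- 1) *\<^sub>R ((v \<bullet> y) *\<^sub>R hopf y) + (v \<bullet> hopf y) *\<^sub>R y" for y
      by (simp add: H_def hopf_simps linear_neg[OF linear_hopf])
    then show ?thesis by (simp only:) (intro smooth_on_add sb smooth_on_const sl)
  qed
  have "y \<bullet> hopf (H y) = 0" if "y \<in> ?S" for y
    using inner_hopf_skew[of y "H y"] Hy(2)[OF that] by simp
  then have hHV: "vector_field (\<lambda>y. hopf (H y))"
    using hH by (simp add: vector_field_def tangent_def)
  have \<alpha>V: "vector_field \<alpha>" unfolding \<alpha>_def by (rule vector_field_scaleR[OF us hHV])
  have \<alpha>h: "hopf y \<bullet> \<alpha> y = 0" if "y \<in> ?S" for y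
    using Hy[OF that] by (simp add: \<alpha>_def)
  have fC: "sphere_C1 f" by (rule sphere_C1_smooth[OF fs])
  have fc: "continuous_on ?S f" by (rule sphere_C1_continuous[OF fC])
  have uc: "continuous_on ?S u" by (rule smooth_on_continuous[OF us])
  have nz: "1 + r\<^sup>2 \<noteq> 0" for r :: real using zero_le_power2[of r] by linarith
  have "(\<integral>y. 2 * (1 + (f y)\<^sup>2) powr (- p - 1) * (u y)\<^sup>2 \<partial>sphere_volume) =
     - (\<integral>y. 2 * (1 + (f y)\<^sup>2) powr (- p - 1) * (1 + (1 - p) * (f y)\<^sup>2) * sphere_deriv f y (hopf
         (\<alpha> y)) \<partial>sphere_volume)"
    unfolding integral_minus[symmetric]
  proof (rule Bochner_Integration.integral_cong[OF refl])
    fix y :: "complex ^ 'n" assume "y \<in> space sphere_volume"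
    then have y: "y \<in> ?S" by simp
    have "hopf (\<alpha> y) = - u y *\<^sub>R H y" by (simp add: \<alpha>_def hopf_simps)
    then have "sphere_deriv f y (hopf (\<alpha> y)) = - u y * sphere_deriv f y (H y)"
      by (simp only: linear_scale[OF sphere_C1_linear[OF fC y]] real_scaleR_def)
    then show "2 * (1 + (f y)\<^sup>2) powr (- p - 1) * (u y)\<^sup>2 =
       - (2 * (1 + (f y)\<^sup>2) powr (- p - 1) * (1 + (1 - p) * (f y)\<^sup>2) * sphere_deriv f y (hopf
           (\<alpha> y)))"
      by (simp add: u_def power2_eq_square)
  qed
  also have "\<dots> = 0"
  proof -
    have "(\<integral>y. energy_variation p q (\<lambda>x. f x *\<^sub>R hopf x) \<alpha> y \<partial>sphere_volume) = 0"
      using har \<alpha>V unfolding harmonic_section_iff[OF n] by blast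
    from trans[OF integral_energy_variation_horizontal[OF fC \<alpha>V \<alpha>h, symmetric] this] show ?thesis
      by simp
  qed
  finally have "2 * (1 + (f x)\<^sup>2) powr (- p - 1) * (u x)\<^sup>2 = 0"
    by (intro integral_sphere_eq_0_imp[OF _ _ _ x, of "\<lambda>y. 2 * (1 + (f y)\<^sup>2) powr (- p - 1) *
        (u y)\<^sup>2"])
       (auto intro!: continuous_intros fc uc simp: nz)
  then have "u x = 0" using nz[of "f x"] by simp
  moreover have "H x = v" using v by (simp add: H_def)
  ultimately show ?thesis by (simp add: u_def power2_eq_square)
qed

text \<open>Great circles in horizontal directions stay horizontal.\<close>

lemma constant_along_horizontal_circle:
  fixes f :: "complex ^ 'n \<Rightarrow> real"
  assumes f: "sphere_C1 f"
    and h: "\<And>x v. x \<in> sphere 0 1 \<Longrightarrow> v \<bullet> x = 0 \<Longrightarrow> v \<bullet> hopf x = 0 \<Longrightarrow>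
       (1 + a * (f x)\<^sup>2) * sphere_deriv f x v = 0"
    and x: "x \<in> sphere 0 1" and v: "v \<in> sphere 0 1" "v \<bullet> x = 0" "v \<bullet> hopf x = 0"
  shows "f (cos t *\<^sub>R x + sin t *\<^sub>R v) + a / 3 * f (cos t *\<^sub>R x + sin t *\<^sub>R v) ^ 3
      = f x + a / 3 * f x ^ 3"
proof -
  define c where "c t = cos t *\<^sub>R x + sin t *\<^sub>R v" for t
  define c' where "c' t = - sin t *\<^sub>R x + cos t *\<^sub>R v" for t
  have xx: "x \<bullet> x = 1" "v \<bullet> v = 1" "x \<bullet> v = 0" "hopf x \<bullet> v = 0" "x \<bullet> hopf v = 0" "v \<bullet> hopf v = 0"
    using x v inner_hopf_skew[of x v] by (simp_all add: norm_eq_1 inner_commute)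
  have cc: "c t \<bullet> c t = (cos t)\<^sup>2 + (sin t)\<^sup>2" for t
    using xx v by (simp add: c_def inner_add_left inner_add_right power2_eq_square)
  then have cS: "c t \<in> sphere 0 1" for t by (simp add: norm_eq_1)
  have ct: "c' t \<bullet> c t = 0" "c' t \<bullet> hopf (c t) = 0" for t
    using xx v by (simp_all add: c_def c'_def inner_add_left inner_add_right inner_diff_left
        hopf_simps mult.commute)
  have dc: "(c has_vector_derivative c' t) (at t)" for t
  proof -
    have "(cos has_vector_derivative - sin t) (at t)" "(sin has_vector_derivative cos t) (at t)"
      unfolding has_real_derivative_iff_has_vector_derivative[symmetric] by
          (rule DERIV_cos DERIV_sin)+
    note * = this[THEN bounded_linear.has_vector_derivative[OF bounded_linear_scaleR_left]]
    show ?thesis unfolding c_def c'_def by (intro has_vector_derivative_add *)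
  qed
  have d: "((\<lambda>t. f (c t)) has_real_derivative sphere_deriv f (c t) (c' t)) (at t)" for t
    unfolding has_real_derivative_iff_has_vector_derivative
    by (rule curve_derivative[OF dc _ sphere_C1_has_derivative[OF f cS]]) (use cS in blast)
  \<comment> \<open>The cubic is the primitive of \<open>1 + a r^2\<close>, so its derivative along
    the circle is the quantity assumed to vanish.\<close>
  have "((\<lambda>t. f (c t) + a / 3 * f (c t) ^ 3) has_real_derivative 0) (at t)" for t
  proof -
    have "((\<lambda>t. f (c t) + a / 3 * f (c t) ^ 3) has_real_derivative
        sphere_deriv f (c t) (c' t) + a / 3 * (3 * f (c t) ^ 2 * sphere_deriv f (c t) (c' t)))
            (at t)"
      using DERIV_add[OF d DERIV_cmult[OF DERIV_power[OF d, of 3], of "a / 3"]] by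
          (simp add: mult_ac)
    moreover have "sphere_deriv f (c t) (c' t) + a / 3 * (3 * f (c t) ^ 2 * sphere_deriv f (c t)
        (c' t)) =
        (1 + a * (f (c t))\<^sup>2) * sphere_deriv f (c t) (c' t)"
      by (simp add: algebra_simps)
    ultimately show ?thesis using h[OF cS ct] by simp
  qed
  from DERIV_isconst_all[OF allI[OF this], of t 0] show ?thesis by (simp add: c_def)
qed

text \<open>Horizontal circles also connect points of one Hopf fibre: \<open>x\<close> and a phase
  multiple \<open>x'\<close> of it both reach a common horizontal \<open>v\<close> after a quarter
  turn. If the phase makes \<open>y\<close> orthogonal to \<open>hopf x'\<close>, then
  \<open>y\<close> lies on a horizontal circle through \<open>x'\<close>. So \<open>g\<close> is
  constant on the sphere, and \<open>f\<close> takes values among the finitely many roots of a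
  cubic.\<close>

lemma horizontal_constant_imp_constant:
  fixes f :: "complex ^ 'n \<Rightarrow> real"
  assumes n: "CARD('n) \<ge> 2" and f: "sphere_C1 f"
    and h: "\<And>x v. x \<in> sphere 0 1 \<Longrightarrow> v \<bullet> x = 0 \<Longrightarrow> v \<bullet> hopf x = 0 \<Longrightarrow>
       (1 + a * (f x)\<^sup>2) * sphere_deriv f x v = 0"
  obtains k where "\<And>x. x \<in> sphere 0 1 \<Longrightarrow> f x = k"
proof -
  let ?S = "sphere (0 :: complex ^ 'n) 1"
  define g where "g x = f x + a / 3 * f x ^ 3" for x
  have circle: "g (cos t *\<^sub>R x + sin t *\<^sub>R v) = g x"
    if "x \<in> ?S" "v \<in> ?S" "v \<bullet> x = 0" "v \<bullet> hopf x = 0" for x v t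
    unfolding g_def by (rule constant_along_horizontal_circle[OF f h that])
  have perp: "\<exists>v\<in>?S. v \<bullet> x = 0 \<and> v \<bullet> hopf x = 0" for x :: "complex ^ 'n"
  proof -
    \<comment> \<open>Two real linear conditions in a real dimension of at least 4.\<close>
    have "dim {x, hopf x} \<le> card {x, hopf x}" by (rule dim_le_card') simp
    also have "\<dots> \<le> 2" by (simp add: card_insert_if)
    finally have "dim {x, hopf x} < DIM(complex ^ 'n)" using n by simp
    then obtain w where w: "w \<noteq> 0" "\<And>y. y \<in> span {x, hopf x} \<Longrightarrow> orthogonal w y"
      by (rule orthogonal_to_subspace_exists) blast
    have "w \<bullet> x = 0" "w \<bullet> hopf x = 0" using w(2)[of x] w(2)[of "hopf x"]
      by (auto simp: orthogonal_def span_base)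
    then show ?thesis using w(1) by (intro bexI[of _ "w /\<^sub>R norm w"]) auto
  qed
  have const: "g x = g y" if x: "x \<in> ?S" and y: "y \<in> ?S" for x y
  proof -
    have xx: "x \<bullet> x = 1" "y \<bullet> y = 1" using x y by (simp_all add: norm_eq_1)
    obtain v where v: "v \<in> ?S" "v \<bullet> x = 0" "v \<bullet> hopf x = 0" using perp by blast
    define \<alpha> \<beta> where "\<alpha> = x \<bullet> y" and "\<beta> = hopf x \<bullet> y"
    \<comment> \<open>The unit number \<open>c + i s\<close> is the phase of
      \<open>\<alpha> + i \<beta>\<close>, which makes
      \<open>hopf x' \<bullet> y = c * \<beta> - s * \<alpha>\<close> vanish; for
      \<open>\<alpha> = \<beta> = 0\<close> any phase does.\<close>
    obtain c s where cs: "c\<^sup>2 + s\<^sup>2 = 1" "c * \<beta> = s * \<alpha>"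
    proof (cases "\<alpha>\<^sup>2 + \<beta>\<^sup>2 = 0")
      case True
      then have "\<alpha> = 0" "\<beta> = 0" by (simp_all add: sum_power2_eq_zero_iff)
      then show thesis using that[of 1 0] by simp
    next
      case False
      define \<rho> where "\<rho> = sqrt (\<alpha>\<^sup>2 + \<beta>\<^sup>2)"
      have "\<rho>\<^sup>2 = \<alpha>\<^sup>2 + \<beta>\<^sup>2" "\<rho> \<noteq> 0" using False by (simp_all add: \<rho>_def)
      then have "(\<alpha> / \<rho>)\<^sup>2 + (\<beta> / \<rho>)\<^sup>2 = 1"
        using False by (auto simp: power_divide add_divide_distrib[symmetric])
      then show thesis using that[of "\<alpha> / \<rho>" "\<beta> / \<rho>"] by simp
    qed
    define x' where "x' = c *\<^sub>R x + s *\<^sub>R hopf x"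
    have hx': "hopf x' = c *\<^sub>R hopf x - s *\<^sub>R x" by (simp add: x'_def hopf_simps)
    have x'x': "x' \<bullet> x' = 1"
      using cs(1) xx by (simp add: x'_def inner_add_left inner_add_right power2_eq_square)
    then have x'S: "x' \<in> ?S" by (simp add: norm_eq_1)
    have vx': "v \<bullet> x' = 0" "v \<bullet> hopf x' = 0"
      unfolding hx' using v by (simp_all add: x'_def inner_add_right inner_diff_right)
    have "g x = g x'" using circle[OF x v, of "pi / 2"] circle[OF x'S v(1) vx', of "pi / 2"] by simp
    define r where "r = x' \<bullet> y"
    define w where "w = y - r *\<^sub>R x'"
    have hy: "hopf x' \<bullet> y = 0"
      unfolding hx' using cs(2) by (simp add: inner_diff_left \<alpha>_def \<beta>_def)
    have w: "w \<bullet> x' = 0" "w \<bullet> hopf x' = 0"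
      using hy x'x' by (simp_all add: w_def r_def inner_diff_left inner_diff_right inner_commute)
    have "y = r *\<^sub>R x' + w" by (simp add: w_def)
    then have "y \<bullet> y = r\<^sup>2 + w \<bullet> w"
      using w(1) x'x' by (simp add: inner_add_left inner_add_right inner_commute power2_eq_square)
    then have "r\<^sup>2 + (norm w)\<^sup>2 = 1" using xx by (simp add: power2_norm_eq_inner)
    then obtain t where t: "r = cos t" "norm w = sin t" using sincos_total_pi[OF norm_ge_zero]
        by blast
    have "\<exists>e\<in>?S. e \<bullet> x' = 0 \<and> e \<bullet> hopf x' = 0 \<and> w = norm w *\<^sub>R e"
    proof (cases "w = 0")
      \<comment> \<open>Here \<open>y\<close> is \<open>x'\<close> or \<open>- x'\<close>, and every
        horizontal great circle through \<open>x'\<close> passes through both.\<close>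
      case True
      then show ?thesis using v(1) vx' by (intro bexI[of _ v]) auto
    next
      case False
      then show ?thesis using w by (intro bexI[of _ "w /\<^sub>R norm w"]) auto
    qed
    then obtain e where e: "e \<in> ?S" "e \<bullet> x' = 0" "e \<bullet> hopf x' = 0" "w = norm w *\<^sub>R e" by blast
    have "y = cos t *\<^sub>R x' + sin t *\<^sub>R e" using \<open>y = r *\<^sub>R x' + w\<close> e(4) t by simp
    then have "g y = g x'" using circle[OF x'S e(1-3)] by simp
    with \<open>g x = g x'\<close> show ?thesis by simp
  qed
  obtain x0 where x0: "x0 \<in> ?S" using perp by blast
  \<comment> \<open>The linear coefficient 1 keeps the polynomial nonzero also when
    \<open>a = 0\<close>.\<close>
  have "f ` ?S \<subseteq> {r. poly [:- g x0, 1, 0, a / 3:] r = 0}"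
  proof
    fix r assume "r \<in> f ` ?S"
    then obtain x where x: "x \<in> ?S" "r = f x" by blast
    have "g x = g x0" by (rule const[OF x(1) x0])
    then show "r \<in> {r. poly [:- g x0, 1, 0, a / 3:] r = 0}"
      using x(2) by (simp add: g_def power3_eq_cube algebra_simps)
  qed
  moreover have "finite {r. poly [:- g x0, 1, 0, a / 3:] r = 0}" by (rule poly_roots_finite) simp
  ultimately have fin: "finite (f ` ?S)" by (rule finite_subset)
  have "connected (f ` ?S)"
    by (intro connected_continuous_image sphere_C1_continuous f connected_sphere) (use n in simp)
  with fin x0 obtain k where "f ` ?S = {k}" using connected_finite_iff_sing by blast
  then show thesis by (intro that[of k]) blast
qed

section \<open>Constant multiples of the Hopf field\<close>

text \<open>Each summand is \<open>1 - (x \<bullet> b)\<^sup>2\<close>; the sum is the trace of the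
  tangent projection, that is, the dimension of the sphere.\<close>

lemma sum_norm_tproj:
  fixes x :: "'a::euclidean_space"
  assumes "x \<in> sphere 0 1"
  shows "(\<Sum>b\<in>Basis. tproj x b \<bullet> tproj x b) = real DIM('a) - 1"
proof -
  have xx: "x \<bullet> x = 1" using assms by (simp add: norm_eq_1)
  have "(\<Sum>b\<in>Basis. tproj x b \<bullet> tproj x b) = (\<Sum>b\<in>Basis. 1 - (x \<bullet> b) * (x \<bullet> b))"
    by (rule sum.cong[OF refl]) (simp add: tproj_def inner_diff_left inner_diff_right xx
        inner_commute)
  then show ?thesis using xx euclidean_inner[of x x] by (simp add: sum_subtractf)
qed

text \<open>With \<open>N\<close> the real dimension, \<open>energy_quadratic\<close> is
  \<open>c^2 (N - 1) - c^2\<close>, and the trace term integrates to \<open>N - 1\<close> times the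
  integral of \<open>\<eta> \<bullet> hopf\<close>. The coefficients then combine as \<open>(1 +
  c^2) (N - 1) - (1 + c^2 + p c^2 (N - 2)) = (N - 2) (1 + (1 - p) c^2)\<close>.\<close>

lemma integral_energy_variation_constant:
  fixes f :: "complex ^ 'n \<Rightarrow> real"
  assumes f: "\<And>x. x \<in> sphere 0 1 \<Longrightarrow> f x = c" and \<eta>: "vector_field \<eta>"
  shows "(\<integral>x. energy_variation p q (\<lambda>x. f x *\<^sub>R hopf x) \<eta> x \<partial>sphere_volume) =
    c * (real DIM(complex ^ 'n) - 2) * (1 + c\<^sup>2) powr (- p - 1) * (1 + (1 - p) * c\<^sup>2) *
      (\<integral>x. \<eta> x \<bullet> hopf x \<partial>sphere_volume)"
proof -
  let ?S = "sphere (0 :: complex ^ 'n) 1" and ?\<sigma> = "\<lambda>x. f x *\<^sub>R hopf x" and ?N =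
      "real DIM(complex ^ 'n)"
  define P where "P = (1 + c\<^sup>2) powr (- p - 1)"
  define dv where "dv x = (\<Sum>b\<in>Basis. hopf (tproj x b) \<bullet> sphere_deriv \<eta> x (tproj x b))" for x
  have pos: "1 + c\<^sup>2 > 0" using zero_le_power2[of c] by linarith
  have e: "(1 + c\<^sup>2) powr - p = P * (1 + c\<^sup>2)"
    using powr_add[of "1 + c\<^sup>2" "- p - 1" 1] pos by (simp add: P_def)
  have \<eta>C: "sphere_C1 \<eta>" by (rule vector_field_C1[OF \<eta>])
  have ch: "continuous_on ?S (\<lambda>x. \<eta> x \<bullet> hopf x)"
    by (intro continuous_intros sphere_C1_continuous[OF \<eta>C] linear_continuous_on
        bounded_linear_hopf)
  have dvc: "continuous_on ?S dv"
    unfolding dv_def tproj_def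
    by (intro continuous_intros linear_continuous_on_compose[OF _ linear_hopf]
        continuous_on_sphere_deriv_tproj[OF \<eta>C, unfolded tproj_def])
  have "(\<integral>x. energy_variation p q ?\<sigma> \<eta> x \<partial>sphere_volume) =
      (\<integral>x. c * P * ((1 + c\<^sup>2) * dv x) - c * P * ((1 + c\<^sup>2 + p * c\<^sup>2 * (?N - 2)) *
          (\<eta> x \<bullet> hopf x)) \<partial>sphere_volume)"
  proof (rule Bochner_Integration.integral_cong[OF refl])
    fix x :: "complex ^ 'n" assume "x \<in> space sphere_volume"
    then have x: "x \<in> ?S" by simp
    have xx: "x \<bullet> x = 1" using x by (simp add: norm_eq_1)
    have d: "sphere_deriv ?\<sigma> x (tproj x b) = c *\<^sub>R hopf (tproj x b)" for b
    proof -
      have "bounded_linear (\<lambda>y. c *\<^sub>R hopf y :: complex ^ 'n)"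
        by (intro bounded_linear_scaleR_right[THEN bounded_linear_compose] bounded_linear_hopf)
      then show ?thesis
        using sphere_deriv_cong[OF sphere_C1_bounded_linear, of "\<lambda>y. c *\<^sub>R hopf y" ?\<sigma>,
            OF _ _ x tproj_tangent[OF x]]
          sphere_deriv_bounded_linear[OF _ x tproj_tangent[OF x], of "\<lambda>y. c *\<^sub>R hopf y"] f by simp
    qed
    \<comment> \<open>Since \<open>hopf\<close> is an isometry, this also says
      \<open>hopf x \<bullet> hopf (tproj x b) = 0\<close>, which makes the \<open>q\<close>-terms
      vanish.\<close>
    have 0: "x \<bullet> tproj x b = 0" for b using tproj_tangent[OF x, of b] by (simp add: tangent_def)
    have "energy_quadratic q ?\<sigma> x = c\<^sup>2 * (?N - 2)"
      unfolding energy_quadratic_def d f[OF x]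
      by (simp add: xx 0 sum_norm_tproj[OF x] power2_eq_square sum_distrib_left[symmetric]
          algebra_simps del: DIM_cart)
    moreover have "energy_bilinear q ?\<sigma> \<eta> x = c * dv x - c * (\<eta> x \<bullet> hopf x)"
      unfolding energy_bilinear_def d f[OF x]
      by (simp add: 0 dv_def sum_distrib_left inner_commute)
    moreover have "?\<sigma> x \<bullet> ?\<sigma> x = c\<^sup>2" by (simp add: f[OF x] xx power2_eq_square)
    moreover have "?\<sigma> x \<bullet> \<eta> x = c * (\<eta> x \<bullet> hopf x)" by (simp add: f[OF x] inner_commute)
    ultimately show "energy_variation p q ?\<sigma> \<eta> x =
        c * P * ((1 + c\<^sup>2) * dv x) - c * P * ((1 + c\<^sup>2 + p * c\<^sup>2 * (?N - 2)) * (\<eta> x \<bullet> hopf x))"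
      unfolding energy_variation_def by (simp only: e P_def[symmetric])
          (simp add: algebra_simps power2_eq_square del: DIM_cart)
  qed
  also have "\<dots> = c * P * ((1 + c\<^sup>2) * (\<integral>x. dv x \<partial>sphere_volume)) -
      c * P * ((1 + c\<^sup>2 + p * c\<^sup>2 * (?N - 2)) * (\<integral>x. \<eta> x \<bullet> hopf x \<partial>sphere_volume))"
    using integrable_sphere_continuous[OF dvc] integrable_sphere_continuous[OF ch]
    by (subst Bochner_Integration.integral_diff) (simp_all del: DIM_cart)
  also have "(\<integral>x. dv x \<partial>sphere_volume) = (?N - 1) * (\<integral>x. \<eta> x \<bullet> hopf x \<partial>sphere_volume)"
    unfolding dv_def by (rule integral_sphere_skew_divergence[OF \<eta>C linear_hopf inner_hopf_skew])
  finally show ?thesis unfolding P_def[symmetric] by (simp add: algebra_simps del: DIM_cart)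
qed

text \<open>The prefactor in the integrated variation is nonzero: \<open>c\<close> by assumption,
  and \<open>N - 2\<close> because the real dimension \<open>N\<close> is twice
  \<open>CARD('n)\<close>, hence at least 4. Testing with the Hopf field itself, whose pairing with
  \<open>hopf\<close> has nonzero integral, isolates the condition
  \<open>1 + (1 - p) * c\<^sup>2 = 0\<close>.\<close>

lemma constant_harmonic_section_iff:
  fixes f :: "complex ^ 'n \<Rightarrow> real"
  assumes "CARD('n) \<ge> 2" and n: "levi_civita nabla" and fs: "smooth_on (sphere 0 1) f"
    and f: "\<And>x. x \<in> sphere 0 1 \<Longrightarrow> f x = c" and c: "c \<noteq> 0"
  shows "harmonic_section nabla p q (\<lambda>x. f x *\<^sub>R hopf x) \<longleftrightarrow> (p - 1) * c\<^sup>2 = 1"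
proof -
  let ?I = "\<lambda>\<eta>. \<integral>x. \<eta> x \<bullet> hopf x \<partial>(sphere_volume :: (complex ^ 'n) measure)"
  have pos: "1 + c\<^sup>2 > 0" using zero_le_power2[of c] by linarith
  have "?I hopf \<noteq> 0"
  proof
    assume 0: "?I hopf = 0"
    have 1: "hopf x \<bullet> hopf x = 0" if "x \<in> sphere 0 1" for x :: "complex ^ 'n"
      by (rule integral_sphere_eq_0_imp[OF _ _ 0 that]) (auto intro!: continuous_intros)
    obtain b :: "complex ^ 'n" where "b \<in> Basis" using nonempty_Basis by blast
    then have "norm b = 1" by (rule norm_Basis)
    with 1[of b] show False by (simp add: norm_eq_1)
  qed
  have "vector_field (\<lambda>x. f x *\<^sub>R hopf x)" by (rule vector_field_scaleR[OF fs vector_field_hopf])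
  moreover have "(\<integral>x. energy_variation p q (\<lambda>x. f x *\<^sub>R hopf x) \<eta> x \<partial>sphere_volume) = 0 \<longleftrightarrow>
      (1 + (1 - p) * c\<^sup>2) * ?I \<eta> = 0" if "vector_field \<eta>" for \<eta>
    by (subst integral_energy_variation_constant[OF f that]) (use assms(1) c pos in simp_all)
  ultimately have "harmonic_section nabla p q (\<lambda>x. f x *\<^sub>R hopf x) \<longleftrightarrow>
      (\<forall>\<eta> :: complex ^ 'n \<Rightarrow> complex ^ 'n. vector_field \<eta> \<longrightarrow> (1 + (1 - p) * c\<^sup>2) * ?I \<eta> = 0)"
    unfolding harmonic_section_iff[OF n] by blast
  also have "\<dots> \<longleftrightarrow> 1 + (1 - p) * c\<^sup>2 = 0"
    using \<open>?I hopf \<noteq> 0\<close> vector_field_hopf by (metis mult_eq_0_iff)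
  finally show ?thesis by (auto simp: algebra_simps)
qed

text \<open>For \<open>p \<le> 1\<close> the left-hand side of the equation is nonpositive, so the
  equation itself forces \<open>p > 1\<close>.\<close>

lemma square_eq_inverse_iff:
  fixes p c :: real
  shows "(p - 1) * c\<^sup>2 = 1 \<longleftrightarrow> p > 1 \<and> (c = 1 / sqrt (p - 1) \<or> c = - 1 / sqrt (p - 1))"
proof
  assume h: "(p - 1) * c\<^sup>2 = 1"
  have p: "p > 1"
  proof (rule ccontr)
    assume "\<not> p > 1"
    then have "(p - 1) * c\<^sup>2 \<le> 0" by (intro mult_nonpos_nonneg) auto
    with h show False by simp
  qed
  then have "c\<^sup>2 = (1 / sqrt (p - 1))\<^sup>2" using h by (simp add: power_divide field_simps)
  then show "p > 1 \<and> (c = 1 / sqrt (p - 1) \<or> c = - 1 / sqrt (p - 1))"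
    using p by (auto simp: power2_eq_iff)
qed (auto simp: power_divide)

theorem theorem5p4:
  fixes f :: "complex ^ 'n \<Rightarrow> real" and p q :: real and m :: nat
    and nabla :: "complex ^ 'n \<Rightarrow> complex ^ 'n \<Rightarrow> (complex ^ 'n \<Rightarrow> complex ^ 'n) \<Rightarrow> complex ^ 'n"
  assumes "CARD('n) = m + 1" and "m \<ge> 1"
    and "levi_civita nabla"
    and "smooth_on (sphere 0 1) f"
  shows "harmonic_section nabla p q (\<lambda>x. f x *\<^sub>R hopf x) \<and>
           (\<exists>x\<in>sphere 0 1. f x *\<^sub>R hopf x \<noteq> 0)
         \<longleftrightarrow>
         p > 1 \<and> ((\<forall>x\<in>sphere 0 1. f x = 1 / sqrt (p - 1)) \<or>
                  (\<forall>x\<in>sphere 0 1. f x = - 1 / sqrt (p - 1)))"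
    (is "?L \<longleftrightarrow> ?R")
proof
  have n2: "CARD('n) \<ge> 2" using assms(1,2) by simp
  {
    assume L: ?L
    have h: "(1 + (1 - p) * (f x)\<^sup>2) * sphere_deriv f x v = 0"
      if "x \<in> sphere 0 1" "v \<bullet> x = 0" "v \<bullet> hopf x = 0" for x v
      by (rule harmonic_horizontal_derivative[OF assms(3,4) conjunct1[OF L] that])
    obtain c where c: "\<And>x. x \<in> sphere 0 1 \<Longrightarrow> f x = c"
      using horizontal_constant_imp_constant[OF n2 sphere_C1_smooth[OF assms(4)] h] by metis
    \<comment> \<open>Non-triviality enters here: for \<open>c = 0\<close> the linearised energy
      vanishes whatever \<open>p\<close> is.\<close>
    have "c \<noteq> 0" using L c by force
    then have "(p - 1) * c\<^sup>2 = 1"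
      using constant_harmonic_section_iff[OF n2 assms(3,4) c] L by blast
    then show ?R unfolding square_eq_inverse_iff using c by auto
  next
    assume R: ?R
    then obtain c where c: "\<And>x. x \<in> sphere 0 1 \<Longrightarrow> f x = c" "p > 1"
        "c = 1 / sqrt (p - 1) \<or> c = - 1 / sqrt (p - 1)" by blast
    then have pc: "(p - 1) * c\<^sup>2 = 1" unfolding square_eq_inverse_iff by simp
    then have c0: "c \<noteq> 0" by auto
    have "harmonic_section nabla p q (\<lambda>x. f x *\<^sub>R hopf x)"
      using constant_harmonic_section_iff[OF n2 assms(3,4) c(1) c0] pc by simp
    moreover have "\<exists>x\<in>sphere 0 1. f x *\<^sub>R hopf x \<noteq> 0"
    proof -
      obtain x :: "complex ^ 'n" where "x \<in> Basis" using nonempty_Basis by blast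
      then have x: "x \<in> sphere 0 1" using norm_Basis by simp
      have "hopf x \<bullet> hopf x = 1" using x by (simp add: norm_eq_1)
      then have "hopf x \<noteq> 0" by (metis inner_zero_left zero_neq_one)
      then show ?thesis using x c(1) c0 by (intro bexI[of _ x]) auto
    qed
    ultimately show ?L by blast
  }
qed

end
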